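(* Let $k\ge2$ and let $u\in C^k(\bar D\times[0,T])$ be the unique classical solution of the semilinear parabolic problem $$u_t=\Delta u+f(u)\ \text{ in } D\times(0,T),\qquad u(x,0)=\bar u(x)\ \ (x\in D),\qquad u(x,t)=0\ \ (x\in\partial D,\ t\in(0,T)),$$ where $f:\mathbb{R}\to\mathbb{R}$ satisfies $|f(v)-f(w)|\le C_f|v-w|$ for all $v,w\in\mathbb{R}$. Let $u^{\ast}=u_{\theta^{\ast}}$ be a PINN generated by the PINN algorithm with the loss function given in the context. Then the generalization error $\mathcal{E}_G=\big(\int_0^T\int_D|u-u^{\ast}|^2\,dx\,dt\big)^{1/2}$ satisfies $$\mathcal{E}_G\le C_1\Big(\mathcal{E}_T^{tb}+\mathcal{E}_T^{int}+C_2(\mathcal{E}_T^{sb})^{\frac12}+(C_{quad}^{tb})^{\frac12}N_{tb}^{-\frac{\alpha_{tb}}2}+(C_{quad}^{int})^{\frac12}N_{int}^{-\frac{\alpha_{int}}2}+C_2(C_{quad}^{sb})^{\frac14}N_{sb}^{-\frac{\alpha_{sb}}4}\Big),$$ with $$C_1=\sqrt{T+(1+2C_f)T^2e^{(1+2C_f)T}},\qquad C_2=\sqrt{C_{\partial D}(u,u^{\ast})\,T^{\frac12}},$$ $$C_{\partial D}(u,u^\ast)=|\partial D|^{\frac12}\big(\|u\|_{C^1([0,T]\times\partial D)}+\|u^{\ast}\|_{C^1([0,T]\times\partial D)}\big),$$ and $C_{quad}^{tb}=C_{quad}^{tb}(\|\mathcal{R}_{tb,\theta^{\ast}}^2\|_{C^k})$,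 $C_{quad}^{sb}=C_{quad}^{sb}(\|\mathcal{R}_{sb,\theta^{\ast}}^2\|_{C^k})$, $C_{quad}^{int}=C_{quad}^{int}(\|\mathcal{R}_{int,\theta^{\ast}}^2\|_{C^{k-2}})$ the constants of the quadrature error bounds in the context.
   Context: $D\subset\mathbb{R}^d$ is an open, connected, bounded set with $C^k$ boundary $\partial D$ of surface measure $|\partial D|$; $T>0$; $\bar u\in C^k(D)$. The norm $\|\cdot\|_{C^1([0,T]\times\partial D)}$ is the supremum over $[0,T]\times\partial D$ of the function and all its first-order derivatives (including the full spatial gradient). Neural networks $u_\theta$, $\theta\in\Theta\subset\mathbb{R}^M$, are compositions of affine maps and a smooth componentwise scalar activation function (e.g. $\tanh$), with $u_\theta\in C^k([0,T]\times\bar D)$. Residuals: $\mathcal{R}_{int,\theta}=\partial_tu_\theta-\Delta u_\theta-f(u_\theta)$ on $D\times(0,T)$, taken to be in $C^{k-2}([0,T]\times\bar D)$; $\mathcal{R}_{sb,\theta}(x,t)=u_\theta(x,t)$ for $x\in\partial D$, $t\in(0,T]$; $\mathcal{R}_{tb,\theta}(x)=u_\theta(x,0)-\bar u(x)$ for $x\in D$. Training points and positive quadrature weights: $N_{int}$ interior points $(x_n,t_n)\in D\times(0,T)$ with weights $w_n^{int}$; $N_{sb}$ points $(x_n,t_n)$ with $x_n\in\partial D$, weights $w_n^{sb}$; $N_{tb}$ points $x_n\in D$, weights $w_n^{tb}$. Assumed quadrature bounds, with $\alpha_{tb},\alpha_{sb},\alpha_{int}>0$: $$\Big|\int_Dg\,dx-\sum_{n=1}^{N_{tb}}w_n^{tb}g(x_n)\Big|\le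 C_{quad}^{tb}(\|g\|_{C^k})N_{tb}^{-\alpha_{tb}}\quad\text{for } g\in C^k(D),$$ $$\Big|\int_0^T\!\!\int_{\partial D}g\,ds(x)dt-\sum_{n=1}^{N_{sb}}w_n^{sb}g(x_n,t_n)\Big|\le C_{quad}^{sb}(\|g\|_{C^k})N_{sb}^{-\alpha_{sb}}\quad\text{for } g\in C^k(\partial D\times[0,T]),$$ $$\Big|\int_0^T\!\!\int_{D}g\,dx\,dt-\sum_{n=1}^{N_{int}}w_n^{int}g(x_n,t_n)\Big|\le C_{quad}^{int}(\|g\|_{C^{\ell}})N_{int}^{-\alpha_{int}}\quad\text{for } g\in C^{\ell}(D\times[0,T]),\ \ell=k-2.$$ Training errors: $$(\mathcal{E}_T^{tb})^2=\sum_{n=1}^{N_{tb}}w_n^{tb}|\mathcal{R}_{tb,\theta^{\ast}}(x_n)|^2,\quad(\mathcal{E}_T^{sb})^2=\sum_{n=1}^{N_{sb}}w_n^{sb}|\mathcal{R}_{sb,\theta^{\ast}}(x_n,t_n)|^2,\quad(\mathcal{E}_T^{int})^2=\sum_{n=1}^{N_{int}}w_n^{int}|\mathcal{R}_{int,\theta^{\ast}}(x_n,t_n)|^2.$$ PINN algorithm: return $\theta^{\ast}\in\Theta$, an (approximate, local) minimizer of $J(\theta)+\lambda_{reg}J_{reg}(\theta)$, where $$J(\theta)=\sum_{n=1}^{N_{tb}}w_n^{tb}|\mathcal{R}_{tb,\theta}(x_n)|^2+\sum_{n=1}^{N_{sb}}w_n^{sb}|\mathcal{R}_{sb,\theta}(x_n,t_n)|^2+\lambda\sum_{n=1}^{N_{int}}w_n^{int}|\mathcal{R}_{int,\theta}(x_n,t_n)|^2,$$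 $\lambda>0$ is a hyperparameter, $J_{reg}:\Theta\to\mathbb{R}$ a regularization term, $\lambda_{reg}\ge0$. The PINN is $u^{\ast}=u_{\theta^{\ast}}$. No quantitative property of the minimization is assumed. *)

theory Defs
  imports "HOL-Analysis.Analysis"
begin

section \<open>Functions of class $C^k$\<close>

text \<open>Partial derivative in direction \<open>b\<close>, and its iterates along a list of directions.\<close>

definition pd :: "'e::euclidean_space \<Rightarrow> ('e \<Rightarrow> real) \<Rightarrow> 'e \<Rightarrow> real" where
  "pd b g x = deriv (\<lambda>h. g (x + h *\<^sub>R b)) 0"

primrec pds :: "'e::euclidean_space list \<Rightarrow> ('e \<Rightarrow> real) \<Rightarrow> 'e \<Rightarrow> real" where
  "pds [] g = g"
| "pds (b # bs) g = pd b (pds bs g)"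

definition multi_indices :: "nat \<Rightarrow> 'e::euclidean_space list set" where
  "multi_indices k = {bs. set bs \<subseteq> Basis \<and> length bs \<le> k}"

text \<open>
  \<open>Ck_on k S g\<close>: all partial derivatives of \<open>g\<close> of order at most \<open>k\<close> exist in the interior of \<open>S\<close>
  and, together with \<open>g\<close> itself, extend continuously to \<open>S\<close>. It is used only for
  \<open>S \<subseteq> closure (interior S)\<close>, where the extensions are unique: for open \<open>S\<close> this is the usual $C^k(S)$,
  for \<open>S = closure D\<close> or \<open>S = closure D \<times> {0..T}\<close> it is the usual class of functions that are $C^k$
  up to the boundary. Values of \<open>g\<close> outside \<open>S\<close> are irrelevant.
\<close>

definition Ck_on :: "nat \<Rightarrow> 'e::euclidean_space set \<Rightarrow> ('e \<Rightarrow> real) \<Rightarrow> bool" where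
  "Ck_on k S g \<longleftrightarrow>
     continuous_on S g \<and>
     (\<forall>bs \<in> multi_indices k.
        (length bs < k \<longrightarrow>
           (\<forall>x \<in> interior S. \<forall>b \<in> Basis. (\<lambda>h. pds bs g (x + h *\<^sub>R b)) differentiable (at 0))) \<and>
        (\<exists>G. continuous_on S G \<and> (\<forall>x \<in> interior S. G x = pds bs g x)))"

text \<open>The supremum over the interior equals the one over \<open>S\<close>, by continuity of the extensions.\<close>

definition Ck_vals :: "nat \<Rightarrow> 'e::euclidean_space set \<Rightarrow> ('e \<Rightarrow> real) \<Rightarrow> real set" where
  "Ck_vals k S g = {\<bar>pds bs g x\<bar> |bs x. bs \<in> multi_indices k \<and> x \<in> interior S}"

definition Ck_norm :: "nat \<Rightarrow> 'e::euclidean_space set \<Rightarrow> ('e \<Rightarrow> real) \<Rightarrow> real" where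
  "Ck_norm k S g = Sup (Ck_vals k S g)"

definition Ck_bdd :: "nat \<Rightarrow> 'e::euclidean_space set \<Rightarrow> ('e \<Rightarrow> real) \<Rightarrow> bool" where
  "Ck_bdd k S g \<longleftrightarrow> Ck_on k S g \<and> bdd_above (Ck_vals k S g)"

text \<open>First-order derivative at points of \<open>S\<close>, boundary points included, by continuous extension.\<close>

definition pd_on :: "'e::euclidean_space set \<Rightarrow> 'e \<Rightarrow> ('e \<Rightarrow> real) \<Rightarrow> 'e \<Rightarrow> real" where
  "pd_on S b g x = Lim (at x within interior S) (pd b g)"


section \<open>Domains with $C^k$ boundary, and their surface measure\<close>

text \<open>
  A chart \<open>(e, s, \<gamma>, U)\<close> describes \<open>D\<close> inside the open set \<open>U\<close> as one side of the graph of \<open>\<gamma>\<close> over the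
  hyperplane orthogonal to the coordinate direction \<open>e\<close>; the sign \<open>s\<close> selects the side. The function
  \<open>\<gamma>\<close> of the remaining \<open>DIM('a) - 1\<close> coordinates is encoded as a function on the whole space that does
  not depend on the \<open>e\<close>-coordinate, so that \<open>graph_pt e \<gamma> y\<close> is the point of the graph that differs
  from \<open>y\<close> only in the \<open>e\<close>-coordinate.
\<close>

type_synonym 'a chart = "'a \<times> real \<times> ('a \<Rightarrow> real) \<times> 'a set"

definition graph_pt :: "'a::euclidean_space \<Rightarrow> ('a \<Rightarrow> real) \<Rightarrow> 'a \<Rightarrow> 'a" where
  "graph_pt e \<gamma> y = y + (\<gamma> y - y \<bullet> e) *\<^sub>R e"

fun boundary_chart :: "nat \<Rightarrow> 'a::euclidean_space set \<Rightarrow> 'a chart \<Rightarrow> bool" where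
  "boundary_chart k D (e, s, \<gamma>, U) \<longleftrightarrow>
     e \<in> Basis \<and> s \<in> {1, -1} \<and> open U \<and>
     Ck_on k UNIV \<gamma> \<and> (\<forall>y r. \<gamma> (y + r *\<^sub>R e) = \<gamma> y) \<and>
     D \<inter> U = {x \<in> U. s * (x \<bullet> e) > s * \<gamma> x}"

fun chart_dom :: "'a chart \<Rightarrow> 'a set" where
  "chart_dom (e, s, \<gamma>, U) = U"

definition Ck_boundary :: "nat \<Rightarrow> 'a::euclidean_space set \<Rightarrow> bool" where
  "Ck_boundary k D \<longleftrightarrow> (\<forall>x \<in> frontier D. \<exists>c. boundary_chart k D c \<and> x \<in> chart_dom c)"

text \<open>
  $(d-1)$-dimensional Lebesgue measure on the coordinate hyperplane orthogonal to \<open>e\<close>, constructed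
  like \<^const>\<open>lborel\<close>. For $d = 1$ it is the unit point mass at \<open>0\<close>.
\<close>

definition hyperplane_measure :: "'a::euclidean_space \<Rightarrow> 'a measure" where
  "hyperplane_measure e =
     distr (\<Pi>\<^sub>M b\<in>Basis - {e}. (lborel :: real measure)) borel (\<lambda>y. \<Sum>b\<in>Basis - {e}. y b *\<^sub>R b)"

text \<open>
  \<open>\<sigma>\<close> is the surface measure of \<open>\<partial>D\<close>: a Borel measure carried by \<open>\<partial>D\<close> and given in every graph chart
  by the area element $\sqrt{1 + |\nabla\gamma|^2}\,dy$. When \<open>\<partial>D\<close> is compact and $C^1$ there is
  exactly one such measure, since the charts cover \<open>\<partial>D\<close> and the area formula makes the prescriptions
  of overlapping charts agree; for $d = 1$ it is the counting measure on \<open>\<partial>D\<close>.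
\<close>

definition surface_measure :: "'a::euclidean_space set \<Rightarrow> 'a measure \<Rightarrow> bool" where
  "surface_measure D \<sigma> \<longleftrightarrow>
     sets \<sigma> = sets borel \<and> emeasure \<sigma> (- frontier D) = 0 \<and>
     (\<forall>e s \<gamma> U A. boundary_chart 1 D (e, s, \<gamma>, U) \<and> A \<in> sets borel \<and> A \<subseteq> frontier D \<inter> U \<longrightarrow>
        emeasure \<sigma> A =
          (\<integral>\<^sup>+ y. indicator A (graph_pt e \<gamma> y) * ennreal (sqrt (1 + (\<Sum>b\<in>Basis. (pd b \<gamma> y)\<^sup>2)))
             \<partial>hyperplane_measure e))"


section \<open>$C^k$ functions on the lateral boundary \<open>\<partial>D \<times> [0,T]\<close>\<close>

text \<open>
  As usual for a compact manifold, class and norm are defined through a finite atlas. A function in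
  a chart becomes a function on \<open>{y. graph_pt e \<gamma> y \<in> U} \<times> {0..T}\<close>, again constant in the
  \<open>e\<close>-coordinate. The class does not depend on the atlas, the norm only up to equivalence.
\<close>

definition boundary_atlas :: "nat \<Rightarrow> 'a::euclidean_space set \<Rightarrow> 'a chart set \<Rightarrow> bool" where
  "boundary_atlas k D \<A> \<longleftrightarrow>
     finite \<A> \<and> (\<forall>c\<in>\<A>. boundary_chart k D c) \<and> frontier D \<subseteq> (\<Union>c\<in>\<A>. chart_dom c)"

fun chart_param :: "real \<Rightarrow> 'a::euclidean_space chart \<Rightarrow> ('a \<times> real) set" where
  "chart_param T (e, s, \<gamma>, U) = {y. graph_pt e \<gamma> y \<in> U} \<times> {0..T}"

fun chart_pull :: "'a::euclidean_space chart \<Rightarrow> ('a \<times> real \<Rightarrow> real) \<Rightarrow> 'a \<times> real \<Rightarrow> real" where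
  "chart_pull (e, s, \<gamma>, U) g = (\<lambda>(y, t). g (graph_pt e \<gamma> y, t))"

definition Ck_lateral ::
    "nat \<Rightarrow> 'a::euclidean_space chart set \<Rightarrow> real \<Rightarrow> ('a \<times> real \<Rightarrow> real) \<Rightarrow> bool" where
  "Ck_lateral k \<A> T g \<longleftrightarrow> (\<forall>c\<in>\<A>. Ck_on k (chart_param T c) (chart_pull c g))"

definition Ck_lateral_norm ::
    "nat \<Rightarrow> 'a::euclidean_space chart set \<Rightarrow> real \<Rightarrow> ('a \<times> real \<Rightarrow> real) \<Rightarrow> real" where
  "Ck_lateral_norm k \<A> T g = Sup (\<Union>c\<in>\<A>. Ck_vals k (chart_param T c) (chart_pull c g))"

text \<open>
  The norm of $C^1([0,T]\times\partial D)$ in the error bound: it involves the time derivative and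
  the full (not only the tangential) spatial gradient, so it is defined for functions that are
  $C^1$ on \<open>closure D \<times> {0..T}\<close>.
\<close>

definition C1_lateral_norm ::
    "'a::euclidean_space set \<Rightarrow> real \<Rightarrow> ('a \<times> real \<Rightarrow> real) \<Rightarrow> real" where
  "C1_lateral_norm D T v =
     (let Q = closure D \<times> {0..T} in
      SUP p \<in> frontier D \<times> {0..T}.
        Max {\<bar>v p\<bar>, \<bar>pd_on Q (0, 1) v p\<bar>, sqrt (\<Sum>b\<in>Basis. (pd_on Q (b, 0) v p)\<^sup>2)})"


section \<open>The semilinear parabolic problem and the residuals\<close>

definition dt :: "('a::euclidean_space \<times> real \<Rightarrow> real) \<Rightarrow> 'a \<times> real \<Rightarrow> real" where
  "dt v = pd (0, 1) v"

definition laplacian :: "('a::euclidean_space \<times> real \<Rightarrow> real) \<Rightarrow> 'a \<times> real \<Rightarrow> real" where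
  "laplacian v p = (\<Sum>b\<in>Basis. pds [(b, 0), (b, 0)] v p)"

definition classical_solution ::
    "nat \<Rightarrow> 'a::euclidean_space set \<Rightarrow> real \<Rightarrow> (real \<Rightarrow> real) \<Rightarrow> ('a \<Rightarrow> real) \<Rightarrow> ('a \<times> real \<Rightarrow> real) \<Rightarrow> bool"
  where
  "classical_solution k D T f ubar u \<longleftrightarrow>
     Ck_on k (closure D \<times> {0..T}) u \<and>
     (\<forall>x\<in>D. \<forall>t\<in>{0<..<T}. dt u (x, t) = laplacian u (x, t) + f (u (x, t))) \<and>
     (\<forall>x\<in>D. u (x, 0) = ubar x) \<and>
     (\<forall>x\<in>frontier D. \<forall>t\<in>{0<..<T}. u (x, t) = 0)"

definition unique_classical_solution ::
    "nat \<Rightarrow> 'a::euclidean_space set \<Rightarrow> real \<Rightarrow> (real \<Rightarrow> real) \<Rightarrow> ('a \<Rightarrow> real) \<Rightarrow> ('a \<times> real \<Rightarrow> real) \<Rightarrow> bool"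
  where
  "unique_classical_solution k D T f ubar u \<longleftrightarrow>
     classical_solution k D T f ubar u \<and>
     (\<forall>v. classical_solution k D T f ubar v \<longrightarrow> (\<forall>p \<in> closure D \<times> {0..T}. v p = u p))"

definition res_int ::
    "(real \<Rightarrow> real) \<Rightarrow> ('a::euclidean_space \<times> real \<Rightarrow> real) \<Rightarrow> 'a \<times> real \<Rightarrow> real" where
  "res_int f v p = dt v p - laplacian v p - f (v p)"

definition res_sb :: "('a \<times> real \<Rightarrow> real) \<Rightarrow> 'a \<times> real \<Rightarrow> real" where
  "res_sb v p = v p"

definition res_tb :: "('a \<Rightarrow> real) \<Rightarrow> ('a \<times> real \<Rightarrow> real) \<Rightarrow> 'a \<Rightarrow> real" where
  "res_tb ubar v x = v (x, 0) - ubar x"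


section \<open>Neural networks\<close>

text \<open>
  Vectors are functions on \<^typ>\<open>nat\<close> of which only the first components matter. A network with layer
  widths \<open>[n0, n1, \<dots>, nL]\<close> has $\sum_l n_{l+1}(n_l+1)$ parameters, stored consecutively: row \<open>i\<close> of the
  matrix of a layer with \<open>n\<close> inputs, followed by the bias \<open>i\<close>, occupies \<open>n + 1\<close> slots from
  \<open>i * (n + 1)\<close> on.
\<close>

definition affine_layer :: "nat \<Rightarrow> (nat \<Rightarrow> real) \<Rightarrow> (nat \<Rightarrow> real) \<Rightarrow> nat \<Rightarrow> real" where
  "affine_layer n \<theta> z i = (\<Sum>j<n. \<theta> (i * (n + 1) + j) * z j) + \<theta> (i * (n + 1) + n)"

fun num_params :: "nat list \<Rightarrow> nat" where
  "num_params (n # m # ns) = m * (n + 1) + num_params (m # ns)"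
| "num_params _ = 0"

text \<open>The activation is applied after every affine map except the last one.\<close>

fun ffnn :: "(real \<Rightarrow> real) \<Rightarrow> nat list \<Rightarrow> (nat \<Rightarrow> real) \<Rightarrow> (nat \<Rightarrow> real) \<Rightarrow> nat \<Rightarrow> real" where
  "ffnn act (n # m # l # ns) \<theta> z =
     ffnn act (m # l # ns) (\<lambda>i. \<theta> (m * (n + 1) + i)) (\<lambda>i. act (affine_layer n \<theta> z i))"
| "ffnn act [n, m] \<theta> z = affine_layer n \<theta> z"
| "ffnn act _ \<theta> z = z"

text \<open>
  Coordinates of a vector in some fixed enumeration of the basis; the choice only permutes the
  columns of the first weight matrix.
\<close>

definition coords :: "'e::euclidean_space \<Rightarrow> nat \<Rightarrow> real" where
  "coords z i = z \<bullet> ((SOME bs. distinct bs \<and> set bs = (Basis :: 'e set)) ! i)"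

definition network ::
    "(real \<Rightarrow> real) \<Rightarrow> nat list \<Rightarrow> (nat \<Rightarrow> real) \<Rightarrow> 'a::euclidean_space \<times> real \<Rightarrow> real" where
  "network act ns \<theta> p = ffnn act ns \<theta> (coords p) 0"

definition param_space :: "nat \<Rightarrow> (nat \<Rightarrow> real) set" where
  "param_space M = {\<theta>. \<forall>i\<ge>M. \<theta> i = 0}"


section \<open>Quadrature, loss function and training\<close>

definition quad :: "nat \<Rightarrow> (nat \<Rightarrow> real) \<Rightarrow> (nat \<Rightarrow> 'p) \<Rightarrow> ('p \<Rightarrow> real) \<Rightarrow> real" where
  "quad N w z g = (\<Sum>n<N. w n * g (z n))"

definition training_error :: "nat \<Rightarrow> (nat \<Rightarrow> real) \<Rightarrow> (nat \<Rightarrow> 'p) \<Rightarrow> ('p \<Rightarrow> real) \<Rightarrow> real" where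
  "training_error N w z R = sqrt (quad N w z (\<lambda>p. \<bar>R p\<bar>\<^sup>2))"

text \<open>
  An approximate, local minimizer: minimality within some neighbourhood, up to some tolerance. The
  tolerance is not quantified. The topology on \<^typ>\<open>nat \<Rightarrow> real\<close> is that of pointwise convergence, which
  induces the usual one on \<open>param_space M\<close>.
\<close>

definition approx_local_minimizer ::
    "('p::topological_space \<Rightarrow> real) \<Rightarrow> 'p set \<Rightarrow> 'p \<Rightarrow> bool" where
  "approx_local_minimizer F \<Theta> \<theta> \<longleftrightarrow>
     \<theta> \<in> \<Theta> \<and> (\<exists>\<epsilon>\<ge>0. \<exists>N. open N \<and> \<theta> \<in> N \<and> (\<forall>\<theta>' \<in> \<Theta> \<inter> N. F \<theta> \<le> F \<theta>' + \<epsilon>))"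

definition generalization_error ::
    "'a::euclidean_space set \<Rightarrow> real \<Rightarrow> ('a \<times> real \<Rightarrow> real) \<Rightarrow> ('a \<times> real \<Rightarrow> real) \<Rightarrow> real" where
  "generalization_error D T u v =
     sqrt (LINT t:{0..T}|lborel. LINT x:D|lborel. \<bar>u (x, t) - v (x, t)\<bar>\<^sup>2)"

definition const_1 :: "real \<Rightarrow> real \<Rightarrow> real" where
  "const_1 T Cf = sqrt (T + (1 + 2 * Cf) * T\<^sup>2 * exp ((1 + 2 * Cf) * T))"

definition const_bdry ::
    "'a::euclidean_space set \<Rightarrow> 'a measure \<Rightarrow> real \<Rightarrow> ('a \<times> real \<Rightarrow> real) \<Rightarrow> ('a \<times> real \<Rightarrow> real) \<Rightarrow> real" where
  "const_bdry D \<sigma> T u v =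
     sqrt (measure \<sigma> (frontier D)) * (C1_lateral_norm D T u + C1_lateral_norm D T v)"

definition const_2 ::
    "'a::euclidean_space set \<Rightarrow> 'a measure \<Rightarrow> real \<Rightarrow> ('a \<times> real \<Rightarrow> real) \<Rightarrow> ('a \<times> real \<Rightarrow> real) \<Rightarrow> real" where
  "const_2 D \<sigma> T u v = sqrt (const_bdry D \<sigma> T u v * sqrt T)"

end

theory Submission
  imports Defs
begin

text \<open>
  The error \<open>V = u\<^sup>* - u\<close> solves $V_t = \Delta V + F + R$ with $|F| \le C_f |V|$, where \<open>R\<close> is the interior
  residual. Write $a^2 = \int_D V(\cdot,0)^2$, $b^2 = \int_0^T\int_D R^2$ and
  $c^2 = C_{\partial D} T^{1/2} (\int_0^T\int_{\partial D} V^2)^{1/2}$. It suffices to show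
  $\int_0^T\int_D V^2 \le C_1^2 (a + b + c)^2$; the quadrature bounds do the rest.

  Multiplying the equation by $2V$ and applying Gronwall's inequality yields $2c^2$ in place of $c^2$. The
  exponential in $C_1$ absorbs the factor 2 only when $C_f T$ is not small. When $C_f T \le 1/2$, the
  equation is integrated over $(0,t)$ first and only then multiplied by $V(t)$ and integrated over
  \<open>D \<times> (0,T)\<close>: the gradient term becomes $-\frac12 \int_D |\int_0^T \nabla V|^2 \le 0$, and the
  boundary term appears with the factor 1.

  Both arguments use only the inequality
  $\int_D (w \Delta v + \nabla w \cdot \nabla v) \le \int_{\partial D} |w| |\nabla v|$. After localisation by a
  partition of unity the field \<open>X\<close> is multiplied by a cutoff \<open>\<phi>(\<rho>)\<close>, where \<open>\<rho>\<close> is the signed distance to the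
  graph along the chart direction. Then $\int \phi(\rho)\,\mathrm{div} X = - \int \phi'(\rho) \nabla\rho \cdot X$, and
  as \<open>\<phi>(\<rho>)\<close> tends to the indicator of \<open>D\<close> the right-hand side concentrates on \<open>\<partial>D\<close> with the area
  element $|\nabla\rho|$ as density.
\<close>


section \<open>Functions of class $C^k$ with continuously extended derivatives\<close>

text \<open>Three obstacles shape the proof. Derivatives exist only in the interior of the cylinder;
  at its ends and on the lateral boundary they have a meaning only as continuous extensions. Each
  calculus fact is therefore proved for a function paired with a continuous function that is its
  derivative inside, and carried to the closed cylinder by continuity. Next,
  \<open>surface_measure\<close> prescribes areas in charts and provides no normal field. The flux
  is bounded by |X| from the start, which costs nothing, as only |V| and |grad V| on the boundary
  enter the constants. Finally, the quadrature bounds require smooth squared residuals: for the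
  initial one this rests on \<open>ubar\<close> being the trace of \<open>u\<close>, for the lateral
  one on the network being smooth on the whole space.

  The threshold Cf T \<le> 1/2 comes from comparing constants. With \<tau> = (1 + 2 Cf) T one has
  C_1^2 = T (1 + \<tau> exp \<tau>), while Gronwall's inequality yields 2 T (exp \<tau> - 1) /
  \<tau> for c^2; the latter is the smaller one for \<tau> \<ge> 1 and the larger one as \<tau>
  tends to 0.\<close>

definition Ck_ext :: "nat \<Rightarrow> 'e::euclidean_space set \<Rightarrow> 'e set \<Rightarrow> ('e \<Rightarrow> real) \<Rightarrow> bool" where
  "Ck_ext k S K g \<longleftrightarrow>
     (\<forall>bs \<in> multi_indices k.
        (length bs < k \<longrightarrow>
           (\<forall>x \<in> S. \<forall>b \<in> Basis. (\<lambda>h. pds bs g (x + h *\<^sub>R b)) differentiable (at 0))) \<and>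
        (\<exists>G. continuous_on K G \<and> (\<forall>x \<in> S. G x = pds bs g x)))"

text \<open>\<open>Ck_ext\<close> separates the set \<open>S\<close> on which derivatives are taken
  from the set \<open>K\<close> to which they extend. The quadrature bounds concern functions on
  \<open>D\<close>, whereas boundedness of their derivatives comes from extensions to the compact
  \<open>closure D\<close>.\<close>

lemma Ck_on_iff: "Ck_on k S g \<longleftrightarrow> continuous_on S g \<and> Ck_ext k (interior S) S g"
  unfolding Ck_on_def Ck_ext_def by blast

lemma Ck_ext_subset:
  assumes "Ck_ext k S K g" "S' \<subseteq> S" "K' \<subseteq> K"
  shows "Ck_ext k S' K' g"
proof -
  have "\<exists>G. continuous_on K' G \<and> (\<forall>x \<in> S'. G x = pds bs g x)"
    if "\<exists>G. continuous_on K G \<and> (\<forall>x \<in> S. G x = pds bs g x)" for bs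
    using that continuous_on_subset[OF _ assms(3)] assms(2) by blast
  then show ?thesis
    using assms(1,2) unfolding Ck_ext_def by (simp add: subset_iff)
qed

lemma multi_indices_mono: "m \<le> k \<Longrightarrow> multi_indices m \<subseteq> multi_indices k"
  by (auto simp: multi_indices_def)

lemma Ck_ext_le:
  assumes "Ck_ext k S K g" "m \<le> k"
  shows "Ck_ext m S K g"
  unfolding Ck_ext_def
proof
  fix bs :: "'a list" assume "bs \<in> multi_indices m"
  then have "bs \<in> multi_indices k" using multi_indices_mono[OF assms(2)] by blast
  from assms(1)[unfolded Ck_ext_def, rule_format, OF this]
  show "(length bs < m \<longrightarrow> (\<forall>x\<in>S. \<forall>b\<in>Basis. (\<lambda>h. pds bs g (x + h *\<^sub>R b)) differentiable at 0)) \<and>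
        (\<exists>G. continuous_on K G \<and> (\<forall>x\<in>S. G x = pds bs g x))"
    using assms(2) by simp
qed

lemma Ck_on_le: "Ck_on k S g \<Longrightarrow> m \<le> k \<Longrightarrow> Ck_on m S g"
  by (auto simp: Ck_on_iff intro: Ck_ext_le)

lemma pds_append: "pds (as @ bs) g = pds as (pds bs g)"
  by (induction as) auto

lemma eventually_line_in_open:
  fixes x b :: "'e::real_normed_vector"
  assumes "open S" "x \<in> S"
  shows "eventually (\<lambda>h. x + h *\<^sub>R b \<in> S) (nhds (0::real))"
proof -
  have "((\<lambda>h::real. x + h *\<^sub>R b) \<longlongrightarrow> x + 0 *\<^sub>R b) (nhds 0)"
    by (intro tendsto_intros filterlim_ident)
  then show ?thesis
    using topological_tendstoD[of _ x "nhds 0" S] assms by auto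
qed

lemma pd_cong:
  assumes "open S" "x \<in> S" "\<And>y. y \<in> S \<Longrightarrow> g y = h y"
  shows "pd b g x = pd b h x"
  unfolding pd_def
  by (rule deriv_cong_ev) (use eventually_line_in_open[OF assms(1,2), of b] assms(3)
        in \<open>auto elim: eventually_mono\<close>)

lemma line_differentiable_cong:
  fixes x :: "'e::euclidean_space"
  assumes "open S" "x \<in> S" "\<And>y. y \<in> S \<Longrightarrow> g y = h y"
    and "(\<lambda>r. g (x + r *\<^sub>R b)) differentiable (at (0::real))"
  shows "(\<lambda>r. (h (x + r *\<^sub>R b)::real)) differentiable (at 0)"
proof -
  have "((\<lambda>r. g (x + r *\<^sub>R b)) has_field_derivative pd b g x) (at 0)"
    using assms(4) unfolding pd_def by (simp add: DERIV_deriv_iff_real_differentiable)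
  moreover have "eventually (\<lambda>r. g (x + r *\<^sub>R b) = h (x + r *\<^sub>R b)) (nhds 0)"
    using eventually_line_in_open[OF assms(1,2), of b] assms(3) by (auto elim: eventually_mono)
  ultimately have "((\<lambda>r. h (x + r *\<^sub>R b)) has_field_derivative pd b g x) (at 0)"
    using DERIV_cong_ev[of 0 0 "\<lambda>r. g (x + r *\<^sub>R b)" "\<lambda>r. h (x + r *\<^sub>R b)"] by simp
  then show ?thesis
    unfolding real_differentiable_def by blast
qed

lemma pds_cong:
  assumes "open S" "\<And>y. y \<in> S \<Longrightarrow> g y = h y" "x \<in> S"
  shows "pds bs g x = pds bs h x"
  using assms(3) by (induction bs arbitrary: x) (auto simp: assms(2) intro!: pd_cong[OF assms(1)])

text \<open>\<open>pds bs g x\<close> depends only on the values of \<open>g\<close> near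
  \<open>x\<close>, hence the openness of \<open>S\<close>. This is the tool for replacing
  \<open>pd b\<close> of a sum, product or composition by its formula, which is known on
  \<open>S\<close> alone.\<close>

lemma Ck_ext_cong:
  assumes "open S" "\<And>y. y \<in> S \<Longrightarrow> g y = h y" "Ck_ext k S K g"
  shows "Ck_ext k S K h"
proof -
  have eq: "pds bs g x = pds bs h x" if "x \<in> S" for bs x
    by (rule pds_cong[OF assms(1,2) that])
  show ?thesis
    unfolding Ck_ext_def
  proof (intro ballI conjI impI)
    fix bs :: "'a list" assume bs: "bs \<in> multi_indices k"
    show "\<exists>G. continuous_on K G \<and> (\<forall>x\<in>S. G x = pds bs h x)"
      using assms(3) bs by (simp add: Ck_ext_def eq)
    fix x b :: 'a assume "length bs < k" "x \<in> S" "b \<in> Basis"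
    then show "(\<lambda>r. pds bs h (x + r *\<^sub>R b)) differentiable at 0"
      using assms(3) bs
      by (intro line_differentiable_cong[OF assms(1) _ eq]) (auto simp: Ck_ext_def)
  qed
qed

lemma Ck_ext_0: "Ck_ext 0 S K g \<longleftrightarrow> (\<exists>G. continuous_on K G \<and> (\<forall>x \<in> S. G x = g x))"
  by (simp add: Ck_ext_def multi_indices_def)

text \<open>Splits off the innermost direction, that is, the last entry of the list and the
  derivative taken first. Inductions on \<open>k\<close> can then replace \<open>g\<close> by
  \<open>pd b g\<close>, which is why \<open>g\<close> is generalised in them.\<close>

lemma Ck_ext_Suc:
  "Ck_ext (Suc k) S K g \<longleftrightarrow>
     (\<exists>G. continuous_on K G \<and> (\<forall>x \<in> S. G x = g x)) \<and>
     (\<forall>b\<in>Basis. (\<forall>x\<in>S. (\<lambda>h. g (x + h *\<^sub>R b)) differentiable (at 0)) \<and> Ck_ext k S K (pd b g))"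
  (is "?L \<longleftrightarrow> ?E \<and> ?R")
proof
  assume L: ?L
  have E: ?E and d: "\<And>b x. b \<in> Basis \<Longrightarrow> x \<in> S \<Longrightarrow> (\<lambda>h. g (x + h *\<^sub>R b)) differentiable (at 0)"
    using L[unfolded Ck_ext_def, rule_format, of "[]"] by (auto simp: multi_indices_def)
  have "Ck_ext k S K (pd b g)" if b: "b \<in> Basis" for b
    unfolding Ck_ext_def
  proof
    fix bs :: "'a list" assume "bs \<in> multi_indices k"
    then have "bs @ [b] \<in> multi_indices (Suc k)"
      using b by (auto simp: multi_indices_def)
    from L[unfolded Ck_ext_def, rule_format, OF this]
    show "(length bs < k \<longrightarrow> (\<forall>x\<in>S. \<forall>ba\<in>Basis. (\<lambda>h. pds bs (pd b g) (x + h *\<^sub>R ba)) differentiable at 0)) \<and>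
          (\<exists>G. continuous_on K G \<and> (\<forall>x\<in>S. G x = pds bs (pd b g) x))"
      by (simp add: pds_append)
  qed
  with E d show "?E \<and> ?R" by blast
next
  assume R: "?E \<and> ?R"
  show ?L
    unfolding Ck_ext_def
  proof
    fix bs :: "'a list" assume bs: "bs \<in> multi_indices (Suc k)"
    show "(length bs < Suc k \<longrightarrow> (\<forall>x\<in>S. \<forall>b\<in>Basis. (\<lambda>h. pds bs g (x + h *\<^sub>R b)) differentiable at 0)) \<and>
          (\<exists>G. continuous_on K G \<and> (\<forall>x\<in>S. G x = pds bs g x))"
    proof (cases bs rule: rev_cases)
      case Nil
      then show ?thesis using R by auto
    next
      case (snoc cs c)
      then have cs: "cs \<in> multi_indices k" "c \<in> Basis"
        using bs by (auto simp: multi_indices_def)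
      then have "Ck_ext k S K (pd c g)" using R by blast
      from this[unfolded Ck_ext_def, rule_format, OF cs(1)] show ?thesis
        by (simp add: snoc pds_append)
    qed
  qed
qed

lemma Ck_ext_imp_extension: "Ck_ext k S K g \<Longrightarrow> \<exists>G. continuous_on K G \<and> (\<forall>x \<in> S. G x = g x)"
  using Ck_ext_le[of k S K g 0] by (auto simp: Ck_ext_0)

lemma pd_has_derivative:
  assumes "(\<lambda>h. g (x + h *\<^sub>R b)) differentiable (at 0)"
  shows "((\<lambda>h. g (x + h *\<^sub>R b)) has_real_derivative pd b g x) (at 0)"
  using assms unfolding pd_def by (simp add: DERIV_deriv_iff_real_differentiable)

lemma pd_eqI: "((\<lambda>h. g (x + h *\<^sub>R b)) has_real_derivative d) (at 0) \<Longrightarrow> pd b g x = d"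
  unfolding pd_def by (rule DERIV_imp_deriv)

section \<open>Sums, products and linear functions\<close>

lemma Ck_ext_const [simp]: "Ck_ext k S K (\<lambda>x. c)"
proof -
  have pd0: "pd b (\<lambda>x. c) = (\<lambda>x. 0)" for b :: 'a and c :: real
    by (simp add: pd_def fun_eq_iff)
  show ?thesis
    by (induction k arbitrary: c) (auto simp: Ck_ext_0 Ck_ext_Suc pd0 intro!: exI[of _ "\<lambda>_. _"])
qed

lemma Ck_ext_add:
  assumes "open S" "Ck_ext k S K g" "Ck_ext k S K h"
  shows "Ck_ext k S K (\<lambda>x. g x + h x)"
  using assms(2,3)
proof (induction k arbitrary: g h)
  case 0
  then show ?case unfolding Ck_ext_0 by (metis (mono_tags, lifting) continuous_on_add)
next
  case (Suc k)
  have E: "\<exists>G. continuous_on K G \<and> (\<forall>x \<in> S. G x = g x + h x)"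
    using Suc.prems[THEN Ck_ext_imp_extension] by (metis (mono_tags, lifting) continuous_on_add)
  show ?case
    unfolding Ck_ext_Suc
  proof (intro conjI ballI E)
    fix b :: 'a assume b: "b \<in> Basis"
    have D: "((\<lambda>r. g (x + r *\<^sub>R b) + h (x + r *\<^sub>R b)) has_real_derivative pd b g x + pd b h x) (at 0)"
      if "x \<in> S" for x
      using Suc.prems b that
      by (intro DERIV_add pd_has_derivative) (auto simp: Ck_ext_Suc)
    show "(\<lambda>r. g (x + r *\<^sub>R b) + h (x + r *\<^sub>R b)) differentiable at 0" if "x \<in> S" for x
      using D[OF that] real_differentiable_def by blast
    show "Ck_ext k S K (pd b (\<lambda>x. g x + h x))"
      by (rule Ck_ext_cong[OF assms(1) _ Suc.IH[of "pd b g" "pd b h"]])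
         (use Suc.prems b D in \<open>auto simp: Ck_ext_Suc intro!: pd_eqI[symmetric]\<close>)
  qed
qed

lemma Ck_ext_mult:
  assumes "open S" "Ck_ext k S K g" "Ck_ext k S K h"
  shows "Ck_ext k S K (\<lambda>x. g x * h x)"
  using assms(2,3)
proof (induction k arbitrary: g h)
  case 0
  then show ?case unfolding Ck_ext_0 by (metis (mono_tags, lifting) continuous_on_mult)
next
  case (Suc k)
  have E: "\<exists>G. continuous_on K G \<and> (\<forall>x \<in> S. G x = g x * h x)"
    using Suc.prems[THEN Ck_ext_imp_extension] by (metis (mono_tags, lifting) continuous_on_mult)
  show ?case
    unfolding Ck_ext_Suc
  proof (intro conjI ballI E)
    fix b :: 'a assume b: "b \<in> Basis"
    have D: "((\<lambda>r. g (x + r *\<^sub>R b) * h (x + r *\<^sub>R b)) has_real_derivative pd b g x * h x + pd b h x * g x) (at 0)"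
      if "x \<in> S" for x
      using Suc.prems b that
        DERIV_mult[OF pd_has_derivative[of g x b] pd_has_derivative[of h x b]]
      by (auto simp: Ck_ext_Suc)
    show "(\<lambda>r. g (x + r *\<^sub>R b) * h (x + r *\<^sub>R b)) differentiable at 0" if "x \<in> S" for x
      using D[OF that] real_differentiable_def by blast
    show "Ck_ext k S K (pd b (\<lambda>x. g x * h x))"
    proof (rule Ck_ext_cong[OF assms(1)])
      \<comment> \<open>Each undifferentiated factor has one order to spare and is weakened from
        \<open>Suc k\<close> to \<open>k\<close> before the induction hypothesis is applied.\<close>
      show "Ck_ext k S K (\<lambda>x. pd b g x * h x + pd b h x * g x)"
        using Suc.prems b Suc.prems[THEN Ck_ext_le, of k]
        by (intro Ck_ext_add assms(1) Suc.IH) (auto simp: Ck_ext_Suc)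
    qed (use D in \<open>auto intro!: pd_eqI[symmetric]\<close>)
  qed
qed

lemma Ck_ext_sum:
  assumes "open S" "\<And>i. i \<in> I \<Longrightarrow> Ck_ext k S K (g i)"
  shows "Ck_ext k S K (\<lambda>x. \<Sum>i\<in>I. g i x)"
  using assms(2) by (induction I rule: infinite_finite_induct) (auto intro: Ck_ext_add[OF assms(1)])

lemma Ck_ext_inner_left: "Ck_ext k S K (\<lambda>x. x \<bullet> c)"
proof -
  have D: "((\<lambda>r. (x + r *\<^sub>R b) \<bullet> c) has_real_derivative b \<bullet> c) (at 0)" for x b :: 'a
    by (auto simp: inner_add_left intro!: derivative_eq_intros)
  have E: "\<exists>G. continuous_on K G \<and> (\<forall>x\<in>S. G x = x \<bullet> c)"
    by (rule exI[of _ "\<lambda>x. x \<bullet> c"]) (auto intro!: continuous_intros)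
  show ?thesis
  proof (cases k)
    case 0
    then show ?thesis using E by (simp add: Ck_ext_0)
  next
    case (Suc m)
    have "pd b (\<lambda>x. x \<bullet> c) = (\<lambda>x. b \<bullet> c)" for b
      using D by (auto intro: pd_eqI)
    then show ?thesis
      unfolding Suc Ck_ext_Suc using E D real_differentiable_def by fastforce
  qed
qed

section \<open>Composition with smooth activations; neural networks\<close>

lemma pd_real: "pd 1 g = deriv g" for g :: "real \<Rightarrow> real"
proof
  fix x
  have "deriv (\<lambda>h. g (x + h)) 0 = deriv g x"
    unfolding deriv_def using DERIV_shift[of g _ 0 x] by (simp add: add.commute)
  then show "pd 1 g x = deriv g x"
    by (simp add: pd_def)
qed

text \<open>\<open>deriv act\<close> satisfies the same hypothesis as \<open>act\<close>, so smooth
  functions are stable under differentiation; this closes the induction for compositions.\<close>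

lemma smooth_real:
  fixes act :: "real \<Rightarrow> real"
  assumes "\<And>m. Ck_on m UNIV act"
  shows "(act has_real_derivative deriv act x) (at x)" "continuous_on UNIV act" "Ck_on m UNIV (deriv act)"
proof -
  have ext: "Ck_ext m UNIV UNIV act" for m
    using assms[of m] by (simp add: Ck_on_iff)
  have "(\<lambda>h. act (x + h *\<^sub>R 1)) differentiable (at 0)"
    using ext[of 1] by (simp add: Ck_ext_Suc)
  from pd_has_derivative[OF this] show "(act has_real_derivative deriv act x) (at x)"
    using DERIV_shift[of act "deriv act x" 0 x] by (simp add: pd_real add.commute)
  show "continuous_on UNIV act"
    using assms[of 0] by (simp add: Ck_on_iff)
  have d: "Ck_ext m UNIV UNIV (deriv act)" for m
    using ext[of "Suc m"] by (simp add: Ck_ext_Suc pd_real)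
  moreover have "continuous_on UNIV (deriv act)"
    using Ck_ext_imp_extension[OF d[of 0]] by (auto intro: continuous_on_eq)
  ultimately show "Ck_on m UNIV (deriv act)"
    by (simp add: Ck_on_iff)
qed

lemma extension_compose:
  fixes act :: "real \<Rightarrow> real"
  assumes "continuous_on UNIV act" "\<exists>G. continuous_on K G \<and> (\<forall>x \<in> S. G x = g x)"
  shows "\<exists>G. continuous_on K G \<and> (\<forall>x \<in> S. G x = act (g x))"
proof -
  obtain G where G: "continuous_on K G" "\<forall>x \<in> S. G x = g x" using assms(2) by blast
  have "continuous_on K (\<lambda>x. act (G x))"
    by (rule continuous_on_compose2[OF assms(1) G(1)]) simp
  then show ?thesis using G(2) by (intro exI[of _ "\<lambda>x. act (G x)"]) simp
qed

text \<open>By the chain rule the derivative is \<open>deriv act (g x) * pd b g x\<close>. The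
  induction on \<open>k\<close> runs over all smooth \<open>act\<close> at once, because its
  hypothesis is applied to \<open>deriv act\<close>.\<close>

lemma Ck_ext_compose_smooth:
  assumes "open S" "\<And>m. Ck_on m UNIV act" "Ck_ext k S K g"
  shows "Ck_ext k S K (\<lambda>x. act (g x))"
  using assms(2,3)
proof (induction k arbitrary: act g)
  case 0
  then show ?case
    using extension_compose[OF smooth_real(2)[of act]] by (simp add: Ck_ext_0)
next
  case (Suc k)
  note act = smooth_real[of act, OF Suc.prems(1)]
  have E: "\<exists>G. continuous_on K G \<and> (\<forall>x \<in> S. G x = act (g x))"
    by (rule extension_compose[OF act(2) Ck_ext_imp_extension[OF Suc.prems(2)]])
  show ?case
    unfolding Ck_ext_Suc
  proof (intro conjI ballI E)
    fix b :: 'a assume b: "b \<in> Basis"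
    have D: "((\<lambda>r. act (g (x + r *\<^sub>R b))) has_real_derivative deriv act (g x) * pd b g x) (at 0)"
      if "x \<in> S" for x
      using Suc.prems(2) b that
      by (intro DERIV_chain2[where f = act] pd_has_derivative) (auto simp: Ck_ext_Suc act)
    show "(\<lambda>r. act (g (x + r *\<^sub>R b))) differentiable at 0" if "x \<in> S" for x
      using D[OF that] real_differentiable_def by blast
    show "Ck_ext k S K (pd b (\<lambda>x. act (g x)))"
    proof (rule Ck_ext_cong[OF assms(1)])
      show "Ck_ext k S K (\<lambda>x. deriv act (g x) * pd b g x)"
        using Suc.prems(2) b
        by (intro Ck_ext_mult[OF assms(1) Suc.IH[OF act(3) Ck_ext_le[OF Suc.prems(2)]]])
           (auto simp: Ck_ext_Suc)
    qed (use D in \<open>auto intro!: pd_eqI[symmetric]\<close>)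
  qed
qed

lemma Ck_ext_ffnn:
  assumes "open S" "\<And>m. Ck_on m UNIV act" "\<And>i. Ck_ext k S K (\<lambda>p. z p i)"
  shows "Ck_ext k S K (\<lambda>p. ffnn act ns \<theta> (z p) i)"
proof -
  have aff: "Ck_ext k S K (\<lambda>p. affine_layer n \<theta> (z p) i)"
    if "\<And>i. Ck_ext k S K (\<lambda>p. z p i)" for n \<theta> z i
    unfolding affine_layer_def
    by (intro Ck_ext_add Ck_ext_sum Ck_ext_mult Ck_ext_const assms(1) that)
  have "Ck_ext k S K (\<lambda>p. ffnn act ns \<theta> (z p) i)"
    if "\<And>i. Ck_ext k S K (\<lambda>p. z p i)" for ns \<theta> z
    using that
  proof (induction "length ns" arbitrary: ns \<theta> z)
    case 0
    then show ?case by simp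
  next
    case (Suc r ns \<theta> z)
    show ?case
    \<comment> \<open>The rule serves as the case split into lists of length 0, 1 and at least
      2.\<close>
    proof (cases ns rule: remdups_adj.cases)
      case 1
      then show ?thesis using Suc.hyps(2) by simp
    next
      case (2 n)
      then show ?thesis using Suc.prems by simp
    next
      case (3 n m ms)
      show ?thesis
      proof (cases ms)
        case Nil
        show ?thesis
          unfolding 3 Nil ffnn.simps by (rule aff[OF Suc.prems])
      next
        case (Cons l ls)
        show ?thesis
          unfolding 3 Cons ffnn.simps
        proof (rule Suc.hyps(1))
          show "r = length (m # l # ls)" using Suc.hyps(2) 3 Cons by simp
          show "Ck_ext k S K (\<lambda>p. act (affine_layer n \<theta> (z p) i))" for i
            by (rule Ck_ext_compose_smooth[OF assms(1,2) aff[OF Suc.prems]])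
        qed
      qed
    qed
  qed
  from this[of z, OF assms(3)] show ?thesis .
qed

text \<open>\<open>\<Phi>\<close> is general so that it can be the graph parametrisation of the
  lateral boundary. The hypothesis covers every vector \<open>c\<close>, since \<open>coords\<close>
  at an index beyond the enumeration is the inner product with an unspecified vector.\<close>

lemma Ck_ext_network:
  fixes \<Phi> :: "'e::euclidean_space \<Rightarrow> 'a::euclidean_space \<times> real"
  assumes "open S" "\<And>m. Ck_on m UNIV act" "\<And>c. Ck_ext k S K (\<lambda>p. \<Phi> p \<bullet> c)"
  shows "Ck_ext k S K (\<lambda>p. network act ns \<theta> (\<Phi> p))"
proof -
  have "Ck_ext k S K (\<lambda>p. coords (\<Phi> p) i)" for i
    unfolding coords_def by (rule assms(3))
  from Ck_ext_ffnn[where z = "\<lambda>p. coords (\<Phi> p)", OF assms(1,2) this]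
  show ?thesis
    unfolding network_def .
qed

lemma extension_fst:
  assumes "\<exists>G. continuous_on UNIV G \<and> (\<forall>x\<in>UNIV. G x = \<gamma> x)"
  shows "\<exists>G. continuous_on UNIV G \<and> (\<forall>x\<in>UNIV. G x = \<gamma> (fst x))"
proof -
  obtain G where G: "continuous_on UNIV G" "\<forall>x\<in>UNIV. G x = \<gamma> x" using assms by blast
  have "continuous_on UNIV (\<lambda>x. G (fst x))"
    by (rule continuous_on_compose2[OF G(1) continuous_on_fst[OF continuous_on_id]]) simp
  then show ?thesis using G(2) by (intro exI[of _ "\<lambda>x. G (fst x)"]) simp
qed

lemma Ck_ext_fst:
  fixes \<gamma> :: "'a::euclidean_space \<Rightarrow> real"
  assumes "Ck_ext k UNIV UNIV \<gamma>"
  shows "Ck_ext k UNIV UNIV (\<lambda>p::'a \<times> real. \<gamma> (fst p))"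
  using assms
proof (induction k arbitrary: \<gamma>)
  case 0
  then show ?case
    unfolding Ck_ext_0 by (rule extension_fst)
next
  case (Suc k)
  have E: "\<exists>G. continuous_on UNIV G \<and> (\<forall>x\<in>UNIV. G x = \<gamma> (fst x))"
    by (rule extension_fst[OF Ck_ext_imp_extension[OF Suc.prems]])
  have "pd (b, 0) (\<lambda>p::'a \<times> real. \<gamma> (fst p)) = (\<lambda>p. pd b \<gamma> (fst p))" for b
    by (simp add: pd_def fun_eq_iff)
  moreover have "pd (0, 1) (\<lambda>p::'a \<times> real. \<gamma> (fst p)) = (\<lambda>p. 0)"
    by (simp add: pd_def fun_eq_iff)
  ultimately show ?case
    unfolding Ck_ext_Suc using Suc E
    by (auto simp: Basis_prod_def Ck_ext_Suc)
qed

section \<open>Bounds for derivatives, and traces at the initial time\<close>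

lemma finite_multi_indices: "finite (multi_indices k :: 'e::euclidean_space list set)"
  unfolding multi_indices_def by (rule finite_lists_length_le) simp

text \<open>There are finitely many multi-indices, and each derivative is the restriction of a
  continuous function on the compact \<open>K\<close>.\<close>

lemma bdd_above_Ck_vals:
  assumes "Ck_ext k (interior S) K g" "compact K" "interior S \<subseteq> K"
  shows "bdd_above (Ck_vals k S g)"
proof -
  have eq: "Ck_vals k S g = (\<Union>bs\<in>multi_indices k. (\<lambda>x. \<bar>pds bs g x\<bar>) ` interior S)"
    by (auto simp: Ck_vals_def)
  have "bdd_above ((\<lambda>x. \<bar>pds bs g x\<bar>) ` interior S)" if "bs \<in> multi_indices k" for bs
  proof -
    have "\<exists>G. continuous_on K G \<and> (\<forall>x \<in> interior S. G x = pds bs g x)"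
      using assms(1) that by (simp add: Ck_ext_def)
    then obtain G where G: "continuous_on K G" "\<And>x. x \<in> interior S \<Longrightarrow> G x = pds bs g x"
      by blast
    have "bounded (G ` K)"
      using G(1) assms(2) compact_continuous_image compact_imp_bounded by blast
    then obtain B where "\<And>x. x \<in> K \<Longrightarrow> \<bar>G x\<bar> \<le> B"
      by (force simp: bounded_iff)
    then show ?thesis
      using G(2) assms(3) by (intro bdd_aboveI2[of _ _ B]) force
  qed
  then show ?thesis
    unfolding eq by (simp add: finite_multi_indices)
qed

lemma Ck_bddI:
  assumes "continuous_on S g" "Ck_ext k (interior S) K g" "compact K" "S \<subseteq> K"
  shows "Ck_bdd k S g"
proof -
  have "interior S \<subseteq> K" using assms(4) interior_subset by blast
  then show ?thesis
    using assms bdd_above_Ck_vals[OF assms(2,3)]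
    by (auto simp: Ck_bdd_def Ck_on_iff intro: Ck_ext_subset)
qed

text \<open>Passes a derivative in a space direction from positive times to time 0. For small
  \<open>t\<close> the mean value inequality bounds the deviation of the increment of
  \<open>G\<close> at time \<open>t\<close> from \<open>h * G' (x, 0)\<close> by
  \<open>\<bar>h\<bar> * (e/2)\<close>, uniformly in \<open>t\<close>; then \<open>t\<close> tends
  to 0.\<close>

lemma slice_has_derivative:
  fixes G G' :: "'a::euclidean_space \<times> real \<Rightarrow> real"
  assumes D: "open D" "x \<in> D" and T: "T > 0"
    and G: "continuous_on (closure D \<times> {0..T}) G" and G': "continuous_on (closure D \<times> {0..T}) G'"
    and der: "\<And>y t. y \<in> D \<Longrightarrow> t \<in> {0<..<T} \<Longrightarrow>
        ((\<lambda>h. G (y + h *\<^sub>R b, t)) has_real_derivative G' (y, t)) (at 0)"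
  shows "((\<lambda>h. G (x + h *\<^sub>R b, 0)) has_real_derivative G' (x, 0)) (at 0)"
proof -
  obtain r where r: "r > 0" "ball x r \<subseteq> D"
    using D openE by blast
  have xD: "y \<in> closure D" if "y \<in> D" for y using that closure_subset by blast
  have der': "((\<lambda>h. G (x + h *\<^sub>R b, t)) has_real_derivative G' (x + h *\<^sub>R b, t)) (at h)"
    if "x + h *\<^sub>R b \<in> D" "t \<in> {0<..<T}" for h t
    using der[OF that] DERIV_shift[of "\<lambda>h. G (x + h *\<^sub>R b, t)" _ 0 h]
    by (simp add: algebra_simps)
  have "((\<lambda>h. (G (x + h *\<^sub>R b, 0) - G (x, 0)) / h) \<longlongrightarrow> G' (x, 0)) (at 0)"
    unfolding LIM_def
  proof (intro allI impI)
    fix e :: real assume e: "e > 0"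
    obtain d where d: "d > 0" "\<And>p. p \<in> closure D \<times> {0..T} \<Longrightarrow> dist p (x, 0) < d \<Longrightarrow> dist (G' p) (G' (x, 0)) < e/2"
      using G'[unfolded continuous_on_iff, rule_format, of "(x,0)" "e/2"] xD[OF D(2)] T e by auto
    \<comment> \<open>The step in space uses up \<open>d/2\<close> and the time \<open>t\<close> the
      other half of \<open>d\<close>; the summand 1 in the denominator covers
      \<open>b = 0\<close>.\<close>
    define \<delta> where "\<delta> = min (d/2) r / (norm b + 1)"
    have nb: "norm b + 1 > 0" by (simp add: add_nonneg_pos)
    have \<delta>: "\<delta> > 0" using d r nb by (simp add: \<delta>_def)
    have small: "norm (h *\<^sub>R b) < d/2 \<and> norm (h *\<^sub>R b) < r" if "\<bar>h\<bar> < \<delta>" for h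
    proof -
      have "\<bar>h\<bar> * norm b \<le> \<bar>h\<bar> * (norm b + 1)" by (simp add: algebra_simps)
      also have "\<dots> < \<delta> * (norm b + 1)" using that nb by simp
      also have "\<dots> = min (d/2) r" using nb by (simp add: \<delta>_def)
      finally show ?thesis by simp
    qed
    have inD: "x + h *\<^sub>R b \<in> D" if "\<bar>h\<bar> < \<delta>" for h
      using small[OF that] r(2) by (auto simp: dist_norm)
    have "dist ((G (x + h *\<^sub>R b, 0) - G (x, 0)) / h) (G' (x, 0)) < e" if h: "h \<noteq> 0" "\<bar>h\<bar> < \<delta>" for h
    proof -
      have est: "\<bar>(G (x + h *\<^sub>R b, t) - G (x, t)) - h * G' (x, 0)\<bar> \<le> \<bar>h\<bar> * (e/2)"
        if t: "t \<in> {0<..<T}" "t < d/2" for t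
      proof -
        have "norm ((G (x + h *\<^sub>R b, t) - h * G' (x, 0)) - (G (x + 0 *\<^sub>R b, t) - 0 * G' (x, 0))) \<le> (e/2) * norm (h - 0)"
        proof (rule field_differentiable_bound[where S = "{-\<bar>h\<bar>..\<bar>h\<bar>}" and
              f = "\<lambda>k. G (x + k *\<^sub>R b, t) - k * G' (x, 0)" and f' = "\<lambda>k. G' (x + k *\<^sub>R b, t) - G' (x, 0)"])
          fix k assume "k \<in> {-\<bar>h\<bar>..\<bar>h\<bar>}"
          then have k: "\<bar>k\<bar> < \<delta>" using h by auto
          show "((\<lambda>k. G (x + k *\<^sub>R b, t) - k * G' (x, 0)) has_field_derivative G' (x + k *\<^sub>R b, t) - G' (x, 0))
                  (at k within {-\<bar>h\<bar>..\<bar>h\<bar>})"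
          proof (rule has_field_derivative_at_within)
            show "((\<lambda>k. G (x + k *\<^sub>R b, t) - k * G' (x, 0)) has_field_derivative G' (x + k *\<^sub>R b, t) - G' (x, 0)) (at k)"
            proof (rule DERIV_diff[OF der'[OF inD[OF k] t(1)]])
              show "((\<lambda>k. k * G' (x, 0)) has_field_derivative G' (x, 0)) (at k)"
                by (auto intro!: derivative_eq_intros)
            qed
          qed
          have "dist (x + k *\<^sub>R b, t) (x, 0) \<le> norm (k *\<^sub>R b) + \<bar>t\<bar>"
            using sqrt_sum_squares_le_sum_abs[of "norm (k *\<^sub>R b)" t] by (simp add: dist_norm norm_Pair)
          also have "\<dots> < d" using small[OF k] t by auto
          finally show "norm (G' (x + k *\<^sub>R b, t) - G' (x, 0)) \<le> e/2"
            using d(2)[of "(x + k *\<^sub>R b, t)"] xD[OF inD[OF k]] t by (auto simp: dist_norm)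
        qed auto
        then show ?thesis by (simp add: algebra_simps)
      qed
      have lim: "((\<lambda>t. G (y, t)) \<longlongrightarrow> G (y, 0)) (at_right 0)" if "y \<in> D" for y
      proof -
        have "continuous_on {0..T} (\<lambda>t. G (y, t))"
          by (rule continuous_on_compose2[OF G]) (use xD[OF that] in \<open>auto intro!: continuous_intros\<close>)
        then have "((\<lambda>t. G (y, t)) \<longlongrightarrow> G (y, 0)) (at 0 within {0..T})"
          using T by (auto simp: continuous_on_def)
        then show ?thesis by (simp add: at_within_Icc_at_right[OF T])
      qed
      have "\<bar>(G (x + h *\<^sub>R b, 0) - G (x, 0)) - h * G' (x, 0)\<bar> \<le> \<bar>h\<bar> * (e/2)"
      proof (rule tendsto_upperbound)
        show "((\<lambda>t. \<bar>(G (x + h *\<^sub>R b, t) - G (x, t)) - h * G' (x, 0)\<bar>) \<longlongrightarrow>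
            \<bar>(G (x + h *\<^sub>R b, 0) - G (x, 0)) - h * G' (x, 0)\<bar>) (at_right 0)"
          by (intro tendsto_intros lim inD D h)
        show "\<forall>\<^sub>F t in at_right 0. \<bar>(G (x + h *\<^sub>R b, t) - G (x, t)) - h * G' (x, 0)\<bar> \<le> \<bar>h\<bar> * (e/2)"
          unfolding eventually_at_right_field
          using est T d by (intro exI[of _ "min T (d/2)"]) auto
      qed simp
      moreover have "(G (x + h *\<^sub>R b, 0) - G (x, 0)) / h - G' (x, 0) =
          ((G (x + h *\<^sub>R b, 0) - G (x, 0)) - h * G' (x, 0)) / h"
        using h(1) by (simp add: field_simps)
      ultimately have "\<bar>(G (x + h *\<^sub>R b, 0) - G (x, 0)) / h - G' (x, 0)\<bar> \<le> e/2"
        using h(1) by (simp add: abs_divide pos_divide_le_eq mult.commute)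
      then show ?thesis using e by (simp add: dist_real_def)
    qed
    then show "\<exists>s>0. \<forall>h. h \<noteq> 0 \<and> dist h 0 < s \<longrightarrow> dist ((G (x + h *\<^sub>R b, 0) - G (x, 0)) / h) (G' (x, 0)) < e"
      using \<delta> by (intro exI[of _ \<delta>]) (simp add: dist_real_def)
  qed
  then show ?thesis
    by (simp add: has_field_derivative_iff)
qed

lemma cylinder_subset_interior:
  fixes D :: "'a::euclidean_space set"
  assumes "open D"
  shows "D \<times> {0<..<T::real} \<subseteq> interior (closure D \<times> {0..T})"
proof (rule interior_maximal)
  show "D \<times> {0<..<T} \<subseteq> closure D \<times> {0..T}"
    by (rule Sigma_mono) (auto intro: subsetD[OF closure_subset])
  show "open (D \<times> {0<..<T})"
    using assms by (intro open_Times) auto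
qed

text \<open>The slice \<open>t = 0\<close> lies on the boundary of the cylinder, where
  \<open>pds\<close> of \<open>v\<close> would depend on values of \<open>v\<close> outside. The
  derivatives of the trace are identified instead with the values at \<open>t = 0\<close> of the
  extended spatial derivatives, by induction along the list of directions.\<close>

lemma Ck_ext_slice:
  fixes T :: real
  assumes D: "open D" and T: "T > 0" and v: "Ck_on k (closure D \<times> {0..T}) v"
  shows "Ck_ext k D (closure D) (\<lambda>x. v (x, 0))"
proof -
  let ?K = "closure D \<times> {0..T}"
  let ?l = "map (\<lambda>b::'a. (b, 0::real))"
  note sub = cylinder_subset_interior[OF D, of T]
  have ext: "Ck_ext k (interior ?K) ?K v" and cv: "continuous_on ?K v"
    using v by (auto simp: Ck_on_iff)
  have l: "?l bs \<in> multi_indices k" if "bs \<in> multi_indices k" for bs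
    using that by (auto simp: multi_indices_def Basis_prod_def)
  \<comment> \<open>For the empty list the extension is \<open>v\<close> itself, so that the trace
    of \<open>G []\<close> is \<open>v (x, 0)\<close>; the induction in \<open>val\<close> starts
    there.\<close>
  define G where "G bs = (if bs = [] then v else SOME G. continuous_on ?K G \<and> (\<forall>p\<in>interior ?K. G p = pds (?l bs) v p))" for bs
  have G: "continuous_on ?K (G bs)" "\<And>p. p \<in> interior ?K \<Longrightarrow> G bs p = pds (?l bs) v p"
    if "bs \<in> multi_indices k" for bs
  proof -
    have "\<exists>G. continuous_on ?K G \<and> (\<forall>p\<in>interior ?K. G p = pds (?l bs) v p)"
      using ext l[OF that] by (auto simp: Ck_ext_def)
    from someI_ex[OF this] show "continuous_on ?K (G bs)" "\<And>p. p \<in> interior ?K \<Longrightarrow> G bs p = pds (?l bs) v p"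
      using cv by (auto simp: G_def)
  qed
  have step: "((\<lambda>h. G bs (x + h *\<^sub>R b, 0)) has_real_derivative G (b # bs) (x, 0)) (at 0)"
    if "b # bs \<in> multi_indices k" "x \<in> D" for b bs x
  proof (rule slice_has_derivative[OF D that(2) T G(1) G(1)])
    show bs: "bs \<in> multi_indices k" and "b # bs \<in> multi_indices k"
      using that by (auto simp: multi_indices_def)
    fix y t assume yt: "y \<in> D" "t \<in> {0<..<T}"
    then have p: "(y, t) \<in> interior ?K" using sub by auto
    have bB: "(b, 0::real) \<in> Basis" "length (?l bs) < k"
      using that(1) by (auto simp: multi_indices_def Basis_prod_def)
    have "(\<lambda>h. pds (?l bs) v ((y, t) + h *\<^sub>R (b, 0))) differentiable at 0"
      using bspec[OF ext[unfolded Ck_ext_def] l[OF bs]] bB(2) p bB(1) by blast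
    from pd_has_derivative[OF this]
    have "((\<lambda>h. pds (?l bs) v ((y, t) + h *\<^sub>R (b, 0))) has_real_derivative G (b # bs) (y, t)) (at 0)"
      using G(2)[OF that(1) p] by simp
    moreover have "eventually (\<lambda>h. pds (?l bs) v ((y, t) + h *\<^sub>R (b, 0)) = G bs (y + h *\<^sub>R b, t)) (nhds 0)"
      using eventually_line_in_open[OF open_interior p, of "(b, 0)"]
      by (rule eventually_mono) (use G(2)[OF bs] in auto)
    ultimately show "((\<lambda>h. G bs (y + h *\<^sub>R b, t)) has_real_derivative G (b # bs) (y, t)) (at 0)"
      using DERIV_cong_ev[of 0 0 "\<lambda>h. pds (?l bs) v ((y, t) + h *\<^sub>R (b, 0))" "\<lambda>h. G bs (y + h *\<^sub>R b, t)"]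
      by simp
  qed
  have val: "pds bs (\<lambda>x. v (x, 0)) x = G bs (x, 0)" if "bs \<in> multi_indices k" "x \<in> D" for bs x
    using that
  proof (induction bs arbitrary: x)
    case Nil
    then show ?case by (simp add: G_def)
  next
    case (Cons b bs)
    then have bs: "bs \<in> multi_indices k" by (auto simp: multi_indices_def)
    have "pd b (pds bs (\<lambda>x. v (x, 0))) x = pd b (\<lambda>x. G bs (x, 0)) x"
      by (rule pd_cong[OF D Cons.prems(2)]) (use Cons.IH bs in auto)
    then show ?case
      using pd_eqI[of "\<lambda>x. G bs (x, 0)", OF step[OF Cons.prems]] by simp
  qed
  show ?thesis
    unfolding Ck_ext_def
  proof (intro ballI conjI impI)
    fix bs :: "'a list" assume bs: "bs \<in> multi_indices k"
    have "continuous_on (closure D) (\<lambda>x. G bs (x, 0))"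
      by (rule continuous_on_compose2[OF G(1)[OF bs]]) (use T in \<open>auto intro!: continuous_intros\<close>)
    then show "\<exists>G. continuous_on (closure D) G \<and> (\<forall>x\<in>D. G x = pds bs (\<lambda>x. v (x, 0)) x)"
      using val[OF bs] by (intro exI[of _ "\<lambda>x. G bs (x, 0)"]) auto
    fix x b :: 'a assume len: "length bs < k" and x: "x \<in> D" and b: "b \<in> Basis"
    then have "b # bs \<in> multi_indices k" using bs by (auto simp: multi_indices_def)
    from step[OF this x] have "(\<lambda>h. G bs (x + h *\<^sub>R b, 0)) differentiable at 0"
      unfolding real_differentiable_def by blast
    then show "(\<lambda>h. pds bs (\<lambda>x. v (x, 0)) (x + h *\<^sub>R b)) differentiable at 0"
      using line_differentiable_cong[OF D x, of "\<lambda>x. G bs (x, 0)" "pds bs (\<lambda>x. v (x, 0))"] val[OF bs]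
      by simp
  qed
qed

text \<open>In a chart the boundary point is the image of a map whose components are linear terms
  plus multiples of \<open>\<gamma>\<close>. Since \<open>act\<close> is smooth on the whole line,
  the network is smooth on the whole space, and the composition is C^k for all parameters, not only
  those of the chart.\<close>

lemma Ck_lateral_network_square:
  fixes D :: "'a::euclidean_space set"
  assumes "\<And>m. Ck_on m UNIV act" "boundary_atlas k D \<A>"
  shows "Ck_lateral k \<A> T (\<lambda>p. (network act ns \<theta> p)\<^sup>2)"
  unfolding Ck_lateral_def
proof
  fix c assume c: "c \<in> \<A>"
  obtain e s \<gamma> U where ceq: "c = (e, s, \<gamma>, U)" by (cases c)
  have "Ck_on k UNIV \<gamma>"
    using assms(2) c by (auto simp: boundary_atlas_def ceq)
  then have g: "Ck_ext k UNIV UNIV \<gamma>" by (simp add: Ck_on_iff)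
  have lin: "Ck_ext k UNIV UNIV (\<lambda>p::'a \<times> real. (graph_pt e \<gamma> (fst p), snd p) \<bullet> q)" for q
  proof -
    have eq: "(graph_pt e \<gamma> (fst p), snd p) \<bullet> q =
        p \<bullet> q + (\<gamma> (fst p) + (-1) * (p \<bullet> (e, 0))) * (e \<bullet> fst q)" for p
      by (cases p; cases q) (simp add: graph_pt_def inner_Pair algebra_simps inner_add_left)
    show ?thesis
      unfolding eq
      by (intro Ck_ext_add Ck_ext_mult Ck_ext_fst Ck_ext_inner_left Ck_ext_const g open_UNIV)
  qed
  have n: "Ck_ext k UNIV UNIV (\<lambda>p::'a \<times> real. network act ns \<theta> (graph_pt e \<gamma> (fst p), snd p))"
    by (rule Ck_ext_network[OF open_UNIV assms(1) lin])
  have "Ck_ext k UNIV UNIV (\<lambda>p::'a \<times> real. (network act ns \<theta> (graph_pt e \<gamma> (fst p), snd p))\<^sup>2)"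
    unfolding power2_eq_square by (rule Ck_ext_mult[OF open_UNIV n n])
  then have sq: "Ck_ext k UNIV UNIV (chart_pull c (\<lambda>p. (network act ns \<theta> p)\<^sup>2))"
    by (simp add: ceq case_prod_beta')
  show "Ck_on k (chart_param T c) (chart_pull c (\<lambda>p. (network act ns \<theta> p)\<^sup>2))"
    unfolding Ck_on_iff
  proof
    show "Ck_ext k (interior (chart_param T c)) (chart_param T c) (chart_pull c (\<lambda>p. (network act ns \<theta> p)\<^sup>2))"
      by (rule Ck_ext_subset[OF sq]) auto
    show "continuous_on (chart_param T c) (chart_pull c (\<lambda>p. (network act ns \<theta> p)\<^sup>2))"
      using Ck_ext_imp_extension[OF sq] continuous_on_subset
      by (metis (no_types, lifting) UNIV_I continuous_on_cong subset_UNIV)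
  qed
qed

section \<open>Surface measure\<close>

lemma set_integrable_continuous_compact:
  fixes f :: "'a::euclidean_space \<Rightarrow> real"
  assumes "compact K" "continuous_on K f" "A \<subseteq> K" "A \<in> sets borel" "sets M = sets borel" "emeasure M A < \<infinity>"
  shows "set_integrable M A f"
proof -
  have "bounded (f ` K)"
    using assms(1,2) compact_continuous_image compact_imp_bounded by blast
  then obtain B where B: "\<And>x. x \<in> K \<Longrightarrow> \<bar>f x\<bar> \<le> B"
    by (force simp: bounded_iff)
  have m: "(\<lambda>x. indicator A x *\<^sub>R f x) \<in> borel_measurable borel"
    by (rule borel_measurable_continuous_on_indicator[OF assms(4) continuous_on_subset[OF assms(2,3)]])
  show ?thesis
    unfolding set_integrable_def
  proof (rule integrableI_bounded_set[of A _ _ B])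
    show "A \<in> sets M" using assms by simp
    show "(\<lambda>x. indicator A x *\<^sub>R f x) \<in> borel_measurable M"
      using m assms(5) measurable_cong_sets by blast
    show "AE x in M. x \<in> A \<longrightarrow> norm (indicator A x *\<^sub>R f x) \<le> B"
      using B assms(3) by auto
  qed (use assms in auto)
qed

section \<open>Integrals of directional derivatives\<close>

lemma DERIV_imp_difference_quotient_LIMSEQ:
  assumes "(g has_real_derivative d) (at 0)"
  shows "(\<lambda>n. real (Suc n) * (g (1 / real (Suc n)) - g 0)) \<longlonglongrightarrow> d"
proof -
  have "((\<lambda>h. (g h - g 0) / h) \<longlongrightarrow> d) (at 0)"
    using assms by (simp add: has_field_derivative_iff)
  moreover have "filterlim (\<lambda>n. 1 / real (Suc n)) (at 0) sequentially"
    by (rule filterlim_atI) (use LIMSEQ_inverse_real_of_nat in \<open>auto simp: inverse_eq_divide\<close>)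
  ultimately have "(\<lambda>n. (g (1 / real (Suc n)) - g 0) / (1 / real (Suc n))) \<longlonglongrightarrow> d"
    by (rule filterlim_compose)
  then show ?thesis by (simp add: mult.commute)
qed

text \<open>By translation invariance every difference quotient has integral zero.\<close>

lemma integral_directional_derivative_eq_0:
  fixes Z Z' :: "'a::euclidean_space \<Rightarrow> real"
  assumes der: "\<And>x. ((\<lambda>h. Z (x + h *\<^sub>R b)) has_real_derivative Z' x) (at 0)"
    and Z[measurable]: "Z \<in> borel_measurable borel"
    and ZB: "\<And>x. \<bar>Z x\<bar> \<le> C" and Z'B: "\<And>x. \<bar>Z' x\<bar> \<le> B"
    and supp: "\<And>x. norm x > R \<Longrightarrow> Z x = 0"
  shows "integrable lborel Z'" "(LINT x|lborel. Z' x) = 0"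
proof -
  define s where "s n x = real (Suc n) * (Z (x + (1 / real (Suc n)) *\<^sub>R b) - Z x)" for n x
  have s[measurable]: "s n \<in> borel_measurable borel" for n
    unfolding s_def by measurable
  have lim: "(\<lambda>n. s n x) \<longlonglongrightarrow> Z' x" for x
    using DERIV_imp_difference_quotient_LIMSEQ[OF der[of x]] by (simp add: s_def)
  have Z'[measurable]: "Z' \<in> borel_measurable borel"
    by (rule borel_measurable_LIMSEQ_real[OF lim s])
  have derh: "((\<lambda>h. Z (x + h *\<^sub>R b)) has_real_derivative Z' (x + h *\<^sub>R b)) (at h)" for x h
    using der[of "x + h *\<^sub>R b"] DERIV_shift[of "\<lambda>h. Z (x + h *\<^sub>R b)" _ 0 h]
    by (simp add: algebra_simps)
  \<comment> \<open>All shifts have length at most \<open>norm b\<close>, so every difference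
    quotient vanishes off this one ball; this gives an integrable majorant common to all
    \<open>n\<close>.\<close>
  let ?K = "cball (0::'a) (R + norm b)"
  have fin: "emeasure lborel ?K < \<infinity>"
    by (rule emeasure_bounded_finite) simp
  have intZ: "integrable lborel Z"
    by (rule integrableI_bounded_set[of "cball 0 R" _ _ C])
       (use ZB supp emeasure_bounded_finite[OF bounded_cball, of "0::'a" R] in \<open>auto simp: not_le\<close>)
  have sB: "\<bar>s n x\<bar> \<le> B" for n x
  proof -
    have "\<bar>Z (x + (1 / real (Suc n)) *\<^sub>R b) - Z (x + 0 *\<^sub>R b)\<bar> \<le> B * norm (1 / real (Suc n) - 0)"
      using field_differentiable_bound[of UNIV "\<lambda>h. Z (x + h *\<^sub>R b)" "\<lambda>h. Z' (x + h *\<^sub>R b)" B "1 / real (Suc n)" 0]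
        derh Z'B by simp
    then have "real (Suc n) * \<bar>Z (x + (1 / real (Suc n)) *\<^sub>R b) - Z x\<bar> \<le> real (Suc n) * (B * (1 / real (Suc n)))"
      by (intro mult_left_mono) simp_all
    also have "\<dots> = B" by simp
    finally show ?thesis
      by (simp add: s_def abs_mult del: of_nat_Suc)
  qed
  have s0: "s n x = 0" if "x \<notin> ?K" for n x
  proof -
    have x: "norm x > R + norm b" using that by simp
    have "norm ((1 / real (Suc n)) *\<^sub>R b) \<le> norm b"
      using mult_left_le[of "1 / real (Suc n)" "norm b"] by (simp add: mult.commute)
    then have "norm (x + (1 / real (Suc n)) *\<^sub>R b) > R"
      using norm_triangle_ineq2[of x "- ((1 / real (Suc n)) *\<^sub>R b)"] x by simp
    moreover have "norm x > R" using x norm_ge_zero[of b] by linarith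
    ultimately show ?thesis by (simp add: s_def supp)
  qed
  have B0: "0 \<le> B" using Z'B[of 0] by linarith
  have w: "integrable lborel (\<lambda>x. B * indicator ?K x)"
    using fin by (intro integrable_mult_right integrable_real_indicator) auto
  have bd: "AE x in lborel. norm (s n x) \<le> B * indicator ?K x" for n
    using sB s0 B0 by (auto simp: indicator_def)
  show "integrable lborel Z'"
    by (rule integrable_dominated_convergence[where s = s and w = "\<lambda>x. B * indicator ?K x"])
       (use w bd lim in auto)
  have "(\<lambda>n. LINT x|lborel. s n x) \<longlonglongrightarrow> (LINT x|lborel. Z' x)"
    by (rule integral_dominated_convergence[where w = "\<lambda>x. B * indicator ?K x"])
       (use w bd lim in auto)
  moreover have "(LINT x|lborel. s n x) = 0" for n
  proof -
    let ?c = "(1 / real (Suc n)) *\<^sub>R b"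
    have i: "integrable lborel (\<lambda>x. Z (x + ?c))" and e: "(LINT x|lborel. Z (x + ?c)) = (LINT x|lborel. Z x)"
      using integrable_distr_eq[of "(+) ?c" lborel borel Z] integral_distr[of "(+) ?c" lborel borel Z] intZ
      by (auto simp: lborel_distr_plus add.commute)
    show ?thesis
      unfolding s_def using i e intZ by simp
  qed
  ultimately show "(LINT x|lborel. Z' x) = 0"
    by (simp add: LIMSEQ_const_iff)
qed

section \<open>Lebesgue measure in graph coordinates\<close>

lemma sets_hyperplane_measure [measurable_cong, simp]: "sets (hyperplane_measure e) = sets borel"
  by (simp add: hyperplane_measure_def)

text \<open>\<open>lborel\<close> is the image of the product measure over \<open>Basis\<close>, and
  \<open>hyperplane_measure e\<close> that of the product over the remaining directions; the claim
  is Tonelli's theorem for the factor \<open>e\<close>.\<close>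

lemma nn_integral_lborel_hyperplane:
  fixes e :: "'a::euclidean_space"
  assumes e: "e \<in> Basis" and g[measurable]: "g \<in> borel_measurable borel"
  shows "(\<integral>\<^sup>+ x. g x \<partial>lborel) = (\<integral>\<^sup>+ y. (\<integral>\<^sup>+ r. g (y + r *\<^sub>R e) \<partial>lborel) \<partial>hyperplane_measure e)"
proof -
  interpret product_sigma_finite "\<lambda>_::'a. lborel :: real measure"
    by (rule product_sigma_finite.intro) (rule sigma_finite_lborel)
  let ?B = "Basis - {e}"
  have ins: "insert e ?B = Basis" using e by blast
  have m: "(\<lambda>f. \<Sum>b\<in>I. f b *\<^sub>R b) \<in> borel_measurable (Pi\<^sub>M I (\<lambda>_. lborel :: real measure))"
    for I :: "'a set"
    by measurable
  have "(\<integral>\<^sup>+ x. g x \<partial>lborel) = (\<integral>\<^sup>+ f. g (\<Sum>b\<in>Basis. f b *\<^sub>R b) \<partial>Pi\<^sub>M Basis (\<lambda>_. lborel))"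
    by (subst lborel_eq) (rule nn_integral_distr[OF m], simp)
  also have "\<dots> = (\<integral>\<^sup>+ f. g (\<Sum>b\<in>insert e ?B. f b *\<^sub>R b) \<partial>Pi\<^sub>M (insert e ?B) (\<lambda>_. lborel))"
    by (simp only: ins)
  also have "\<dots> = (\<integral>\<^sup>+ f. (\<integral>\<^sup>+ r. g (\<Sum>b\<in>insert e ?B. (f(e := r)) b *\<^sub>R b) \<partial>lborel) \<partial>Pi\<^sub>M ?B (\<lambda>_. lborel))"
  proof (rule product_nn_integral_insert)
    show "(\<lambda>f. g (\<Sum>b\<in>insert e ?B. f b *\<^sub>R b)) \<in> borel_measurable (Pi\<^sub>M (insert e ?B) (\<lambda>_. lborel))"
      by (rule measurable_compose[OF m]) simp
  qed auto
  also have "\<dots> = (\<integral>\<^sup>+ f. (\<integral>\<^sup>+ r. g ((\<Sum>b\<in>?B. f b *\<^sub>R b) + r *\<^sub>R e) \<partial>lborel) \<partial>Pi\<^sub>M ?B (\<lambda>_. lborel))"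
  proof -
    have "(\<Sum>b\<in>insert e ?B. (f(e := r)) b *\<^sub>R b) = (\<Sum>b\<in>?B. f b *\<^sub>R b) + r *\<^sub>R e" for f :: "'a \<Rightarrow> real" and r
      by (subst sum.insert) (auto simp: add.commute intro!: sum.cong)
    then show ?thesis by simp
  qed
  also have "\<dots> = (\<integral>\<^sup>+ y. (\<integral>\<^sup>+ r. g (y + r *\<^sub>R e) \<partial>lborel) \<partial>hyperplane_measure e)"
    unfolding hyperplane_measure_def by (subst nn_integral_distr[OF m]) simp_all
  finally show ?thesis .
qed

text \<open>On each line in direction \<open>e\<close> this is the affine substitution that moves
  the origin to the graph and orients the line by \<open>s\<close>; its Jacobian is 1. In a chart
  the new variable \<open>r\<close> is the signed distance to the graph.\<close>

lemma nn_integral_lborel_graph: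
  fixes e :: "'a::euclidean_space"
  assumes e: "e \<in> Basis" and s: "s \<in> {1, -1::real}" and g[measurable]: "g \<in> borel_measurable borel"
  shows "(\<integral>\<^sup>+ x. g x \<partial>lborel) =
    (\<integral>\<^sup>+ y. (\<integral>\<^sup>+ r. g (graph_pt e \<gamma> y + (s * r) *\<^sub>R e) \<partial>lborel) \<partial>hyperplane_measure e)"
proof -
  have "(\<integral>\<^sup>+ r. g (y + r *\<^sub>R e) \<partial>lborel) = (\<integral>\<^sup>+ r. g (graph_pt e \<gamma> y + (s * r) *\<^sub>R e) \<partial>lborel)" for y
  proof -
    have [measurable]: "(\<lambda>r. g (y + r *\<^sub>R e)) \<in> borel_measurable borel"
      by measurable
    show ?thesis
      using s by (subst nn_integral_real_affine[of "\<lambda>r. g (y + r *\<^sub>R e)" s "\<gamma> y - y \<bullet> e"])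
        (auto simp: graph_pt_def algebra_simps)
  qed
  then show ?thesis
    by (simp add: nn_integral_lborel_hyperplane[OF e g])
qed

section \<open>Area element and finiteness of the surface measure\<close>

lemma pd_graph_invariant:
  fixes \<gamma> :: "'a::euclidean_space \<Rightarrow> real"
  assumes "\<And>y r. \<gamma> (y + r *\<^sub>R e) = \<gamma> y"
  shows "pd b \<gamma> (y + r *\<^sub>R e) = pd b \<gamma> y"
proof -
  have "\<gamma> (y + r *\<^sub>R e + h *\<^sub>R b) = \<gamma> (y + h *\<^sub>R b)" for h
    using assms[of "y + h *\<^sub>R b" r] by (simp add: algebra_simps)
  then show ?thesis by (simp add: pd_def)
qed

lemma Ck_on_1_UNIV:
  assumes "Ck_on 1 UNIV \<gamma>"
  shows "continuous_on UNIV \<gamma>"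
    and "b \<in> Basis \<Longrightarrow> continuous_on UNIV (pd b \<gamma>)"
    and "b \<in> Basis \<Longrightarrow> ((\<lambda>h. \<gamma> (x + h *\<^sub>R b)) has_real_derivative pd b \<gamma> x) (at 0)"
proof -
  have E: "Ck_ext 1 UNIV UNIV \<gamma>" and c: "continuous_on UNIV \<gamma>"
    using assms by (auto simp: Ck_on_iff)
  show "continuous_on UNIV \<gamma>" by (rule c)
  assume b: "b \<in> Basis"
  have "Ck_ext 0 UNIV UNIV (pd b \<gamma>)" and d: "(\<lambda>h. \<gamma> (x + h *\<^sub>R b)) differentiable (at 0)"
    using E b by (auto simp: Ck_ext_Suc)
  then obtain G where "continuous_on UNIV G" "\<forall>x\<in>UNIV. G x = pd b \<gamma> x"
    by (auto simp: Ck_ext_0)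
  moreover from this have "G = pd b \<gamma>" by auto
  ultimately show "continuous_on UNIV (pd b \<gamma>)" by simp
  show "((\<lambda>h. \<gamma> (x + h *\<^sub>R b)) has_real_derivative pd b \<gamma> x) (at 0)"
    by (rule pd_has_derivative[OF d])
qed

lemma inner_graph_pt: "e \<in> Basis \<Longrightarrow> graph_pt e \<gamma> y \<bullet> e = \<gamma> y"
  by (simp add: graph_pt_def inner_add_left)

lemma graph_pt_eq_shift: "graph_pt e \<gamma> y = y + (\<gamma> y - y \<bullet> e) *\<^sub>R e"
  by (simp add: graph_pt_def)

text \<open>The set is invariant under shifts along \<open>e\<close>. Its part in the slab
  \<open>\<bar>x \<bullet> e\<bar> \<le> 1\<close> is bounded, and the Lebesgue measure of that part
  is the hyperplane measure times the thickness 2 of the slab.\<close>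

lemma emeasure_hyperplane_finite:
  fixes e :: "'a::euclidean_space"
  assumes e: "e \<in> Basis" and c: "continuous_on UNIV \<gamma>" and inv: "\<And>y r. \<gamma> (y + r *\<^sub>R e) = \<gamma> y"
  shows "emeasure (hyperplane_measure e) {y. norm (graph_pt e \<gamma> y) \<le> R} < \<infinity>"
proof -
  let ?W = "{y. norm (graph_pt e \<gamma> y) \<le> R}"
  have cg: "continuous_on UNIV (graph_pt e \<gamma>)"
    unfolding graph_pt_def by (intro continuous_intros c)
  have W[measurable]: "?W \<in> sets borel"
    by (intro borel_closed closed_Collect_le continuous_intros continuous_on_compose2[OF cg]) auto
  have V[measurable]: "{x. \<bar>x \<bullet> e\<bar> \<le> 1} \<in> sets borel"
    by (intro borel_closed closed_Collect_le continuous_intros)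
  have gW: "y + r *\<^sub>R e \<in> ?W \<longleftrightarrow> y \<in> ?W" for y r
    using e by (simp add: graph_pt_def inv inner_add_left algebra_simps)
  \<comment> \<open>The point differs from its graph point by at most \<open>1 + R\<close> along
    \<open>e\<close>: 1 from the slab and \<open>R\<close> from
    \<open>\<bar>\<gamma> x\<bar> \<le> R\<close>.\<close>
  have nx: "norm x \<le> 1 + 2 * R" if "norm (graph_pt e \<gamma> x) \<le> R" "\<bar>x \<bullet> e\<bar> \<le> 1" for x
  proof -
    have "\<bar>\<gamma> x\<bar> \<le> R"
      using Basis_le_norm[OF e, of "graph_pt e \<gamma> x"] inner_graph_pt[OF e, of \<gamma> x] that by simp
    moreover have "norm x \<le> norm (graph_pt e \<gamma> x) + norm ((x \<bullet> e - \<gamma> x) *\<^sub>R e)"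
      using norm_triangle_ineq[of "graph_pt e \<gamma> x" "(x \<bullet> e - \<gamma> x) *\<^sub>R e"]
      by (simp add: graph_pt_def algebra_simps)
    ultimately show ?thesis using that e by simp
  qed
  have "2 * emeasure (hyperplane_measure e) ?W = (\<integral>\<^sup>+ y. 2 * indicator ?W y \<partial>hyperplane_measure e)"
    by (subst nn_integral_cmult_indicator) auto
  also have "\<dots> = (\<integral>\<^sup>+ y. (\<integral>\<^sup>+ r. indicator (?W \<inter> {x. \<bar>x \<bullet> e\<bar> \<le> 1}) (y + r *\<^sub>R e) \<partial>lborel) \<partial>hyperplane_measure e)"
  proof (rule nn_integral_cong)
    fix y
    have "(\<integral>\<^sup>+ r. indicator (?W \<inter> {x. \<bar>x \<bullet> e\<bar> \<le> 1}) (y + r *\<^sub>R e) \<partial>lborel) =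
          (\<integral>\<^sup>+ r. indicator ?W y * indicator {- 1 - y \<bullet> e .. 1 - y \<bullet> e} r \<partial>lborel)"
      using e gW by (intro nn_integral_cong) (auto simp: indicator_def inner_add_left)
    also have "\<dots> = 2 * indicator ?W y"
      by (subst nn_integral_cmult_indicator) (auto simp: mult.commute)
    finally show "2 * indicator ?W y = (\<integral>\<^sup>+ r. indicator (?W \<inter> {x. \<bar>x \<bullet> e\<bar> \<le> 1}) (y + r *\<^sub>R e) \<partial>lborel)"
      by simp
  qed
  also have "\<dots> = (\<integral>\<^sup>+ x. indicator (?W \<inter> {x. \<bar>x \<bullet> e\<bar> \<le> 1}) x \<partial>lborel)"
    by (rule nn_integral_lborel_hyperplane[OF e, symmetric]) simp
  also have "\<dots> = emeasure lborel (?W \<inter> {x. \<bar>x \<bullet> e\<bar> \<le> 1})"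
    by (rule nn_integral_indicator) simp
  also have "\<dots> < \<infinity>"
    by (rule emeasure_bounded_finite) (auto simp: bounded_iff intro!: exI[of _ "1 + 2 * R"] nx)
  finally show ?thesis
    by (auto simp: ennreal_mult_less_top)
qed

text \<open>The density in \<open>surface_measure\<close>. In a chart it is also the length of the
  gradient of \<open>s * (x \<bullet> e - \<gamma> x)\<close>, as \<open>\<gamma>\<close> does not
  vary along \<open>e\<close>; this coincidence turns thin layers of volume into surface
  area.\<close>

definition area_element :: "('a::euclidean_space \<Rightarrow> real) \<Rightarrow> 'a \<Rightarrow> real" where
  "area_element \<gamma> y = sqrt (1 + (\<Sum>b\<in>Basis. (pd b \<gamma> y)\<^sup>2))"

lemma area_element_nonneg: "0 \<le> area_element \<gamma> y"
  by (simp add: area_element_def add_nonneg_nonneg sum_nonneg)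

lemma area_element_shift:
  assumes "\<And>y r. \<gamma> (y + r *\<^sub>R e) = \<gamma> y"
  shows "area_element \<gamma> (y + r *\<^sub>R e) = area_element \<gamma> y"
  by (simp add: area_element_def pd_graph_invariant[OF assms])

lemma continuous_on_area_element:
  assumes "Ck_on 1 UNIV \<gamma>"
  shows "continuous_on UNIV (area_element \<gamma>)"
  unfolding area_element_def by (intro continuous_intros Ck_on_1_UNIV(2)[OF assms])

text \<open>\<open>surface_measure\<close> speaks of sets. Read as an equality of measures, it says
  that \<open>\<sigma>\<close> restricted to the chart is the image under
  \<open>graph_pt e \<gamma>\<close> of a weighted hyperplane measure; integrals of functions follow
  by transport.\<close>

lemma nn_integral_surface_measure:
  fixes D :: "'a::euclidean_space set"
  assumes \<sigma>: "surface_measure D \<sigma>" and c: "boundary_chart 1 D (e, s, \<gamma>, U)"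
    and H[measurable]: "H \<in> borel_measurable borel"
  shows "(\<integral>\<^sup>+ x. indicator (frontier D \<inter> U) x * H x \<partial>\<sigma>) =
    (\<integral>\<^sup>+ y. indicator (frontier D \<inter> U) (graph_pt e \<gamma> y) * ennreal (area_element \<gamma> y) * H (graph_pt e \<gamma> y)
      \<partial>hyperplane_measure e)"
proof -
  let ?F = "frontier D \<inter> U"
  have sets\<sigma>[measurable_cong, simp]: "sets \<sigma> = sets borel"
    using \<sigma> by (simp add: surface_measure_def)
  have g: "Ck_on 1 UNIV \<gamma>" "open U" using c by auto
  have F[measurable]: "?F \<in> sets borel"
    using g(2) by (intro sets.Int borel_closed borel_open) auto
  have [measurable]: "graph_pt e \<gamma> \<in> borel_measurable borel"
    unfolding graph_pt_def
    by (intro borel_measurable_continuous_onI continuous_intros Ck_on_1_UNIV(1)[OF g(1)])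
  have [measurable]: "area_element \<gamma> \<in> borel_measurable borel"
    by (rule borel_measurable_continuous_onI[OF continuous_on_area_element[OF g(1)]])
  define w where "w y = indicator ?F (graph_pt e \<gamma> y) * ennreal (area_element \<gamma> y)" for y
  have w[measurable]: "w \<in> borel_measurable borel"
    unfolding w_def by measurable
  have eq: "density \<sigma> (indicator ?F) = distr (density (hyperplane_measure e) w) borel (graph_pt e \<gamma>)"
  proof (rule measure_eqI)
    fix A assume "A \<in> sets (density \<sigma> (indicator ?F))"
    then have A[measurable]: "A \<in> sets borel" by simp
    have "emeasure (density \<sigma> (indicator ?F)) A = (\<integral>\<^sup>+ x. indicator (?F \<inter> A) x \<partial>\<sigma>)"
      by (subst emeasure_density, simp, simp, rule nn_integral_cong) (simp add: indicator_def)
    also have "\<dots> = emeasure \<sigma> (?F \<inter> A)"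
      by (rule nn_integral_indicator) simp
    also have "\<dots> = (\<integral>\<^sup>+ y. indicator (?F \<inter> A) (graph_pt e \<gamma> y) * ennreal (area_element \<gamma> y) \<partial>hyperplane_measure e)"
      using \<sigma>[unfolded surface_measure_def] c sets.Int[OF F A]
      unfolding area_element_def by blast
    also have "\<dots> = (\<integral>\<^sup>+ y. w y * indicator (graph_pt e \<gamma> -` A) y \<partial>hyperplane_measure e)"
      by (intro nn_integral_cong) (auto simp: w_def indicator_def)
    also have "\<dots> = emeasure (density (hyperplane_measure e) w) (graph_pt e \<gamma> -` A)"
    proof (subst emeasure_density)
      show "graph_pt e \<gamma> -` A \<in> sets (hyperplane_measure e)"
        using measurable_sets[of "graph_pt e \<gamma>" borel borel A] by simp
    qed auto
    also have "\<dots> = emeasure (distr (density (hyperplane_measure e) w) borel (graph_pt e \<gamma>)) A"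
      by (subst emeasure_distr) (auto simp: hyperplane_measure_def)
    finally show "emeasure (density \<sigma> (indicator ?F)) A =
      emeasure (distr (density (hyperplane_measure e) w) borel (graph_pt e \<gamma>)) A" .
  qed simp
  have "(\<integral>\<^sup>+ x. indicator ?F x * H x \<partial>\<sigma>) = (\<integral>\<^sup>+ x. H x \<partial>density \<sigma> (indicator ?F))"
    by (subst nn_integral_density) auto
  also have "\<dots> = (\<integral>\<^sup>+ y. H (graph_pt e \<gamma> y) \<partial>density (hyperplane_measure e) w)"
    unfolding eq by (rule nn_integral_distr) auto
  also have "\<dots> = (\<integral>\<^sup>+ y. w y * H (graph_pt e \<gamma> y) \<partial>hyperplane_measure e)"
    by (subst nn_integral_density) auto
  finally show ?thesis by (simp add: w_def)
qed

lemma boundary_chart_le: "boundary_chart k D c \<Longrightarrow> m \<le> k \<Longrightarrow> boundary_chart m D c"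
  by (cases c) (auto intro: Ck_on_le)

lemma Ck_boundary_le: "Ck_boundary k D \<Longrightarrow> m \<le> k \<Longrightarrow> Ck_boundary m D"
  unfolding Ck_boundary_def using boundary_chart_le by metis

lemma emeasure_surface_chart_finite:
  fixes D :: "'a::euclidean_space set"
  assumes \<sigma>: "surface_measure D \<sigma>" and c: "boundary_chart 1 D (e, s, \<gamma>, U)"
    and K: "compact K" "K \<subseteq> U"
  shows "emeasure \<sigma> (frontier D \<inter> K) < \<infinity>"
proof -
  have sets\<sigma>[measurable_cong, simp]: "sets \<sigma> = sets borel"
    using \<sigma> by (simp add: surface_measure_def)
  have g: "Ck_on 1 UNIV \<gamma>" "e \<in> Basis" "\<And>y r. \<gamma> (y + r *\<^sub>R e) = \<gamma> y" using c by auto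
  have [measurable]: "K \<in> sets borel" "frontier D \<in> sets borel"
    using K by (auto intro: borel_closed compact_imp_closed)
  obtain R where R: "\<And>x. x \<in> K \<Longrightarrow> norm x \<le> R"
    using compact_imp_bounded[OF K(1)] by (auto simp: bounded_iff)
  obtain B where B: "\<And>x. norm x \<le> R \<Longrightarrow> area_element \<gamma> x \<le> B"
  proof -
    have "bounded (area_element \<gamma> ` cball 0 R)"
      using continuous_on_area_element[OF g(1)] continuous_on_subset compact_continuous_image compact_imp_bounded
      by (metis compact_cball subset_UNIV)
    then obtain B where "\<forall>x\<in>cball 0 R. \<bar>area_element \<gamma> x\<bar> \<le> B"
      unfolding bounded_iff by auto
    then have "\<And>x. norm x \<le> R \<Longrightarrow> area_element \<gamma> x \<le> B"
      using abs_ge_self order_trans by (metis mem_cball_0)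
    then show ?thesis by (rule that)
  qed
  let ?W = "{y. norm (graph_pt e \<gamma> y) \<le> R}"
  have cg: "continuous_on UNIV (graph_pt e \<gamma>)"
    unfolding graph_pt_def by (intro continuous_intros Ck_on_1_UNIV(1)[OF g(1)])
  have W[measurable]: "?W \<in> sets borel"
    by (intro borel_closed closed_Collect_le continuous_intros continuous_on_compose2[OF cg]) auto
  \<comment> \<open>\<open>y\<close> itself may be arbitrarily far out along \<open>e\<close>, but
    the area element takes the same value at its graph point, which lies in the ball of radius
    \<open>R\<close>.\<close>
  have AB: "area_element \<gamma> y \<le> B" if "norm (graph_pt e \<gamma> y) \<le> R" for y
    using B[OF that] by (simp add: graph_pt_eq_shift area_element_shift[OF g(3)])
  have "emeasure \<sigma> (frontier D \<inter> K) = (\<integral>\<^sup>+ x. indicator (frontier D \<inter> U) x * indicator K x \<partial>\<sigma>)"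
  proof (subst nn_integral_indicator[symmetric])
    show "frontier D \<inter> K \<in> sets \<sigma>" by simp
    show "(\<integral>\<^sup>+ x. indicator (frontier D \<inter> K) x \<partial>\<sigma>) = (\<integral>\<^sup>+ x. indicator (frontier D \<inter> U) x * indicator K x \<partial>\<sigma>)"
      by (rule nn_integral_cong) (use K(2) in \<open>auto simp: indicator_def\<close>)
  qed
  also have "\<dots> = (\<integral>\<^sup>+ y. indicator (frontier D \<inter> U) (graph_pt e \<gamma> y) * ennreal (area_element \<gamma> y) * indicator K (graph_pt e \<gamma> y)
      \<partial>hyperplane_measure e)"
    by (rule nn_integral_surface_measure[OF \<sigma> c]) simp
  also have "\<dots> \<le> (\<integral>\<^sup>+ y. ennreal B * indicator ?W y \<partial>hyperplane_measure e)"
    using AB R by (intro nn_integral_mono) (auto simp: indicator_def intro!: ennreal_leI)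
  also have "\<dots> = ennreal B * emeasure (hyperplane_measure e) ?W"
    by (rule nn_integral_cmult_indicator) simp
  also have "\<dots> < \<infinity>"
    using emeasure_hyperplane_finite[OF g(2) Ck_on_1_UNIV(1)[OF g(1)] g(3), of R]
    by (simp add: ennreal_mult_less_top)
  finally show ?thesis .
qed

text \<open>\<open>surface_measure\<close> does not postulate finiteness. It holds near each
  boundary point, by a chart, and finitely many such balls cover the compact boundary.\<close>

lemma emeasure_frontier_finite:
  fixes D :: "'a::euclidean_space set"
  assumes \<sigma>: "surface_measure D \<sigma>" and D: "bounded D" "Ck_boundary 1 D"
  shows "emeasure \<sigma> (frontier D) < \<infinity>"
proof -
  have sets\<sigma>: "sets \<sigma> = sets borel"
    using \<sigma> by (simp add: surface_measure_def)
  have "\<exists>r>0. emeasure \<sigma> (frontier D \<inter> cball x r) < \<infinity>" if x: "x \<in> frontier D" for x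
  proof -
    obtain e s \<gamma> U where c: "boundary_chart 1 D (e, s, \<gamma>, U)" "x \<in> U"
      using D(2) x unfolding Ck_boundary_def by (metis chart_dom.simps chart_dom.cases)
    then have "open U" by auto
    then obtain r where "r > 0" "cball x r \<subseteq> U"
      using c(2) open_contains_cball by blast
    then show ?thesis
      using emeasure_surface_chart_finite[OF \<sigma> c(1) compact_cball] by blast
  qed
  then obtain r where r: "\<And>x. x \<in> frontier D \<Longrightarrow> r x > 0 \<and> emeasure \<sigma> (frontier D \<inter> cball x (r x)) < \<infinity>"
    by metis
  have "compact (frontier D)" using D(1) by (rule compact_frontier_bounded)
  then obtain C where C: "C \<subseteq> frontier D" "finite C" "frontier D \<subseteq> (\<Union>x\<in>C. ball x (r x))"
    by (rule compactE_image[of _ "frontier D" "\<lambda>x. ball x (r x)"]) (use r in \<open>auto intro!: bexI\<close>)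
  have "emeasure \<sigma> (frontier D) \<le> emeasure \<sigma> (\<Union>x\<in>C. frontier D \<inter> cball x (r x))"
  proof (rule emeasure_mono)
    show "frontier D \<subseteq> (\<Union>x\<in>C. frontier D \<inter> cball x (r x))"
    proof
      fix y assume y: "y \<in> frontier D"
      then obtain x where "x \<in> C" "y \<in> ball x (r x)" using C(3) by blast
      then show "y \<in> (\<Union>x\<in>C. frontier D \<inter> cball x (r x))"
        using y by (intro UN_I[of x]) auto
    qed
    show "(\<Union>x\<in>C. frontier D \<inter> cball x (r x)) \<in> sets \<sigma>"
      unfolding sets\<sigma> by (intro sets.finite_UN C(2) borel_closed closed_Int) auto
  qed
  also have "\<dots> \<le> (\<Sum>x\<in>C. emeasure \<sigma> (frontier D \<inter> cball x (r x)))"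
    unfolding sets\<sigma> by (intro emeasure_subadditive_finite C(2)) (auto simp: sets\<sigma> intro!: borel_closed closed_Int)
  also have "\<dots> < \<infinity>"
    using r C(1) by (subst infinity_ennreal_def, subst ennreal_sum_less_top) (auto simp: C(2))
  finally show ?thesis .
qed

section \<open>Smooth cutoffs\<close>

text \<open>The square of the positive part is of class C^1. All cutoffs are built from it, as they
  are differentiated only once.\<close>

definition sqpos :: "real \<Rightarrow> real" where
  "sqpos t = (max 0 t)\<^sup>2"

lemma sqpos_nonneg: "0 \<le> sqpos t"
  and sqpos_eq_0: "t \<le> 0 \<Longrightarrow> sqpos t = 0"
  and sqpos_pos: "0 < t \<Longrightarrow> 0 < sqpos t"
  by (auto simp: sqpos_def)

lemma DERIV_sqpos: "(sqpos has_real_derivative 2 * max 0 t) (at t)"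
proof -
  consider "t > 0" | "t < 0" | "t = 0" by linarith
  then show ?thesis
  proof cases
    case 1
    have "((\<lambda>t. t\<^sup>2) has_real_derivative 2 * t) (at t)"
      by (auto intro!: derivative_eq_intros)
    then have "(sqpos has_real_derivative 2 * t) (at t)"
      by (rule has_field_derivative_transform_within_open[of _ _ _ "{0<..}"]) (use 1 in \<open>auto simp: sqpos_def\<close>)
    then show ?thesis using 1 by simp
  next
    case 2
    have "((\<lambda>t. 0) has_real_derivative 0) (at t)"
      by simp
    then have "(sqpos has_real_derivative 0) (at t)"
      by (rule has_field_derivative_transform_within_open[of _ _ _ "{..<0}"]) (use 2 in \<open>auto simp: sqpos_def\<close>)
    then show ?thesis using 2 by simp
  next
    case 3
    have "((\<lambda>h. max 0 h) \<longlongrightarrow> max 0 (0::real)) (at 0)"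
      by (intro tendsto_intros)
    moreover have "\<forall>\<^sub>F h in at 0. max 0 h = (sqpos (0 + h) - sqpos 0) / h"
      by (auto simp: sqpos_def eventually_at_filter max_def power2_eq_square)
    ultimately have "((\<lambda>h. (sqpos (0 + h) - sqpos 0) / h) \<longlongrightarrow> 0) (at 0)"
      using Lim_transform_eventually by fastforce
    then show ?thesis using 3 by (simp add: DERIV_def)
  qed
qed

lemma continuous_on_sqpos [continuous_intros]:
  "continuous_on S f \<Longrightarrow> continuous_on S (\<lambda>x. sqpos (f x))"
  unfolding sqpos_def by (intro continuous_intros)

text \<open>On \<open>{0..1}\<close> this is the polynomial (1 - (1 - t)^2)^2; the inner truncation
  makes it constant for \<open>t \<ge> 1\<close>, the outer one for
  \<open>t \<le> 0\<close>.\<close>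

definition smoothstep :: "real \<Rightarrow> real" where
  "smoothstep t = sqpos (1 - sqpos (1 - t))"

definition smoothstep' :: "real \<Rightarrow> real" where
  "smoothstep' t = 2 * max 0 (1 - sqpos (1 - t)) * (2 * max 0 (1 - t))"

lemma DERIV_smoothstep: "(smoothstep has_real_derivative smoothstep' t) (at t)"
proof -
  have "((\<lambda>t. 1 - t) has_real_derivative -1) (at t)"
    by (auto intro!: derivative_eq_intros)
  from DERIV_diff[OF DERIV_const DERIV_chain2[OF DERIV_sqpos this], of 1]
  have "((\<lambda>t. 1 - sqpos (1 - t)) has_real_derivative 2 * max 0 (1 - t)) (at t)"
    by simp
  from DERIV_chain2[OF DERIV_sqpos this] show ?thesis
    by (simp add: smoothstep_def[abs_def] smoothstep'_def)
qed

lemma continuous_on_smoothstep [continuous_intros]: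
  "continuous_on S f \<Longrightarrow> continuous_on S (\<lambda>x. smoothstep (f x))"
  "continuous_on S f \<Longrightarrow> continuous_on S (\<lambda>x. smoothstep' (f x))"
  unfolding smoothstep_def smoothstep'_def by (intro continuous_intros; assumption)+

lemma smoothstep_eq_0: "t \<le> 0 \<Longrightarrow> smoothstep t = 0"
  and smoothstep_eq_1: "1 \<le> t \<Longrightarrow> smoothstep t = 1"
  and smoothstep_range: "0 \<le> smoothstep t" "smoothstep t \<le> 1"
  and smoothstep'_nonneg: "0 \<le> smoothstep' t"
  and smoothstep'_eq_0: "t \<notin> {0..1} \<Longrightarrow> smoothstep' t = 0"
proof -
  have le: "1 \<le> sqpos (1 - t)" if "t \<le> 0" for t
    using that by (auto simp: sqpos_def max_def intro!: one_le_power)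
  show "t \<le> 0 \<Longrightarrow> smoothstep t = 0"
    using le[of t] by (simp add: smoothstep_def sqpos_eq_0)
  show "1 \<le> t \<Longrightarrow> smoothstep t = 1"
    by (simp add: smoothstep_def sqpos_eq_0) (simp add: sqpos_def)
  show "0 \<le> smoothstep t" by (simp add: smoothstep_def sqpos_nonneg)
  show "smoothstep t \<le> 1"
    using sqpos_nonneg[of "1 - t"] by (auto simp: smoothstep_def sqpos_def[of "1 - sqpos (1 - t)"] max_def intro!: power_le_one)
  show "0 \<le> smoothstep' t" by (simp add: smoothstep'_def)
  show "t \<notin> {0..1} \<Longrightarrow> smoothstep' t = 0"
    using le[of t] by (auto simp: smoothstep'_def)
qed

lemma nn_integral_smoothstep': "(\<integral>\<^sup>+ t. ennreal (smoothstep' t) \<partial>lborel) = 1"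
proof -
  have "(\<integral>\<^sup>+ t. ennreal (smoothstep' t) \<partial>lborel) = (\<integral>\<^sup>+ t. ennreal (smoothstep' t) * indicator {0..1} t \<partial>lborel)"
    by (rule nn_integral_cong) (use smoothstep'_eq_0 in \<open>auto simp: indicator_def\<close>)
  also have "\<dots> = ennreal (smoothstep 1 - smoothstep 0)"
    by (rule nn_integral_FTC_Icc)
       (auto intro!: borel_measurable_continuous_onI continuous_intros DERIV_smoothstep smoothstep'_nonneg)
  finally show ?thesis by (simp add: smoothstep_eq_0 smoothstep_eq_1)
qed

text \<open>\<open>cutoff n\<close> rises from 0 at \<open>1 / Suc n\<close> to 1 at \<open>2 / Suc n\<close>.\<close>

definition cutoff :: "nat \<Rightarrow> real \<Rightarrow> real" where
  "cutoff n t = smoothstep (real (Suc n) * t - 1)"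

definition cutoff' :: "nat \<Rightarrow> real \<Rightarrow> real" where
  "cutoff' n t = real (Suc n) * smoothstep' (real (Suc n) * t - 1)"

lemma DERIV_cutoff: "(cutoff n has_real_derivative cutoff' n t) (at t)"
proof -
  have "((\<lambda>t. real (Suc n) * t - 1) has_real_derivative real (Suc n)) (at t)"
    by (auto intro!: derivative_eq_intros)
  from DERIV_chain2[OF DERIV_smoothstep this] show ?thesis
    by (simp add: cutoff_def[abs_def] cutoff'_def mult.commute)
qed

lemma continuous_on_cutoff [continuous_intros]:
  "continuous_on S f \<Longrightarrow> continuous_on S (\<lambda>x. cutoff n (f x))"
  "continuous_on S f \<Longrightarrow> continuous_on S (\<lambda>x. cutoff' n (f x))"
  unfolding cutoff_def cutoff'_def by (intro continuous_intros; assumption)+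

text \<open>The cutoff vanishes on a neighbourhood of the half-line \<open>t \<le> 0\<close>. A
  field multiplied by it therefore vanishes near the boundary and extends by zero.\<close>

lemma cutoff_eq_0: "t < 1 / real (Suc n) \<Longrightarrow> cutoff n t = 0"
  by (auto simp: cutoff_def field_simps intro!: smoothstep_eq_0)

lemma cutoff'_eq_0: "t \<notin> {0..2 / real (Suc n)} \<Longrightarrow> cutoff' n t = 0"
proof -
  assume "t \<notin> {0..2 / real (Suc n)}"
  then have "real (Suc n) * t < 0 \<or> 2 < real (Suc n) * t"
    by (auto simp: not_le pos_divide_less_eq mult.commute mult_less_0_iff simp del: of_nat_Suc)
  then have "real (Suc n) * t - 1 \<notin> {0..1}" by auto
  then show ?thesis by (simp add: cutoff'_def smoothstep'_eq_0 del: of_nat_Suc)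
qed

lemma cutoff_range: "0 \<le> cutoff n t" "cutoff n t \<le> 1" and cutoff'_nonneg: "0 \<le> cutoff' n t"
  by (simp_all add: cutoff_def cutoff'_def smoothstep_range smoothstep'_nonneg)

lemma cutoff_LIMSEQ: "0 < t \<Longrightarrow> (\<lambda>n. cutoff n t) \<longlonglongrightarrow> 1"
proof (rule tendsto_eventually)
  assume t: "0 < t"
  obtain N where N: "2 / t \<le> real N" using real_arch_simple by blast
  show "\<forall>\<^sub>F n in sequentially. cutoff n t = 1"
    using eventually_ge_at_top[of N]
  proof eventually_elim
    case (elim n)
    then have "2 / t \<le> real (Suc n)" using N by simp
    then have "1 \<le> real (Suc n) * t - 1" using t by (simp add: field_simps)
    then show ?case by (simp add: cutoff_def smoothstep_eq_1 del: of_nat_Suc)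
  qed
qed

text \<open>Unit mass together with support in \<open>{0..2 / real (Suc n)}\<close> makes
  \<open>cutoff' n\<close> an approximate Dirac mass at 0.\<close>

lemma nn_integral_cutoff': "(\<integral>\<^sup>+ t. ennreal (cutoff' n t) \<partial>lborel) = 1"
proof -
  have [measurable]: "smoothstep' \<in> borel_measurable borel"
    by (intro borel_measurable_continuous_onI continuous_intros continuous_on_id)
  have "1 = (\<integral>\<^sup>+ t. ennreal (smoothstep' t) \<partial>lborel)" by (simp add: nn_integral_smoothstep')
  also have "\<dots> = ennreal \<bar>real (Suc n)\<bar> * (\<integral>\<^sup>+ t. ennreal (smoothstep' (- 1 + real (Suc n) * t)) \<partial>lborel)"
    by (rule nn_integral_real_affine) auto
  also have "\<dots> = (\<integral>\<^sup>+ t. ennreal (cutoff' n t) \<partial>lborel)"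
    by (subst nn_integral_cmult[symmetric])
       (auto simp: cutoff'_def ennreal_mult' smoothstep'_nonneg simp del: of_nat_Suc)
  finally show ?thesis by simp
qed

section \<open>Integration by parts for fields vanishing near the boundary\<close>

lemma compact_bound:
  fixes f :: "'a::euclidean_space \<Rightarrow> 'b::real_normed_vector"
  assumes "compact K" "continuous_on K f"
  obtains B where "0 \<le> B" "\<And>x. x \<in> K \<Longrightarrow> norm (f x) \<le> B"
proof -
  have "bounded (f ` K)"
    using assms compact_continuous_image compact_imp_bounded by blast
  then obtain B where "\<And>x. x \<in> K \<Longrightarrow> norm (f x) \<le> B"
    by (auto simp: bounded_iff)
  then show ?thesis by (intro that[of "max 0 B"]) (auto simp: le_max_iff_disj)
qed

lemma set_integrable_lborel_continuous:
  fixes f :: "'a::euclidean_space \<Rightarrow> real"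
  assumes "open D" "bounded D" "continuous_on (closure D) f"
  shows "set_integrable lborel D f"
proof (rule set_integrable_continuous_compact[OF _ assms(3)])
  show "compact (closure D)" using assms(2) by simp
qed (use assms closure_subset in \<open>auto intro: emeasure_bounded_finite[unfolded infinity_ennreal_def]\<close>)

text \<open>The product of \<open>\<zeta>\<close> and \<open>Y\<close>, extended by zero, is
  differentiable on the whole space thanks to \<open>near\<close>. The derivative of each component
  along its own direction then has integral zero, and the product rule gives the formula.\<close>

lemma integral_divergence_cutoff:
  fixes Y :: "'a::euclidean_space \<Rightarrow> 'a" and Dv :: "'a \<Rightarrow> 'a \<Rightarrow> real"
  assumes D: "open D" "bounded D"
    and Y: "continuous_on (closure D) Y"
    and der: "\<And>x b. x \<in> D \<Longrightarrow> b \<in> Basis \<Longrightarrow> ((\<lambda>h. Y (x + h *\<^sub>R b) \<bullet> b) has_real_derivative Dv b x) (at 0)"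
    and Dv: "\<And>b. b \<in> Basis \<Longrightarrow> continuous_on (closure D) (Dv b)"
    and \<zeta>: "continuous_on (closure D) \<zeta>"
    and der\<zeta>: "\<And>x b. x \<in> D \<Longrightarrow> b \<in> Basis \<Longrightarrow> ((\<lambda>h. \<zeta> (x + h *\<^sub>R b)) has_real_derivative \<zeta>' b x) (at 0)"
    and \<zeta>': "\<And>b. b \<in> Basis \<Longrightarrow> continuous_on (closure D) (\<zeta>' b)"
    and near: "\<And>x. x \<notin> D \<Longrightarrow> \<exists>\<epsilon>>0. \<forall>y\<in>D. dist x y < \<epsilon> \<longrightarrow> \<zeta> y *\<^sub>R Y y = 0"
  shows "(LBINT x:D. \<zeta> x * (\<Sum>b\<in>Basis. Dv b x)) = - (LBINT x:D. (\<Sum>b\<in>Basis. \<zeta>' b x * (Y x \<bullet> b)))"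
proof -
  have cpt: "compact (closure D)" using D(2) by simp
  have DK: "x \<in> closure D" if "x \<in> D" for x using that closure_subset by blast
  have b0: "(LBINT x:D. \<zeta>' b x * (Y x \<bullet> b) + \<zeta> x * Dv b x) = 0" if b: "b \<in> Basis" for b
  proof -
    define Z where "Z x = (if x \<in> D then \<zeta> x * (Y x \<bullet> b) else 0)" for x
    define Z' where "Z' x = (if x \<in> D then \<zeta>' b x * (Y x \<bullet> b) + \<zeta> x * Dv b x else 0)" for x
    have cZ: "continuous_on (closure D) (\<lambda>x. \<zeta> x * (Y x \<bullet> b))"
      by (intro continuous_intros Y \<zeta>)
    have cZ': "continuous_on (closure D) (\<lambda>x. \<zeta>' b x * (Y x \<bullet> b) + \<zeta> x * Dv b x)"
      by (intro continuous_intros Y \<zeta> \<zeta>' Dv b)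
    obtain C where C: "0 \<le> C" "\<And>x. x \<in> closure D \<Longrightarrow> norm (\<zeta> x * (Y x \<bullet> b)) \<le> C"
      using compact_bound[OF cpt cZ] by blast
    obtain B where B: "0 \<le> B" "\<And>x. x \<in> closure D \<Longrightarrow> norm (\<zeta>' b x * (Y x \<bullet> b) + \<zeta> x * Dv b x) \<le> B"
      using compact_bound[OF cpt cZ'] by blast
    obtain R where R: "\<And>x. x \<in> D \<Longrightarrow> norm x \<le> R"
      using D(2) by (auto simp: bounded_iff)
    have "(LINT x|lborel. Z' x) = 0"
    proof (rule integral_directional_derivative_eq_0(2)[where Z = Z and C = C and B = B and R = R and b = b])
      show "Z \<in> borel_measurable borel"
        unfolding Z_def
        by (rule borel_measurable_continuous_on_if)
           (use D(1) cZ closure_subset in \<open>auto intro: continuous_on_subset\<close>)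
      show "\<bar>Z x\<bar> \<le> C" for x using C DK[of x] by (auto simp: Z_def)
      show "\<bar>Z' x\<bar> \<le> B" for x using B DK[of x] by (auto simp: Z'_def)
      show "Z x = 0" if "R < norm x" for x using R[of x] that by (auto simp: Z_def)
      show "((\<lambda>h. Z (x + h *\<^sub>R b)) has_real_derivative Z' x) (at 0)" for x
      proof (cases "x \<in> D")
        case True
        have "((\<lambda>h. \<zeta> (x + h *\<^sub>R b) * (Y (x + h *\<^sub>R b) \<bullet> b)) has_real_derivative
            \<zeta>' b x * (Y (x + 0 *\<^sub>R b) \<bullet> b) + Dv b x * \<zeta> (x + 0 *\<^sub>R b)) (at 0)"
          by (rule DERIV_mult[OF der\<zeta>[OF True b] der[OF True b]])
        moreover have "\<forall>\<^sub>F h in nhds 0. \<zeta> (x + h *\<^sub>R b) * (Y (x + h *\<^sub>R b) \<bullet> b) = Z (x + h *\<^sub>R b)"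
          using eventually_line_in_open[OF D(1) True, of b] by (rule eventually_mono) (simp add: Z_def)
        ultimately show ?thesis
          using DERIV_cong_ev[of 0 0 "\<lambda>h. \<zeta> (x + h *\<^sub>R b) * (Y (x + h *\<^sub>R b) \<bullet> b)" "\<lambda>h. Z (x + h *\<^sub>R b)"
              "Z' x"] True
          by (simp add: Z'_def mult.commute)
      next
        case False
        then obtain \<epsilon> where e: "\<epsilon> > 0" "\<And>y. y \<in> D \<Longrightarrow> dist x y < \<epsilon> \<Longrightarrow> \<zeta> y *\<^sub>R Y y = 0"
          using near by blast
        have "\<forall>\<^sub>F h in nhds 0. x + h *\<^sub>R b \<in> ball x \<epsilon>"
          using eventually_line_in_open[OF open_ball, of x x \<epsilon> b] e(1) by simp
        then have "\<forall>\<^sub>F h in nhds 0. 0 = Z (x + h *\<^sub>R b)"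
        proof (rule eventually_mono)
          fix h assume "x + h *\<^sub>R b \<in> ball x \<epsilon>"
          then have "\<zeta> (x + h *\<^sub>R b) *\<^sub>R Y (x + h *\<^sub>R b) \<bullet> b = 0" if "x + h *\<^sub>R b \<in> D"
            using e(2)[OF that] by auto
          then show "0 = Z (x + h *\<^sub>R b)" by (simp add: Z_def)
        qed
        then show ?thesis
          using DERIV_cong_ev[of 0 0 "\<lambda>h. 0" "\<lambda>h. Z (x + h *\<^sub>R b)" 0] False
          by (simp add: Z'_def)
      qed
    qed
    moreover have "(LINT x|lborel. Z' x) = (LBINT x:D. \<zeta>' b x * (Y x \<bullet> b) + \<zeta> x * Dv b x)"
      unfolding set_lebesgue_integral_def by (rule Bochner_Integration.integral_cong) (auto simp: Z'_def)
    ultimately show ?thesis by simp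
  qed
  have i1: "set_integrable lborel D (\<lambda>x. \<zeta> x * (\<Sum>b\<in>Basis. Dv b x))"
    by (intro set_integrable_lborel_continuous D continuous_intros \<zeta> Dv)
  have i2: "set_integrable lborel D (\<lambda>x. \<Sum>b\<in>Basis. \<zeta>' b x * (Y x \<bullet> b))"
    by (intro set_integrable_lborel_continuous D continuous_intros \<zeta>' Y)
  have ib: "set_integrable lborel D (\<lambda>x. \<zeta>' b x * (Y x \<bullet> b) + \<zeta> x * Dv b x)" if "b \<in> Basis" for b
    by (intro set_integrable_lborel_continuous D continuous_intros \<zeta>' Y \<zeta> Dv that)
  have "0 = (\<Sum>b\<in>Basis. (LBINT x:D. \<zeta>' b x * (Y x \<bullet> b) + \<zeta> x * Dv b x))"
    using b0 by simp
  also have "\<dots> = (LBINT x:D. (\<Sum>b\<in>Basis. \<zeta>' b x * (Y x \<bullet> b) + \<zeta> x * Dv b x))"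
    using ib unfolding set_lebesgue_integral_def set_integrable_def
    by (subst Bochner_Integration.integral_sum[symmetric]) (auto simp: sum_distrib_left)
  also have "\<dots> = (LBINT x:D. (\<Sum>b\<in>Basis. \<zeta>' b x * (Y x \<bullet> b)) + \<zeta> x * (\<Sum>b\<in>Basis. Dv b x))"
    by (simp add: sum.distrib sum_distrib_left)
  also have "\<dots> = (LBINT x:D. (\<Sum>b\<in>Basis. \<zeta>' b x * (Y x \<bullet> b))) + (LBINT x:D. \<zeta> x * (\<Sum>b\<in>Basis. Dv b x))"
    by (rule set_integral_add(2)[OF i2 i1])
  finally show ?thesis by simp
qed

section \<open>The divergence inequality in a boundary chart\<close>

text \<open>On the graph the defining inequality of \<open>D\<close> becomes an equality, so the
  point is not in \<open>D\<close>; moving by a small \<open>t\<close> along \<open>e\<close> with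
  sign \<open>s\<close> makes the inequality strict and enters \<open>D\<close>.\<close>

lemma frontier_graph_pt:
  fixes D :: "'a::euclidean_space set"
  assumes c: "boundary_chart k D (e, s, \<gamma>, U)" and y: "graph_pt e \<gamma> y \<in> U"
  shows "graph_pt e \<gamma> y \<in> frontier D"
proof -
  let ?p = "graph_pt e \<gamma> y"
  have e: "e \<in> Basis" and s: "s * s = 1" and U: "open U" and inv: "\<And>y r. \<gamma> (y + r *\<^sub>R e) = \<gamma> y"
    and DU: "D \<inter> U = {x \<in> U. s * (x \<bullet> e) > s * \<gamma> x}"
    using c by auto
  have g: "\<gamma> (?p + r *\<^sub>R e) = \<gamma> y" for r
    by (simp add: graph_pt_def inv)
  have "?p \<notin> D"
  proof
    assume "?p \<in> D"
    then have "s * (?p \<bullet> e) > s * \<gamma> ?p" using DU y by blast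
    then show False using g[of 0] inner_graph_pt[OF e, of \<gamma> y] by simp
  qed
  have "?p \<in> closure D"
    unfolding closure_approachable
  proof (intro allI impI)
    fix \<epsilon> :: real assume "\<epsilon> > 0"
    obtain r where r: "r > 0" "ball ?p r \<subseteq> U"
      using U y openE by blast
    define t where "t = min (\<epsilon>/2) (r/2)"
    have t: "t > 0" "t < \<epsilon>" "t < r" using r \<open>\<epsilon> > 0\<close> by (auto simp: t_def)
    let ?q = "?p + (s * t) *\<^sub>R e"
    have "\<bar>s\<bar> = 1" using c by auto
    then have d: "dist ?q ?p = t" using e t by (simp add: dist_norm abs_mult)
    then have "?q \<in> U" using r t by (auto simp: dist_commute)
    moreover have "s * (?q \<bullet> e) > s * \<gamma> ?q"
      using e t s by (simp add: inner_add_left inner_graph_pt g algebra_simps) (simp add: mult.assoc[symmetric])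
    ultimately have "?q \<in> D" using DU by blast
    moreover have "dist ?q ?p < \<epsilon>" using d t by simp
    ultimately show "\<exists>q\<in>D. dist q ?p < \<epsilon>" by blast
  qed
  with \<open>?p \<notin> D\<close> show ?thesis
    by (metis DiffI frontier_def interior_subset subsetD)
qed

text \<open>Convergence is asked of the product: cutoffs in the signed distance tend to 1 only
  inside the chart, where the sign of the distance characterises \<open>D\<close>, and elsewhere the
  integrand \<open>g\<close> will vanish.\<close>

lemma set_integral_dominated_LIMSEQ:
  fixes D :: "'a::euclidean_space set" and g :: "'a \<Rightarrow> real"
  assumes D: "open D" "bounded D" and g: "continuous_on (closure D) g"
    and \<zeta>: "\<And>n. continuous_on (closure D) (\<zeta> n)" "\<And>n x. \<bar>\<zeta> n x\<bar> \<le> 1"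
    and lim: "\<And>x. x \<in> D \<Longrightarrow> (\<lambda>n. \<zeta> n x * g x) \<longlonglongrightarrow> g x"
  shows "(\<lambda>n. LBINT x:D. \<zeta> n x * g x) \<longlonglongrightarrow> (LBINT x:D. g x)"
  unfolding set_lebesgue_integral_def
proof (rule integral_dominated_convergence[where w = "\<lambda>x. \<bar>indicator D x *\<^sub>R g x\<bar>"])
  have i: "set_integrable lborel D g" "set_integrable lborel D (\<lambda>x. \<zeta> n x * g x)" for n
    by (intro set_integrable_lborel_continuous D continuous_intros g \<zeta>)+
  show "integrable lborel (\<lambda>x. \<bar>indicator D x *\<^sub>R g x\<bar>)"
    using i(1) by (auto simp: set_integrable_def)
  show "(\<lambda>x. indicator D x *\<^sub>R g x) \<in> borel_measurable lborel"
    "(\<lambda>x. indicator D x *\<^sub>R (\<zeta> n x * g x)) \<in> borel_measurable lborel" for n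
    using i by (auto simp: set_integrable_def)
  show "AE x in lborel. (\<lambda>n. indicator D x *\<^sub>R (\<zeta> n x * g x)) \<longlonglongrightarrow> indicator D x *\<^sub>R g x"
    using lim by (auto simp: indicator_def)
  show "AE x in lborel. norm (indicator D x *\<^sub>R (\<zeta> n x * g x)) \<le> \<bar>indicator D x *\<^sub>R g x\<bar>" for n
    using \<zeta>(2) by (auto simp: indicator_def abs_mult mult_left_le_one_le)
qed

text \<open>In the layer of thickness \<open>2 / real (Suc n)\<close> the values of \<open>Y\<close>
  are within \<open>\<eta>\<close> in norm of those at the graph points. Integrated along
  \<open>e\<close>, the layer contributes at most the surface integral plus an error
  \<open>\<eta> * (B * m)\<close>, where \<open>B\<close> bounds the area element and
  \<open>m\<close> is the hyperplane measure of the relevant graph parameters.\<close>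

lemma chart_divergence_le:
  fixes Y :: "'a::euclidean_space \<Rightarrow> 'a" and Dv :: "'a \<Rightarrow> 'a \<Rightarrow> real"
  assumes D: "open D" "bounded D"
    and c: "boundary_chart 1 D (e, s, \<gamma>, U)" and \<sigma>: "surface_measure D \<sigma>"
    and fin: "emeasure \<sigma> (frontier D) < \<infinity>"
    and ball: "cball x0 r \<subseteq> U"
    and Y: "continuous_on (closure D) Y"
    and Y0: "\<And>x. x \<in> closure D \<Longrightarrow> x \<notin> ball x0 r \<Longrightarrow> Y x = 0"
    and der: "\<And>x b. x \<in> D \<Longrightarrow> b \<in> Basis \<Longrightarrow> ((\<lambda>h. Y (x + h *\<^sub>R b) \<bullet> b) has_real_derivative Dv b x) (at 0)"
    and Dv: "\<And>b. b \<in> Basis \<Longrightarrow> continuous_on (closure D) (Dv b)"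
    and Dv0: "\<And>x b. x \<in> D \<Longrightarrow> x \<notin> ball x0 r \<Longrightarrow> b \<in> Basis \<Longrightarrow> Dv b x = 0"
  shows "(LBINT x:D. (\<Sum>b\<in>Basis. Dv b x)) \<le> (LINT x:frontier D|\<sigma>. norm (Y x))"
proof -
  have e: "e \<in> Basis" and s: "s * s = 1" "\<bar>s\<bar> = 1" "s \<in> {1, -1}" and U: "open U" and inv: "\<And>y r. \<gamma> (y + r *\<^sub>R e) = \<gamma> y"
    and DU: "\<And>x. x \<in> U \<Longrightarrow> x \<in> D \<longleftrightarrow> s * (x \<bullet> e) > s * \<gamma> x" and C1: "Ck_on 1 UNIV \<gamma>"
    using c by auto
  have sets\<sigma>[measurable_cong, simp]: "sets \<sigma> = sets borel"
    using \<sigma> by (simp add: surface_measure_def)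
  note \<gamma> = Ck_on_1_UNIV[OF C1]
  note A = continuous_on_area_element[OF C1]
  have cK: "compact (closure D)" using D(2) by simp
  have DK: "x \<in> closure D" if "x \<in> D" for x using that closure_subset by blast
  \<comment> \<open>The distance to the graph along \<open>e\<close>, not the Euclidean one; inside
    \<open>U\<close> it is positive exactly on \<open>D\<close>.\<close>
  define \<rho> where "\<rho> x = s * (x \<bullet> e - \<gamma> x)" for x
  have \<rho>: "continuous_on UNIV \<rho>" unfolding \<rho>_def by (intro continuous_intros \<gamma>(1))
  have \<rho>K: "continuous_on (closure D) \<rho>" using \<rho> continuous_on_subset by blast
  have \<rho>pos: "x \<in> D \<longleftrightarrow> \<rho> x > 0" if "x \<in> U" for x
    using DU[OF that] by (simp add: \<rho>_def algebra_simps)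
  have der\<rho>: "((\<lambda>h. \<rho> (x + h *\<^sub>R b)) has_real_derivative s * (b \<bullet> e - pd b \<gamma> x)) (at 0)" if "b \<in> Basis" for x b
  proof -
    have "((\<lambda>h. (x + h *\<^sub>R b) \<bullet> e) has_real_derivative b \<bullet> e) (at 0)"
      by (auto simp: inner_add_left intro!: derivative_eq_intros)
    from DERIV_cmult[OF DERIV_diff[OF this \<gamma>(3)[OF that]]] show ?thesis
      by (simp add: \<rho>_def)
  qed
  define L where "L n = (LBINT x:D. cutoff n (\<rho> x) * (\<Sum>b\<in>Basis. Dv b x))" for n
  have lim: "L \<longlonglongrightarrow> (LBINT x:D. (\<Sum>b\<in>Basis. Dv b x))"
    unfolding L_def
  proof (rule set_integral_dominated_LIMSEQ[OF D])
    show "\<bar>cutoff n (\<rho> x)\<bar> \<le> 1" for n x using cutoff_range[of n "\<rho> x"] by simp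
    fix x assume x: "x \<in> D"
    show "(\<lambda>n. cutoff n (\<rho> x) * (\<Sum>b\<in>Basis. Dv b x)) \<longlonglongrightarrow> (\<Sum>b\<in>Basis. Dv b x)"
    proof (cases "x \<in> ball x0 r")
      case True
      then have "x \<in> U" using ball ball_subset_cball by blast
      then have "\<rho> x > 0" using \<rho>pos x by blast
      from tendsto_mult_right[OF cutoff_LIMSEQ[OF this], of "\<Sum>b\<in>Basis. Dv b x"] show ?thesis by simp
    qed (use Dv0 x in simp)
  qed (intro continuous_intros Dv \<rho>K; assumption)+
  define F where "F x = area_element \<gamma> x * norm (Y x)" for x
  have F: "continuous_on (closure D) F"
    unfolding F_def by (intro continuous_intros Y continuous_on_subset[OF A]) auto
  have F0: "0 \<le> F x" for x by (simp add: F_def area_element_nonneg)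
  have step1: "L n \<le> (LBINT x:D. cutoff' n (\<rho> x) * F x)" for n
  proof -
    have "L n = - (LBINT x:D. (\<Sum>b\<in>Basis. (cutoff' n (\<rho> x) * (s * (b \<bullet> e - pd b \<gamma> x))) * (Y x \<bullet> b)))"
      unfolding L_def
    proof (rule integral_divergence_cutoff[OF D Y der Dv])
      show "continuous_on (closure D) (\<lambda>x. cutoff n (\<rho> x))" by (intro continuous_intros \<rho>K)
      show "continuous_on (closure D) (\<lambda>x. cutoff' n (\<rho> x) * (s * (b \<bullet> e - pd b \<gamma> x)))" if "b \<in> Basis" for b
        by (intro continuous_intros \<rho>K continuous_on_subset[OF \<gamma>(2)[OF that]]) auto
      show "((\<lambda>h. cutoff n (\<rho> (x + h *\<^sub>R b))) has_real_derivative cutoff' n (\<rho> x) * (s * (b \<bullet> e - pd b \<gamma> x))) (at 0)"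
        if "b \<in> Basis" for x b
        using DERIV_chain2[OF DERIV_cutoff der\<rho>[OF that], of n x] by simp
      fix x assume x: "x \<notin> D"
      show "\<exists>\<epsilon>>0. \<forall>y\<in>D. dist x y < \<epsilon> \<longrightarrow> cutoff n (\<rho> y) *\<^sub>R Y y = 0"
      \<comment> \<open>Inside the closed ball the chart applies and the cutoff vanishes near
        \<open>x\<close>; the complement of the closed ball is open, and \<open>Y\<close> vanishes
        there.\<close>
      proof (cases "x \<in> cball x0 r")
        case True
        then have "x \<in> U" using ball by blast
        then have "\<rho> x \<le> 0" using \<rho>pos x not_le by blast
        then have "\<rho> x < 1 / real (Suc n)" by (rule le_less_trans) simp
        then have "open {y. \<rho> y < 1 / real (Suc n)}" "x \<in> {y. \<rho> y < 1 / real (Suc n)}"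
          using \<rho> by (auto intro!: open_Collect_less continuous_intros)
        then obtain \<epsilon> where "\<epsilon> > 0" "ball x \<epsilon> \<subseteq> {y. \<rho> y < 1 / real (Suc n)}"
          using openE by blast
        then show ?thesis using cutoff_eq_0 by (intro exI[of _ \<epsilon>]) auto
      next
        case False
        have "open (- cball x0 r)" by (rule open_Compl) simp
        then obtain \<epsilon> where "\<epsilon> > 0" "ball x \<epsilon> \<subseteq> - cball x0 r"
          using False openE[of "- cball x0 r" x] by blast
        moreover have "Y y = 0" if "y \<in> D" "dist x y < \<epsilon>" for y
        proof (rule Y0[OF DK[OF that(1)]])
          have "y \<notin> cball x0 r" using \<open>ball x \<epsilon> \<subseteq> - cball x0 r\<close> that(2) by auto
          then show "y \<notin> ball x0 r" using ball_subset_cball by blast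
        qed
        ultimately show ?thesis by (intro exI[of _ \<epsilon>]) simp
      qed
    qed
    also have "\<dots> = (LBINT x:D. - (\<Sum>b\<in>Basis. (cutoff' n (\<rho> x) * (s * (b \<bullet> e - pd b \<gamma> x))) * (Y x \<bullet> b)))"
      by (simp add: set_lebesgue_integral_def)
    also have "\<dots> \<le> (LBINT x:D. cutoff' n (\<rho> x) * F x)"
    proof (rule set_integral_mono)
      show "set_integrable lborel D (\<lambda>x. - (\<Sum>b\<in>Basis. (cutoff' n (\<rho> x) * (s * (b \<bullet> e - pd b \<gamma> x))) * (Y x \<bullet> b)))"
        by (intro set_integrable_lborel_continuous D continuous_intros \<rho>K Y continuous_on_subset[OF \<gamma>(2)]) auto
      show "set_integrable lborel D (\<lambda>x. cutoff' n (\<rho> x) * F x)"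
        by (intro set_integrable_lborel_continuous D continuous_intros \<rho>K F)
      fix x
      \<comment> \<open>\<open>s\<close> times \<open>N\<close> is the gradient of
        \<open>\<rho>\<close>. As \<open>pd e \<gamma>\<close> vanishes, the
        \<open>e\<close>-component of \<open>N\<close> is 1 and its length is the area
        element.\<close>
      define N where "N = e - (\<Sum>b\<in>Basis. pd b \<gamma> x *\<^sub>R b)"
      have Nb: "N \<bullet> b = b \<bullet> e - pd b \<gamma> x" if "b \<in> Basis" for b
        using that by (simp add: N_def inner_diff_left inner_commute[of e])
      have pe: "pd e \<gamma> x = 0"
        by (rule pd_eqI) (simp add: inv)
      have "(norm N)\<^sup>2 = (\<Sum>b\<in>Basis. (b \<bullet> e - pd b \<gamma> x)\<^sup>2)"
        unfolding power2_norm_eq_inner euclidean_inner[of N N] by (intro sum.cong) (auto simp: Nb power2_eq_square)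
      also have "\<dots> = (\<Sum>b\<in>Basis. (if b = e then 1 else 0) + (pd b \<gamma> x)\<^sup>2)"
        using e pe by (intro sum.cong) (auto simp: inner_Basis)
      also have "\<dots> = 1 + (\<Sum>b\<in>Basis. (pd b \<gamma> x)\<^sup>2)"
        using e by (simp add: sum.distrib)
      finally have "norm N = area_element \<gamma> x"
        unfolding area_element_def using real_sqrt_unique[of "norm N"] by simp
      have "- (\<Sum>b\<in>Basis. (cutoff' n (\<rho> x) * (s * (b \<bullet> e - pd b \<gamma> x))) * (Y x \<bullet> b)) = cutoff' n (\<rho> x) * (- s * (N \<bullet> Y x))"
      proof -
        have "(\<Sum>b\<in>Basis. (cutoff' n (\<rho> x) * (s * (b \<bullet> e - pd b \<gamma> x))) * (Y x \<bullet> b)) =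
            (\<Sum>b\<in>Basis. cutoff' n (\<rho> x) * s * ((N \<bullet> b) * (Y x \<bullet> b)))"
          by (rule sum.cong) (simp_all add: Nb mult.assoc)
        also have "\<dots> = cutoff' n (\<rho> x) * s * (N \<bullet> Y x)"
          by (subst euclidean_inner[of N "Y x"]) (simp only: sum_distrib_left)
        finally show ?thesis by simp
      qed
      also have "\<dots> \<le> cutoff' n (\<rho> x) * F x"
      proof (rule mult_left_mono)
        have "- s * (N \<bullet> Y x) \<le> \<bar>N \<bullet> Y x\<bar>" using s(3) by auto
        also have "\<dots> \<le> norm N * norm (Y x)" by (rule Cauchy_Schwarz_ineq2)
        finally show "- s * (N \<bullet> Y x) \<le> F x" by (simp add: F_def \<open>norm N = _\<close>)
      qed (rule cutoff'_nonneg)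
      finally show "- (\<Sum>b\<in>Basis. (cutoff' n (\<rho> x) * (s * (b \<bullet> e - pd b \<gamma> x))) * (Y x \<bullet> b)) \<le> cutoff' n (\<rho> x) * F x" .
    qed
    finally show ?thesis .
  qed
  have [measurable]: "graph_pt e \<gamma> \<in> borel_measurable borel"
    unfolding graph_pt_def
    by (intro borel_measurable_continuous_onI continuous_intros \<gamma>(1))
  have [measurable]: "area_element \<gamma> \<in> borel_measurable borel"
    by (rule borel_measurable_continuous_onI[OF A])
  have [measurable]: "\<And>n. cutoff' n \<in> borel_measurable borel"
    by (intro borel_measurable_continuous_onI continuous_intros continuous_on_id)
  have FrU[measurable]: "frontier D \<inter> U \<in> sets borel"
    using U by (intro sets.Int borel_closed borel_open) auto
  \<comment> \<open>Room for the graph points: in the layer a point of the ball and its graph point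
    differ by at most \<open>2 / real (Suc n)\<close>, so in layers thinner than
    \<open>\<delta>\<close> the latter still lies in \<open>U\<close>.\<close>
  obtain \<delta> where \<delta>: "\<delta> > 0" "(\<Union>x\<in>cball x0 r. cball x \<delta>) \<subseteq> U"
    by (rule compact_subset_open_imp_cball_epsilon_subset[OF compact_cball U ball])
  define R where "R = norm x0 + \<bar>r\<bar> + \<delta>"
  let ?W = "{y. norm (graph_pt e \<gamma> y) \<le> R}"
  have [measurable]: "?W \<in> sets borel" by measurable
  obtain B where B: "0 \<le> B" "\<And>x. x \<in> cball 0 R \<Longrightarrow> norm (area_element \<gamma> x) \<le> B"
    by (rule compact_bound[OF compact_cball[of 0 R] continuous_on_subset[OF A subset_UNIV]]) blast
  have AB: "area_element \<gamma> y \<le> B" if "norm (graph_pt e \<gamma> y) \<le> R" for y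
    using B(2)[of "graph_pt e \<gamma> y"] that by (simp add: graph_pt_eq_shift area_element_shift[OF inv])
  define m where "m = enn2real (emeasure (hyperplane_measure e) ?W)"
  have m: "emeasure (hyperplane_measure e) ?W = ennreal m" "0 \<le> m"
    using emeasure_hyperplane_finite[OF e \<gamma>(1) inv, of R] by (auto simp: m_def)
  define I where "I = (LINT x:frontier D|\<sigma>. norm (Y x))"
  \<comment> \<open>\<open>Y\<close> is controlled on \<open>closure D\<close> only; setting the
    norm to zero off the boundary gives a Borel function on the whole space.\<close>
  define YF where "YF x = indicator (frontier D) x * norm (Y x)" for x
  have "(\<lambda>x. indicator (frontier D) x *\<^sub>R norm (Y x)) \<in> borel_measurable borel"
  proof (rule borel_measurable_continuous_on_indicator)
    have "frontier D \<subseteq> closure D" by (simp add: frontier_def Diff_subset)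
    then show "continuous_on (frontier D) (\<lambda>x. norm (Y x))"
      using continuous_on_subset[OF Y] by (intro continuous_intros) auto
  qed simp
  then have YF[measurable]: "YF \<in> borel_measurable borel" by (simp add: YF_def[abs_def])
  have I: "(\<integral>\<^sup>+ x. ennreal (YF x) \<partial>\<sigma>) = ennreal I" and I0: "0 \<le> I"
  proof -
    have "set_integrable \<sigma> (frontier D) (\<lambda>x. norm (Y x))"
      by (rule set_integrable_continuous_compact[OF cK continuous_on_norm[OF Y] _ _ sets\<sigma> fin])
         (auto simp: frontier_def)
    then show "(\<integral>\<^sup>+ x. ennreal (YF x) \<partial>\<sigma>) = ennreal I"
      unfolding I_def set_lebesgue_integral_def set_integrable_def YF_def
      by (subst nn_integral_eq_integral[symmetric]) auto
    show "0 \<le> I" unfolding I_def set_lebesgue_integral_def by (intro Bochner_Integration.integral_nonneg) auto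
  qed
  have step2: "\<exists>N. \<forall>n\<ge>N. (LBINT x:D. cutoff' n (\<rho> x) * F x) \<le> I + \<eta> * (B * m)" if \<eta>: "\<eta> > 0" for \<eta>
  proof -
    have "uniformly_continuous_on (closure D) (\<lambda>x. norm (Y x))"
      by (intro compact_uniformly_continuous cK continuous_intros Y)
    then obtain d where d: "d > 0"
      "\<And>x y. x \<in> closure D \<Longrightarrow> y \<in> closure D \<Longrightarrow> dist x y < d \<Longrightarrow> \<bar>norm (Y x) - norm (Y y)\<bar> < \<eta>"
      using \<eta> unfolding uniformly_continuous_on_def dist_real_def by metis
    obtain N where N: "2 / real (Suc N) < min d \<delta>"
    proof -
      obtain N where "2 / min d \<delta> < real N" using reals_Archimedean2 by blast
      then have "2 < real (Suc N) * min d \<delta>" using d \<delta> by (simp add: field_simps)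
      then have "2 / real (Suc N) < min d \<delta>"
        by (simp add: pos_divide_less_eq mult.commute del: of_nat_Suc min_less_iff_conj)
      then show ?thesis by (rule that)
    qed
    have "(LBINT x:D. cutoff' n (\<rho> x) * F x) \<le> I + \<eta> * (B * m)" if n: "n \<ge> N" for n
    proof -
      have small: "2 / real (Suc n) < d" "2 / real (Suc n) \<le> \<delta>"
      proof -
        have "2 / real (Suc n) \<le> 2 / real (Suc N)" using n by (intro divide_left_mono) auto
        then show "2 / real (Suc n) < d" "2 / real (Suc n) \<le> \<delta>" using N by auto
      qed
      have int: "set_integrable lborel D (\<lambda>x. cutoff' n (\<rho> x) * F x)"
        by (intro set_integrable_lborel_continuous D continuous_intros \<rho>K F)
      define g where "g x = indicator D x *\<^sub>R (cutoff' n (\<rho> x) * F x)" for x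
      have g0: "0 \<le> g x" for x by (simp add: g_def F0 cutoff'_nonneg)
      have gm[measurable]: "(\<lambda>x. ennreal (g x)) \<in> borel_measurable borel"
        using int unfolding set_integrable_def g_def[symmetric] by (auto dest: borel_measurable_integrable)
      have "ennreal (LBINT x:D. cutoff' n (\<rho> x) * F x) = (\<integral>\<^sup>+ x. ennreal (g x) \<partial>lborel)"
        using int g0 unfolding set_lebesgue_integral_def set_integrable_def g_def[symmetric]
        by (subst nn_integral_eq_integral) auto
      also have "\<dots> = (\<integral>\<^sup>+ y. (\<integral>\<^sup>+ t. ennreal (g (graph_pt e \<gamma> y + (s * t) *\<^sub>R e)) \<partial>lborel) \<partial>hyperplane_measure e)"
        by (rule nn_integral_lborel_graph[OF e s(3) gm])
      also have "\<dots> \<le> (\<integral>\<^sup>+ y. indicator (frontier D \<inter> U) (graph_pt e \<gamma> y) * ennreal (area_element \<gamma> y) * ennreal (YF (graph_pt e \<gamma> y))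
          + ennreal (\<eta> * B) * indicator ?W y \<partial>hyperplane_measure e)"
      proof (rule nn_integral_mono)
        fix y
        let ?p = "graph_pt e \<gamma> y"
        \<comment> \<open>A majorant of \<open>F\<close> on the part of the line through
          \<open>y\<close> that matters. It does not depend on \<open>t\<close>, so only the unit
          mass of \<open>cutoff'\<close> remains to be integrated.\<close>
        define V where "V = indicator (frontier D \<inter> U) ?p * area_element \<gamma> y * YF ?p + \<eta> * B * indicator ?W y"
        have V0: "0 \<le> V" using B(1) \<eta> by (simp add: V_def YF_def area_element_nonneg)
        have le: "g (?p + (s * t) *\<^sub>R e) \<le> cutoff' n t * V" for t
        proof (cases "g (?p + (s * t) *\<^sub>R e) = 0")
          case True
          then show ?thesis using V0 cutoff'_nonneg[of n t] by simp
        next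
          case False
          let ?q = "?p + (s * t) *\<^sub>R e"
          have \<gamma>q: "\<gamma> ?q = \<gamma> y" by (simp add: graph_pt_def inv)
          have \<rho>q: "\<rho> ?q = t"
            using e s(1) by (simp add: \<rho>_def \<gamma>q inner_add_left inner_graph_pt mult.assoc[symmetric])
          have q: "?q \<in> D" "cutoff' n t \<noteq> 0" "Y ?q \<noteq> 0"
            using False by (auto simp: g_def \<rho>q F_def split: split_indicator_asm)
          then have qb: "?q \<in> ball x0 r" using Y0 DK by blast
          have t: "0 \<le> t" "t \<le> 2 / real (Suc n)" using cutoff'_eq_0[of t n] q(2) by force+
          have dqp: "dist ?q ?p = t" using e s(2) t(1) by (simp add: dist_norm abs_mult)
          have "?p \<in> cball ?q \<delta>" using dqp t small by simp
          moreover have "?q \<in> cball x0 r" using qb ball_subset_cball by blast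
          ultimately have pU: "?p \<in> U" using \<delta>(2) by blast
          have pF: "?p \<in> frontier D" by (rule frontier_graph_pt[OF c pU])
          have "norm ?p \<le> R"
          proof -
            have "norm ?p \<le> norm x0 + dist x0 ?p"
              using norm_triangle_sub[of ?p x0] by (simp add: dist_norm norm_minus_commute)
            moreover have "dist x0 ?p \<le> dist x0 ?q + dist ?q ?p" by (rule dist_triangle)
            ultimately show ?thesis using qb dqp t small by (simp add: R_def)
          qed
          then have W: "y \<in> ?W" by simp
          have pK: "?p \<in> closure D" using pF by (simp add: frontier_def)
          have "norm (Y ?q) \<le> norm (Y ?p) + \<eta>"
            using d(2)[OF DK[OF q(1)] pK] dqp t small by auto
          then have "area_element \<gamma> y * norm (Y ?q) \<le> area_element \<gamma> y * (norm (Y ?p) + \<eta>)"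
            by (intro mult_left_mono area_element_nonneg)
          also have "\<dots> \<le> area_element \<gamma> y * norm (Y ?p) + \<eta> * B"
            using AB[of y] W \<eta> by (simp add: algebra_simps)
          also have "\<dots> = V" using W pF pU by (simp add: V_def YF_def)
          finally have "F ?q \<le> V"
            by (simp add: F_def area_element_shift[OF inv] graph_pt_eq_shift[of e \<gamma> y])
          then show ?thesis
            using q cutoff'_nonneg[of n t] by (simp add: g_def \<rho>q mult_left_mono)
        qed
        have "(\<integral>\<^sup>+ t. ennreal (g (?p + (s * t) *\<^sub>R e)) \<partial>lborel) \<le> (\<integral>\<^sup>+ t. ennreal (cutoff' n t) * ennreal V \<partial>lborel)"
          using le V0 by (intro nn_integral_mono) (simp add: ennreal_mult''[symmetric] ennreal_leI)
        also have "\<dots> = ennreal V"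
          by (subst nn_integral_multc) (auto simp: nn_integral_cutoff')
        also have "\<dots> = indicator (frontier D \<inter> U) ?p * ennreal (area_element \<gamma> y) * ennreal (YF ?p) + ennreal (\<eta> * B) * indicator ?W y"
          using B(1) \<eta> area_element_nonneg[of \<gamma> y]
          by (auto simp: V_def YF_def indicator_def ennreal_plus ennreal_mult)
        finally show "(\<integral>\<^sup>+ t. ennreal (g (?p + (s * t) *\<^sub>R e)) \<partial>lborel) \<le> indicator (frontier D \<inter> U) ?p * ennreal (area_element \<gamma> y) * ennreal (YF ?p) + ennreal (\<eta> * B) * indicator ?W y" .
      qed
      also have "\<dots> = (\<integral>\<^sup>+ x. indicator (frontier D \<inter> U) x * ennreal (YF x) \<partial>\<sigma>) + ennreal (\<eta> * B) * ennreal m"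
        unfolding nn_integral_surface_measure[OF \<sigma> c measurable_compose[OF YF measurable_ennreal]] m(1)[symmetric]
        by (subst nn_integral_add) (auto simp: nn_integral_cmult_indicator)
      also have "\<dots> \<le> (\<integral>\<^sup>+ x. ennreal (YF x) \<partial>\<sigma>) + ennreal (\<eta> * B) * ennreal m"
        by (intro add_right_mono nn_integral_mono) (auto simp: indicator_def)
      also have "\<dots> = ennreal (I + \<eta> * (B * m))"
        unfolding I using I0 B(1) \<eta> m(2) by (simp add: ennreal_mult'[symmetric] ennreal_plus[symmetric] mult.assoc del: ennreal_plus)
      finally show ?thesis
        using I0 B(1) \<eta> m(2) by (subst (asm) ennreal_le_iff) auto
    qed
    then show ?thesis by blast
  qed
  have "(LBINT x:D. (\<Sum>b\<in>Basis. Dv b x)) \<le> I + \<eta> * (B * m)" if \<eta>: "\<eta> > 0" for \<eta>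
  proof (rule LIMSEQ_le_const2[OF lim])
    show "\<exists>N. \<forall>n\<ge>N. L n \<le> I + \<eta> * (B * m)"
      using step2[OF \<eta>] step1 order_trans by blast
  qed
  then have "(LBINT x:D. (\<Sum>b\<in>Basis. Dv b x)) \<le> I + \<epsilon>" if "\<epsilon> > 0" for \<epsilon>
  proof -
    have Bm: "0 \<le> B * m" using B(1) m(2) by simp
    have "\<epsilon> / (B * m + 1) * (B * m) \<le> \<epsilon>"
      using that Bm by (simp add: divide_le_eq mult_left_le field_simps)
    moreover have "\<epsilon> / (B * m + 1) > 0" using that Bm by simp
    ultimately show ?thesis
      using \<open>\<And>\<eta>. \<eta> > 0 \<Longrightarrow> (LBINT x:D. (\<Sum>b\<in>Basis. Dv b x)) \<le> I + \<eta> * (B * m)\<close>[of "\<epsilon> / (B * m + 1)"] by linarith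
  qed
  then show ?thesis
    unfolding I_def by (rule field_le_epsilon)
qed

section \<open>The divergence inequality and Green's inequality\<close>

text \<open>A predicate, so that a radius can be chosen for every centre before the fields are
  known: the partition of unity that produces the fields depends on these radii.\<close>

definition divergence_le_near :: "'a::euclidean_space set \<Rightarrow> 'a measure \<Rightarrow> 'a \<Rightarrow> real \<Rightarrow> bool" where
  "divergence_le_near D \<sigma> c r \<longleftrightarrow> (\<forall>Y Dv.
    continuous_on (closure D) Y \<longrightarrow> (\<forall>x\<in>closure D. x \<notin> ball c r \<longrightarrow> Y x = 0) \<longrightarrow>
    (\<forall>x\<in>D. \<forall>b\<in>Basis. ((\<lambda>h. Y (x + h *\<^sub>R b) \<bullet> b) has_real_derivative Dv b x) (at 0)) \<longrightarrow>
    (\<forall>b\<in>Basis. continuous_on (closure D) (Dv b)) \<longrightarrow>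
    (\<forall>x\<in>D. x \<notin> ball c r \<longrightarrow> (\<forall>b\<in>Basis. Dv b x = 0)) \<longrightarrow>
    (LBINT x:D. (\<Sum>b\<in>Basis. Dv b x)) \<le> (LINT x:frontier D|\<sigma>. norm (Y x)))"

text \<open>Around an interior point the field vanishes near the boundary, and the constant cutoff 1
  shows that its divergence has integral zero; around a boundary point a chart is used.\<close>

lemma local_divergence_le:
  fixes D :: "'a::euclidean_space set"
  assumes D: "open D" "bounded D" "Ck_boundary 1 D" and \<sigma>: "surface_measure D \<sigma>" and x0: "x0 \<in> closure D"
  shows "\<exists>r>0. divergence_le_near D \<sigma> x0 r"
proof (cases "x0 \<in> D")
  case True
  then obtain r where r: "r > 0" "cball x0 r \<subseteq> D"
    using D(1) open_contains_cball by blast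
  show ?thesis
    unfolding divergence_le_near_def
  proof (intro exI[of _ r] conjI r allI impI)
    fix Y :: "'a \<Rightarrow> 'a" and Dv :: "'a \<Rightarrow> 'a \<Rightarrow> real"
    assume Y: "continuous_on (closure D) Y" and Y0: "\<forall>x\<in>closure D. x \<notin> ball x0 r \<longrightarrow> Y x = 0"
      and der: "\<forall>x\<in>D. \<forall>b\<in>Basis. ((\<lambda>h. Y (x + h *\<^sub>R b) \<bullet> b) has_real_derivative Dv b x) (at 0)"
      and Dv: "\<forall>b\<in>Basis. continuous_on (closure D) (Dv b)"
    have "(LBINT x:D. 1 * (\<Sum>b\<in>Basis. Dv b x)) = - (LBINT x:D. (\<Sum>b\<in>Basis. 0 * (Y x \<bullet> b)))"
    proof (rule integral_divergence_cutoff[OF D(1,2) Y])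
      fix x assume "x \<notin> D"
      then have "x \<notin> cball x0 r" using r(2) by blast
      then obtain \<epsilon> where \<epsilon>: "\<epsilon> > 0" "ball x \<epsilon> \<subseteq> - cball x0 r"
        using openE[of "- cball x0 r" x] by (auto simp: open_Compl)
      have "Y y = 0" if "y \<in> D" "dist x y < \<epsilon>" for y
      proof -
        have "y \<notin> cball x0 r" using \<epsilon>(2) that(2) by auto
        then have "y \<notin> ball x0 r" using ball_subset_cball by blast
        moreover have "y \<in> closure D" using that(1) closure_subset by blast
        ultimately show ?thesis using Y0 by blast
      qed
      then show "\<exists>\<epsilon>>0. \<forall>y\<in>D. dist x y < \<epsilon> \<longrightarrow> 1 *\<^sub>R Y y = 0"
        using \<epsilon>(1) by auto
    qed (use der Dv in auto)
    then have "(LBINT x:D. (\<Sum>b\<in>Basis. Dv b x)) = 0" by simp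
    also have "0 \<le> (LINT x:frontier D|\<sigma>. norm (Y x))"
      unfolding set_lebesgue_integral_def by (intro Bochner_Integration.integral_nonneg) auto
    finally show "(LBINT x:D. (\<Sum>b\<in>Basis. Dv b x)) \<le> (LINT x:frontier D|\<sigma>. norm (Y x))" .
  qed
next
  case False
  then have "x0 \<in> frontier D" using x0 D(1) by (simp add: frontier_def interior_open)
  then obtain e s \<gamma> U where c: "boundary_chart 1 D (e, s, \<gamma>, U)" "x0 \<in> U"
    using D(3) unfolding Ck_boundary_def by (metis chart_dom.simps chart_dom.cases)
  then have "open U" by auto
  then obtain r where r: "r > 0" "cball x0 r \<subseteq> U"
    using c(2) open_contains_cball by blast
  show ?thesis
    unfolding divergence_le_near_def
  proof (intro exI[of _ r] conjI r allI impI)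
    fix Y :: "'a \<Rightarrow> 'a" and Dv :: "'a \<Rightarrow> 'a \<Rightarrow> real"
    assume "continuous_on (closure D) Y" "\<forall>x\<in>closure D. x \<notin> ball x0 r \<longrightarrow> Y x = 0"
      "\<forall>x\<in>D. \<forall>b\<in>Basis. ((\<lambda>h. Y (x + h *\<^sub>R b) \<bullet> b) has_real_derivative Dv b x) (at 0)"
      "\<forall>b\<in>Basis. continuous_on (closure D) (Dv b)"
      "\<forall>x\<in>D. x \<notin> ball x0 r \<longrightarrow> (\<forall>b\<in>Basis. Dv b x = 0)"
    then show "(LBINT x:D. (\<Sum>b\<in>Basis. Dv b x)) \<le> (LINT x:frontier D|\<sigma>. norm (Y x))"
      by (intro chart_divergence_le[OF D(1,2) c(1) \<sigma> emeasure_frontier_finite[OF \<sigma> D(2,3)] r(2)]) auto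
  qed
qed

text \<open>For \<open>r > 0\<close> positive exactly on the open ball, and of class C^1, which
  suffices for localising a first-order inequality.\<close>

definition bump :: "'a::euclidean_space \<Rightarrow> real \<Rightarrow> 'a \<Rightarrow> real" where
  "bump c r y = sqpos (r\<^sup>2 - (y - c) \<bullet> (y - c))"

definition bump' :: "'a::euclidean_space \<Rightarrow> real \<Rightarrow> 'a \<Rightarrow> 'a \<Rightarrow> real" where
  "bump' c r b y = 2 * max 0 (r\<^sup>2 - (y - c) \<bullet> (y - c)) * (- 2 * ((y - c) \<bullet> b))"

lemma DERIV_bump: "((\<lambda>h. bump c r (y + h *\<^sub>R b)) has_real_derivative bump' c r b y) (at 0)"
proof -
  have eq: "r\<^sup>2 - (y + h *\<^sub>R b - c) \<bullet> (y + h *\<^sub>R b - c) =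
      r\<^sup>2 - ((y - c) \<bullet> (y - c) + h * (2 * ((y - c) \<bullet> b)) + h\<^sup>2 * (b \<bullet> b))" for h
    by (simp add: algebra_simps inner_commute power2_eq_square)
  have "((\<lambda>h. r\<^sup>2 - (y + h *\<^sub>R b - c) \<bullet> (y + h *\<^sub>R b - c)) has_real_derivative - 2 * ((y - c) \<bullet> b)) (at 0)"
    unfolding eq by (auto intro!: derivative_eq_intros)
  from DERIV_chain2[OF DERIV_sqpos this] show ?thesis
    by (simp add: bump_def bump'_def)
qed

lemma continuous_on_bump [continuous_intros]:
  "continuous_on S (bump c r)" "continuous_on S (bump' c r b)"
  unfolding bump_def bump'_def by (intro continuous_intros)+

lemma bump_nonneg: "0 \<le> bump c r y"
  by (simp add: bump_def sqpos_nonneg)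

lemma bump_outside: "0 < r \<Longrightarrow> y \<notin> ball c r \<Longrightarrow> bump c r y = 0 \<and> bump' c r b y = 0"
proof -
  assume "0 < r" "y \<notin> ball c r"
  then have "r\<^sup>2 \<le> (norm (y - c))\<^sup>2"
    by (intro power_mono) (auto simp: dist_norm norm_minus_commute)
  then have "r\<^sup>2 - (y - c) \<bullet> (y - c) \<le> 0"
    by (simp add: power2_norm_eq_inner)
  then show ?thesis by (simp add: bump_def bump'_def sqpos_eq_0)
qed

lemma bump_pos: "y \<in> ball c r \<Longrightarrow> 0 < bump c r y"
proof -
  assume "y \<in> ball c r"
  then have "(norm (y - c))\<^sup>2 < r\<^sup>2"
    by (intro power_strict_mono) (auto simp: dist_norm norm_minus_commute)
  then show ?thesis
    by (simp add: bump_def power2_norm_eq_inner sqpos_pos)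
qed

text \<open>The bumps of a finite subcover, divided by their sum, form a partition of unity on
  \<open>closure D\<close>. As the weights are nonnegative with sum 1, the norms of the pieces add
  up to \<open>norm (X x)\<close>, and the localisation loses nothing in the constant.\<close>

theorem divergence_le:
  fixes D :: "'a::euclidean_space set" and X :: "'a \<Rightarrow> 'a" and DX :: "'a \<Rightarrow> 'a \<Rightarrow> real"
  assumes D: "open D" "bounded D" "Ck_boundary 1 D" and \<sigma>: "surface_measure D \<sigma>"
    and X: "continuous_on (closure D) X"
    and DX: "\<And>b. b \<in> Basis \<Longrightarrow> continuous_on (closure D) (DX b)"
    and der: "\<And>x b. x \<in> D \<Longrightarrow> b \<in> Basis \<Longrightarrow> ((\<lambda>h. X (x + h *\<^sub>R b) \<bullet> b) has_real_derivative DX b x) (at 0)"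
  shows "(LBINT x:D. (\<Sum>b\<in>Basis. DX b x)) \<le> (LINT x:frontier D|\<sigma>. norm (X x))"
proof -
  let ?K = "closure D"
  have cK: "compact ?K" using D(2) by simp
  have DK: "D \<subseteq> ?K" by (rule closure_subset)
  have FK: "frontier D \<subseteq> ?K" by (simp add: frontier_def Diff_subset)
  have sets\<sigma>: "sets \<sigma> = sets borel"
    using \<sigma> by (simp add: surface_measure_def)
  note fin = emeasure_frontier_finite[OF \<sigma> D(2,3)]
  have "\<forall>c\<in>?K. \<exists>r>0. divergence_le_near D \<sigma> c r"
    using local_divergence_le[OF D \<sigma>] by blast
  then obtain r where r0: "\<And>c. c \<in> ?K \<Longrightarrow> r c > 0" and r: "\<And>c. c \<in> ?K \<Longrightarrow> divergence_le_near D \<sigma> c (r c)"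
    unfolding bchoice_iff by blast
  obtain C where C: "C \<subseteq> ?K" "finite C" "?K \<subseteq> (\<Union>c\<in>C. ball c (r c))"
    by (rule compactE_image[OF cK, of ?K "\<lambda>c. ball c (r c)"]) (use r0 in \<open>auto intro!: bexI\<close>)
  define S where "S y = (\<Sum>c\<in>C. bump c (r c) y)" for y
  define S' where "S' b y = (\<Sum>c\<in>C. bump' c (r c) b y)" for b y
  have Spos: "S y > 0" if y: "y \<in> ?K" for y
  proof -
    obtain c where "c \<in> C" "y \<in> ball c (r c)" using y C(3) by blast
    then show ?thesis
      unfolding S_def using C(2) by (intro sum_pos2[of C c]) (auto simp: bump_nonneg bump_pos simp del: mem_ball)
  qed
  have S0: "S y \<noteq> 0" if "y \<in> ?K" for y using Spos[OF that] by simp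
  have derS: "((\<lambda>h. S (y + h *\<^sub>R b)) has_real_derivative S' b y) (at 0)" for y b
    unfolding S_def S'_def by (rule DERIV_sum) (rule DERIV_bump)
  have contS: "continuous_on T S" "continuous_on T (S' b)" for T b
    unfolding S_def S'_def by (intro continuous_intros)+
  define w where "w c y = bump c (r c) y / S y" for c y
  define w' where "w' c b y = (bump' c (r c) b y * S y - bump c (r c) y * S' b y) / (S y * S y)" for c b y
  have derw: "((\<lambda>h. w c (y + h *\<^sub>R b)) has_real_derivative w' c b y) (at 0)" if "y \<in> ?K" for c b y
    using DERIV_divide[OF DERIV_bump[of c "r c" y b] derS[of y b]] S0[OF that]
    by (simp add: w_def w'_def)
  have contw: "continuous_on ?K (w c)" "continuous_on ?K (w' c b)" for c b
    unfolding w_def w'_def using S0 by (auto intro!: continuous_intros contS)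
  have w0: "0 \<le> w c y" if "y \<in> ?K" for c y
    using Spos[OF that] by (simp add: w_def bump_nonneg)
  have sumw: "(\<Sum>c\<in>C. w c y) = 1" if "y \<in> ?K" for y
    using S0[OF that] by (simp add: w_def S_def sum_divide_distrib[symmetric])
  have sumw': "(\<Sum>c\<in>C. w' c b y) = 0" for b y
    unfolding w'_def sum_divide_distrib[symmetric] sum_subtractf sum_distrib_right[symmetric]
    by (simp add: S_def[symmetric] S'_def[symmetric])
  define Dv where "Dv c b x = w' c b x * (X x \<bullet> b) + w c x * DX b x" for c b x
  have contDv: "continuous_on ?K (Dv c b)" if "b \<in> Basis" for c b
    unfolding Dv_def by (intro continuous_intros contw X DX that)
  have sumDv: "(\<Sum>c\<in>C. \<Sum>b\<in>Basis. Dv c b x) = (\<Sum>b\<in>Basis. DX b x)" if "x \<in> ?K" for x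
    by (subst sum.swap) (simp add: Dv_def sum.distrib sum_distrib_right[symmetric] sumw[OF that] sumw')
  have "(LBINT x:D. (\<Sum>b\<in>Basis. DX b x)) = (LBINT x:D. (\<Sum>c\<in>C. \<Sum>b\<in>Basis. Dv c b x))"
    by (rule set_lebesgue_integral_cong) (use D(1) sumDv DK in auto)
  also have "\<dots> = (\<Sum>c\<in>C. (LBINT x:D. (\<Sum>b\<in>Basis. Dv c b x)))"
  proof -
    have "set_integrable lborel D (\<lambda>x. \<Sum>b\<in>Basis. Dv c b x)" for c
      by (intro set_integrable_lborel_continuous D continuous_intros contDv)
    then show ?thesis
      unfolding set_lebesgue_integral_def set_integrable_def
      by (subst Bochner_Integration.integral_sum[symmetric]) (auto simp: sum_distrib_left)
  qed
  also have "\<dots> \<le> (\<Sum>c\<in>C. (LINT x:frontier D|\<sigma>. norm (w c x *\<^sub>R X x)))"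
  proof (rule sum_mono)
    fix c assume c: "c \<in> C"
    then have cK: "c \<in> ?K" using C(1) by blast
    have out: "bump c (r c) x = 0" "bump' c (r c) b x = 0" if "x \<notin> ball c (r c)" for x b
      using bump_outside[OF r0[OF cK] that] by blast+
    show "(LBINT x:D. (\<Sum>b\<in>Basis. Dv c b x)) \<le> (LINT x:frontier D|\<sigma>. norm (w c x *\<^sub>R X x))"
    proof (rule r[OF cK, unfolded divergence_le_near_def, THEN spec, THEN spec, THEN mp, THEN mp, THEN mp, THEN mp, THEN mp])
      show "continuous_on ?K (\<lambda>x. w c x *\<^sub>R X x)" by (intro continuous_intros contw X)
      show "\<forall>x\<in>?K. x \<notin> ball c (r c) \<longrightarrow> w c x *\<^sub>R X x = 0"
        using out(1) by (auto simp: w_def simp del: mem_ball)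
      show "\<forall>b\<in>Basis. continuous_on ?K (Dv c b)" using contDv by blast
      show "\<forall>x\<in>D. x \<notin> ball c (r c) \<longrightarrow> (\<forall>b\<in>Basis. Dv c b x = 0)"
        using out by (auto simp: Dv_def w_def w'_def simp del: mem_ball)
      show "\<forall>x\<in>D. \<forall>b\<in>Basis. ((\<lambda>h. w c (x + h *\<^sub>R b) *\<^sub>R X (x + h *\<^sub>R b) \<bullet> b) has_real_derivative Dv c b x) (at 0)"
      proof (intro ballI)
        fix x b :: 'a assume x: "x \<in> D" and b: "b \<in> Basis"
        have "x \<in> ?K" using x DK by blast
        from DERIV_mult[OF derw[OF this, of c b] der[OF x b]]
        show "((\<lambda>h. w c (x + h *\<^sub>R b) *\<^sub>R X (x + h *\<^sub>R b) \<bullet> b) has_real_derivative Dv c b x) (at 0)"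
          by (simp add: Dv_def mult.commute)
      qed
    qed
  qed
  also have "\<dots> = (LINT x:frontier D|\<sigma>. (\<Sum>c\<in>C. norm (w c x *\<^sub>R X x)))"
  proof -
    have "set_integrable \<sigma> (frontier D) (\<lambda>x. norm (w c x *\<^sub>R X x))" for c
      by (rule set_integrable_continuous_compact[OF cK _ FK _ sets\<sigma> fin])
         (auto intro!: continuous_intros contw X)
    then show ?thesis
      unfolding set_lebesgue_integral_def set_integrable_def
      by (subst Bochner_Integration.integral_sum[symmetric]) (auto simp: sum_distrib_left)
  qed
  also have "\<dots> = (LINT x:frontier D|\<sigma>. norm (X x))"
  proof (rule set_lebesgue_integral_cong)
    show "frontier D \<in> sets \<sigma>" by (simp add: sets\<sigma>)
    have "(\<Sum>c\<in>C. norm (w c x *\<^sub>R X x)) = norm (X x)" if "x \<in> frontier D" for x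
    proof -
      have xK: "x \<in> ?K" using that FK by blast
      have "(\<Sum>c\<in>C. norm (w c x *\<^sub>R X x)) = (\<Sum>c\<in>C. w c x) * norm (X x)"
        by (simp add: sum_distrib_right w0[OF xK])
      then show ?thesis by (simp add: sumw[OF xK])
    qed
    then show "\<forall>x. x \<in> frontier D \<longrightarrow> (\<Sum>c\<in>C. norm (w c x *\<^sub>R X x)) = norm (X x)" by blast
  qed
  finally show ?thesis .
qed

text \<open>The divergence inequality for the field w grad v, whose length is |w| |grad v|. The
  functions w and v are kept distinct because values at different times will be paired.\<close>

lemma green_le:
  fixes D :: "'a::euclidean_space set" and w :: "'a \<Rightarrow> real" and Gw Gv Hv :: "'a \<Rightarrow> 'a \<Rightarrow> real"
  assumes D: "open D" "bounded D" "Ck_boundary 1 D" and \<sigma>: "surface_measure D \<sigma>"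
    and cont: "continuous_on (closure D) w"
      "\<And>b. b \<in> Basis \<Longrightarrow> continuous_on (closure D) (Gw b)"
      "\<And>b. b \<in> Basis \<Longrightarrow> continuous_on (closure D) (Gv b)"
      "\<And>b. b \<in> Basis \<Longrightarrow> continuous_on (closure D) (Hv b)"
    and derw: "\<And>x b. x \<in> D \<Longrightarrow> b \<in> Basis \<Longrightarrow> ((\<lambda>h. w (x + h *\<^sub>R b)) has_real_derivative Gw b x) (at 0)"
    and derv: "\<And>x b. x \<in> D \<Longrightarrow> b \<in> Basis \<Longrightarrow> ((\<lambda>h. Gv b (x + h *\<^sub>R b)) has_real_derivative Hv b x) (at 0)"
  shows "(LBINT x:D. w x * (\<Sum>b\<in>Basis. Hv b x) + (\<Sum>b\<in>Basis. Gw b x * Gv b x))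
    \<le> (LINT x:frontier D|\<sigma>. \<bar>w x\<bar> * sqrt (\<Sum>b\<in>Basis. (Gv b x)\<^sup>2))"
proof -
  define V where "V x = (\<Sum>b\<in>Basis. Gv b x *\<^sub>R b)" for x
  have Vb: "V x \<bullet> b = Gv b x" if "b \<in> Basis" for x b
    using that by (simp add: V_def)
  have nV: "norm (V x) = sqrt (\<Sum>b\<in>Basis. (Gv b x)\<^sup>2)" for x
    unfolding norm_eq_sqrt_inner euclidean_inner[of "V x" "V x"] by (simp add: Vb power2_eq_square)
  have "(LBINT x:D. (\<Sum>b\<in>Basis. Gw b x * Gv b x + Hv b x * w x)) \<le> (LINT x:frontier D|\<sigma>. norm (w x *\<^sub>R V x))"
  proof (rule divergence_le[OF D \<sigma>])
    show "continuous_on (closure D) (\<lambda>x. w x *\<^sub>R V x)"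
      unfolding V_def by (intro continuous_intros cont)
    show "continuous_on (closure D) (\<lambda>x. Gw b x * Gv b x + Hv b x * w x)" if "b \<in> Basis" for b
      by (intro continuous_intros cont that)
    show "((\<lambda>h. w (x + h *\<^sub>R b) *\<^sub>R V (x + h *\<^sub>R b) \<bullet> b) has_real_derivative Gw b x * Gv b x + Hv b x * w x) (at 0)"
      if "x \<in> D" "b \<in> Basis" for x b
      using DERIV_mult[OF derw[OF that] derv[OF that]] by (simp add: Vb that)
  qed
  then show ?thesis
    by (simp add: nV sum.distrib sum_distrib_left mult.commute add.commute)
qed

section \<open>Integrals in time and space\<close>

lemma set_integral_Cauchy_Schwarz:
  fixes f g :: "'b \<Rightarrow> real"
  assumes f: "set_integrable M A (\<lambda>x. (f x)\<^sup>2)" and g: "set_integrable M A (\<lambda>x. (g x)\<^sup>2)"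
    and fg: "set_integrable M A (\<lambda>x. f x * g x)"
  shows "(LINT x:A|M. f x * g x) \<le> sqrt (LINT x:A|M. (f x)\<^sup>2) * sqrt (LINT x:A|M. (g x)\<^sup>2)"
proof -
  define a b c where "a = (LINT x:A|M. (f x)\<^sup>2)" and "b = (LINT x:A|M. (g x)\<^sup>2)" and "c = (LINT x:A|M. f x * g x)"
  have a0: "0 \<le> a" and b0: "0 \<le> b"
    unfolding a_def b_def set_lebesgue_integral_def by (intro Bochner_Integration.integral_nonneg; simp)+
  have quadr: "0 \<le> \<alpha>\<^sup>2 * a - 2 * \<alpha> * \<beta> * c + \<beta>\<^sup>2 * b" for \<alpha> \<beta>
  proof -
    have "0 \<le> (LINT x:A|M. (\<alpha> * f x - \<beta> * g x)\<^sup>2)"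
      unfolding set_lebesgue_integral_def by (intro Bochner_Integration.integral_nonneg) simp
    also have "\<dots> = (LINT x:A|M. (\<alpha>\<^sup>2 * (f x)\<^sup>2 - 2 * \<alpha> * \<beta> * (f x * g x)) + \<beta>\<^sup>2 * (g x)\<^sup>2)"
      by (rule arg_cong[where f = "set_lebesgue_integral M A"]) (simp add: fun_eq_iff power2_eq_square algebra_simps)
    also have "\<dots> = \<alpha>\<^sup>2 * a - 2 * \<alpha> * \<beta> * c + \<beta>\<^sup>2 * b"
      by (simp add: set_integral_add set_integral_diff f g fg a_def b_def c_def)
    finally show ?thesis .
  qed
  have "c\<^sup>2 \<le> a * b"
  proof (cases "b = 0")
    case False
    \<comment> \<open>The ratio of the coefficients \<open>\<alpha> = b\<close> and
      \<open>\<beta> = c\<close> is the minimising one and turns the form into b (a b -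
      c^2).\<close>
    have "0 \<le> b\<^sup>2 * a - 2 * b * c * c + c\<^sup>2 * b" by (rule quadr)
    also have "\<dots> = b * (a * b - c\<^sup>2)" by (simp add: power2_eq_square algebra_simps)
    finally show ?thesis using False b0 by (simp add: zero_le_mult_iff)
  next
    case True
    have "c = 0"
    proof (rule ccontr)
      assume "c \<noteq> 0"
      \<comment> \<open>With \<open>b = 0\<close> the form is affine in \<open>\<beta>\<close>; this
        choice of \<open>\<beta>\<close> gives it the value -1.\<close>
      have "0 \<le> a - 2 * ((a + 1) / (2 * c)) * c"
        using quadr[of 1 "(a + 1) / (2 * c)"] True by simp
      then show False using \<open>c \<noteq> 0\<close> by simp
    qed
    then show ?thesis using True by simp
  qed
  then have "\<bar>c\<bar> \<le> sqrt (a * b)" by (rule real_le_rsqrt[of "\<bar>c\<bar>", simplified])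
  then show ?thesis
    unfolding a_def b_def c_def by (simp add: real_sqrt_mult)
qed

lemma LINT_sum_add:
  fixes f g :: "'b \<Rightarrow> real"
  assumes "set_integrable M A f" "set_integrable M A g" "set_integrable M A h"
  shows "(LINT x:A|M. f x + g x + h x) = (LINT x:A|M. f x) + (LINT x:A|M. g x) + (LINT x:A|M. h x)"
  by (simp add: set_integral_add(2)[OF set_integral_add(1)[OF assms(1,2)] assms(3)] set_integral_add(2)[OF assms(1,2)])

lemma continuous_on_slices:
  fixes \<Phi> :: "'a::topological_space \<times> real \<Rightarrow> real"
  assumes "continuous_on (K \<times> {0..T}) \<Phi>"
  shows "x \<in> K \<Longrightarrow> continuous_on {0..T} (\<lambda>t. \<Phi> (x, t))"
    and "t \<in> {0..T} \<Longrightarrow> continuous_on K (\<lambda>x. \<Phi> (x, t))"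
  by (rule continuous_on_compose2[OF assms]; auto intro!: continuous_intros)+

lemma set_integrable_Icc:
  fixes f :: "real \<Rightarrow> real"
  assumes "continuous_on {0..T} f" "t \<le> T"
  shows "set_integrable lborel {0..t} f"
  by (rule borel_integrable_atLeastAtMost') (rule continuous_on_subset[OF assms(1)], use assms(2) in auto)

lemma LINT_Icc_has_derivative:
  fixes f :: "real \<Rightarrow> real"
  assumes f: "continuous_on {0..T} f" and t: "t \<in> {0..T}"
  shows "((\<lambda>t. LBINT s:{0..t}. f s) has_real_derivative f t) (at t within {0..T})"
proof -
  have eq: "integral {0..t} f = (LBINT s:{0..t}. f s)" if "t \<in> {0..T}" for t
    using set_borel_integral_eq_integral(2)[OF set_integrable_Icc[OF f, of t]] that by simp
  have "((\<lambda>t. integral {0..t} f) has_real_derivative f t) (at t within {0..T})"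
    by (rule integral_has_real_derivative[OF f t])
  then show ?thesis
    by (rule has_field_derivative_transform_within[OF _ zero_less_one t eq])
qed

text \<open>Differentiability is asked in the open interval, which is where the time derivative of
  the error is available; continuity handles the end points.\<close>

lemma LINT_Icc_FTC:
  fixes g f :: "real \<Rightarrow> real"
  assumes g: "continuous_on {0..T} g" and f: "continuous_on {0..T} f"
    and der: "\<And>t. t \<in> {0<..<T} \<Longrightarrow> (g has_real_derivative f t) (at t)" and t: "t \<in> {0..T}"
  shows "(LBINT s:{0..t}. f s) = g t - g 0"
proof -
  have "(f has_integral (g t - g 0)) {0..t}"
  proof (rule fundamental_theorem_of_calculus_interior)
    show "continuous_on {0..t} g" using g t continuous_on_subset by fastforce
    show "(g has_vector_derivative f s) (at s)" if "s \<in> {0<..<t}" for s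
      using der[of s] that t by (simp add: has_real_derivative_iff_has_vector_derivative)
  qed (use t in auto)
  then show ?thesis
    using set_borel_integral_eq_integral(2)[OF set_integrable_Icc[OF f, of t]] t
    by (simp add: integral_unique)
qed

lemma continuous_on_LINT_Icc:
  fixes f :: "real \<Rightarrow> real"
  assumes "continuous_on {0..T} f"
  shows "continuous_on {0..T} (\<lambda>t. LBINT s:{0..t}. f s)"
  using LINT_Icc_has_derivative[OF assms] by (intro DERIV_continuous_on) blast

text \<open>The integrand is the derivative of half the square of the primitive. For the gradient
  components this gives the sign of the diffusion term, for |V| the factor 1/2 in the reaction
  term.\<close>

lemma LINT_triangle:
  fixes g :: "real \<Rightarrow> real"
  assumes g: "continuous_on {0..T} g" and T: "0 \<le> T"
  shows "(LBINT t:{0..T}. g t * (LBINT s:{0..t}. g s)) = (LBINT t:{0..T}. g t)\<^sup>2 / 2"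
proof -
  let ?P = "\<lambda>t. LBINT s:{0..t}. g s"
  have P: "continuous_on {0..T} ?P" by (rule continuous_on_LINT_Icc[OF g])
  have "(LBINT t:{0..T}. g t * ?P t) = (?P T)\<^sup>2 / 2 - (?P 0)\<^sup>2 / 2"
  proof (rule LINT_Icc_FTC)
    show "continuous_on {0..T} (\<lambda>t. (?P t)\<^sup>2 / 2)" "continuous_on {0..T} (\<lambda>t. g t * ?P t)"
      by (intro continuous_intros P g; simp)+
    fix t assume t: "t \<in> {0<..<T}"
    have "(?P has_real_derivative g t) (at t within {0..T})"
      by (rule LINT_Icc_has_derivative[OF g]) (use t in auto)
    then have "(?P has_real_derivative g t) (at t)"
      using t by (simp add: at_within_Icc_at)
    then show "((\<lambda>t. (?P t)\<^sup>2 / 2) has_real_derivative g t * ?P t) (at t)"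
      by (auto intro!: derivative_eq_intros)
  qed (use T in auto)
  moreover have "?P 0 = 0"
    using LINT_Icc_FTC[of 0 "\<lambda>_. 0" g 0] by simp
  ultimately show ?thesis by simp
qed

text \<open>The substitution s = t r turns the variable upper limit into the fixed interval
  \<open>{0..1}\<close>, where continuity in a parameter applies.\<close>

lemma continuous_on_time_integral:
  fixes \<Phi> :: "'a::euclidean_space \<times> real \<Rightarrow> real"
  assumes \<Phi>: "continuous_on (K \<times> {0..T}) \<Phi>"
  shows "continuous_on (K \<times> {0..T}) (\<lambda>p. LBINT s:{0..snd p}. \<Phi> (fst p, s))"
proof -
  have c: "continuous_on ((K \<times> {0..T}) \<times> cbox 0 1) (\<lambda>(p, r). \<Phi> (fst p, snd p * r))"
    unfolding case_prod_beta'
  proof (rule continuous_on_compose2[OF \<Phi>])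
    show "continuous_on ((K \<times> {0..T}) \<times> cbox 0 1) (\<lambda>p. (fst (fst p), snd (fst p) * snd p))"
      by (intro continuous_intros)
    show "(\<lambda>p. (fst (fst p), snd (fst p) * snd p)) ` ((K \<times> {0..T}) \<times> cbox 0 1) \<subseteq> K \<times> {0..T}"
    proof safe
      fix x and t r :: real assume "t \<in> {0..T}" "r \<in> cbox 0 1"
      then have "0 \<le> t * r" "t * r \<le> t" "t \<le> T" by (auto intro!: mult_left_le)
      then show "snd (fst ((x, t), r)) * snd ((x, t), r) \<in> {0..T}" by simp
    qed auto
  qed
  have "continuous_on (K \<times> {0..T}) (\<lambda>p. snd p * integral (cbox 0 1) (\<lambda>r. \<Phi> (fst p, snd p * r)))"
    by (intro continuous_intros integral_continuous_on_param[OF c])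
  then show ?thesis
  proof (rule continuous_on_eq)
    fix p assume p: "p \<in> K \<times> {0..T}"
    obtain x t where pe: "p = (x, t)" by (cases p)
    have x: "x \<in> K" and t: "t \<in> {0..T}" using p pe by auto
    have cs: "continuous_on {0..1} (\<lambda>r. \<Phi> (x, t * r))"
    proof (rule continuous_on_compose2[OF \<Phi>])
      show "continuous_on {0..1} (\<lambda>r. (x, t * r))" by (intro continuous_intros)
      show "(\<lambda>r. (x, t * r)) ` {0..1} \<subseteq> K \<times> {0..T}"
      proof clarsimp
        fix r :: real assume "0 \<le> r" "r \<le> 1"
        then have "0 \<le> t * r" "t * r \<le> t" using t by (auto intro!: mult_left_le)
        then show "x \<in> K \<and> 0 \<le> t * r \<and> t * r \<le> T" using x t by auto
      qed
    qed
    have "(LBINT s:{0..t}. \<Phi> (x, s)) = t * (LBINT r:{0..1}. \<Phi> (x, t * r))"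
    proof (cases "t = 0")
      case True
      then show ?thesis
        using LINT_Icc_FTC[of 0 "\<lambda>_. 0" "\<lambda>s. \<Phi> (x, s)" 0] by simp
    next
      case False
      then have t0: "t > 0" using t by simp
      have "(LBINT s:{0..t}. \<Phi> (x, s)) = \<bar>t\<bar> *\<^sub>R (LINT r|lborel. indicator {0..t} (0 + t * r) *\<^sub>R \<Phi> (x, 0 + t * r))"
        unfolding set_lebesgue_integral_def by (rule lborel_integral_real_affine) (use t0 in simp)
      also have "\<dots> = t * (LBINT r:{0..1}. \<Phi> (x, t * r))"
        using t0 unfolding set_lebesgue_integral_def
        by (simp add: indicator_def mult_le_cancel_left1 zero_le_mult_iff)
      finally show ?thesis .
    qed
    also have "(LBINT r:{0..1}. \<Phi> (x, t * r)) = integral {0..1} (\<lambda>r. \<Phi> (x, t * r))"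
      by (rule set_borel_integral_eq_integral(2)[OF set_integrable_Icc[OF cs]]) simp
    finally show "snd p * integral (cbox 0 1) (\<lambda>r. \<Phi> (fst p, snd p * r)) = (LBINT s:{0..snd p}. \<Phi> (fst p, s))"
      by (simp add: pe)
  qed
qed

text \<open>Dominated convergence along sequences, with a constant majorant on a set of finite
  measure; \<open>M\<close> is general because both Lebesgue measure and \<open>\<sigma>\<close>
  occur.\<close>

lemma continuous_on_space_integral:
  fixes \<Phi> :: "'a::euclidean_space \<times> real \<Rightarrow> real"
  assumes K: "compact K" and \<Phi>: "continuous_on (K \<times> {0..T}) \<Phi>"
    and A: "A \<subseteq> K" "A \<in> sets borel" "sets M = sets borel" "emeasure M A < \<infinity>"
  shows "continuous_on {0..T} (\<lambda>t. LINT x:A|M. \<Phi> (x, t))"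
  unfolding continuous_on_sequentially
proof (intro allI ballI impI)
  fix \<tau> :: "nat \<Rightarrow> real" and t assume t: "t \<in> {0..T}" and "(\<forall>n. \<tau> n \<in> {0..T}) \<and> \<tau> \<longlonglongrightarrow> t"
  then have \<tau>: "\<And>n. \<tau> n \<in> {0..T}" "\<tau> \<longlonglongrightarrow> t" by auto
  have "compact (K \<times> {0..T})" using K by (intro compact_Times) auto
  from compact_bound[OF this \<Phi>] obtain B where B: "0 \<le> B" "\<And>p. p \<in> K \<times> {0..T} \<Longrightarrow> norm (\<Phi> p) \<le> B" by blast
  have int: "set_integrable M A (\<lambda>x. \<Phi> (x, t))" if "t \<in> {0..T}" for t
    by (rule set_integrable_continuous_compact[OF K continuous_on_slices(2)[OF \<Phi> that] A])
  have "(\<lambda>n. LINT x:A|M. \<Phi> (x, \<tau> n)) \<longlonglongrightarrow> (LINT x:A|M. \<Phi> (x, t))"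
    unfolding set_lebesgue_integral_def
  proof (rule integral_dominated_convergence[where w = "\<lambda>x. B * indicator A x"])
    show "(\<lambda>x. indicator A x *\<^sub>R \<Phi> (x, t)) \<in> borel_measurable M"
      "(\<lambda>x. indicator A x *\<^sub>R \<Phi> (x, \<tau> n)) \<in> borel_measurable M" for n
      using int[OF t] int[OF \<tau>(1)] by (auto simp: set_integrable_def)
    show "integrable M (\<lambda>x. B * indicator A x)"
      using A by (intro integrable_mult_right integrable_real_indicator) auto
    have "(\<lambda>n. \<Phi> (x, \<tau> n)) \<longlonglongrightarrow> \<Phi> (x, t)" if "x \<in> A" for x
      using continuous_on_slices(1)[OF \<Phi>, of x] that A(1) t \<tau> unfolding continuous_on_sequentially
      by (auto simp: comp_def)
    then show "AE x in M. (\<lambda>n. indicator A x *\<^sub>R \<Phi> (x, \<tau> n)) \<longlonglongrightarrow> indicator A x *\<^sub>R \<Phi> (x, t)"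
      by (auto simp: indicator_def)
    show "AE x in M. norm (indicator A x *\<^sub>R \<Phi> (x, \<tau> n)) \<le> B * indicator A x" for n
      using B(2) A(1) \<tau>(1) by (auto simp: indicator_def subset_iff)
  qed
  then show "((\<lambda>t. LINT x:A|M. \<Phi> (x, t)) \<circ> \<tau>) \<longlonglongrightarrow> (LINT x:A|M. \<Phi> (x, t))"
    by (simp add: comp_def)
qed

lemma set_integrable_cylinder:
  fixes \<Phi> :: "'a::euclidean_space \<times> real \<Rightarrow> real"
  assumes D: "open D" "bounded D" and \<Phi>: "continuous_on (closure D \<times> {0..T}) \<Phi>" and t: "t \<le> T"
  shows "set_integrable lborel (D \<times> {0..t}) \<Phi>"
proof (rule set_integrable_continuous_compact[OF _ \<Phi>])
  show "compact (closure D \<times> {0..T})" using D(2) by (intro compact_Times) auto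
  show "D \<times> {0..t} \<subseteq> closure D \<times> {0..T}"
    using t closure_subset by (intro Sigma_mono) auto
  show "D \<times> {0..t} \<in> sets borel" using D(1) by (intro borel_Times) auto
  show "emeasure lborel (D \<times> {0..t}) < \<infinity>"
    using D(2) by (intro emeasure_bounded_finite bounded_Times) auto
qed simp

lemma Fubini_cylinder:
  fixes \<Phi> :: "'a::euclidean_space \<times> real \<Rightarrow> real"
  assumes D: "open D" "bounded D" and \<Phi>: "continuous_on (closure D \<times> {0..T}) \<Phi>" and t: "t \<le> T"
  shows "(LBINT p:D \<times> {0..t}. \<Phi> p) = (LBINT x:D. LBINT s:{0..t}. \<Phi> (x, s))"
    and "(LBINT p:D \<times> {0..t}. \<Phi> p) = (LBINT s:{0..t}. LBINT x:D. \<Phi> (x, s))"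
proof -
  define F where "F p = indicator (D \<times> {0..t}) p *\<^sub>R \<Phi> p" for p
  have int: "integrable (lborel \<Otimes>\<^sub>M lborel) F"
    using set_integrable_cylinder[OF D \<Phi> t] by (simp add: set_integrable_def F_def[abs_def] lborel_prod)
  have "(LBINT p:D \<times> {0..t}. \<Phi> p) = integral\<^sup>L (lborel \<Otimes>\<^sub>M lborel) F"
    by (simp add: set_lebesgue_integral_def F_def[abs_def] lborel_prod)
  moreover have "integral\<^sup>L (lborel \<Otimes>\<^sub>M lborel) F = (LINT x|lborel. LINT s|lborel. F (x, s))"
    by (rule lborel_pair.integral_fst'[OF int, symmetric])
  moreover have "(LINT x|lborel. LINT s|lborel. F (x, s)) = (LINT s|lborel. LINT x|lborel. F (x, s))"
    by (rule lborel_pair.Fubini_integral[symmetric]) (use int in simp)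
  moreover have "(LINT x|lborel. LINT s|lborel. F (x, s)) = (LBINT x:D. LBINT s:{0..t}. \<Phi> (x, s))"
    unfolding set_lebesgue_integral_def
    by (rule Bochner_Integration.integral_cong) (auto simp: F_def indicator_times indicator_def)
  moreover have "(LINT s|lborel. LINT x|lborel. F (x, s)) = (LBINT s:{0..t}. LBINT x:D. \<Phi> (x, s))"
    unfolding set_lebesgue_integral_def
    by (rule Bochner_Integration.integral_cong) (auto simp: F_def indicator_times mult.commute indicator_def)
  ultimately show "(LBINT p:D \<times> {0..t}. \<Phi> p) = (LBINT x:D. LBINT s:{0..t}. \<Phi> (x, s))"
    and "(LBINT p:D \<times> {0..t}. \<Phi> p) = (LBINT s:{0..t}. LBINT x:D. \<Phi> (x, s))"
    by simp_all
qed

text \<open>Carries the equation, the boundary condition and the pointwise bounds from the open time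
  interval to its end points.\<close>

lemma le_on_Icc_if_le_on_Ioo:
  fixes f g :: "real \<Rightarrow> real"
  assumes "continuous_on {0..T} f" "continuous_on {0..T} g" "0 < T"
    and "\<And>t. t \<in> {0<..<T} \<Longrightarrow> f t \<le> g t" and "t \<in> {0..T}"
  shows "f t \<le> g t"
proof -
  have "closure {0<..<T} = {0..T}" using assms(3) by (simp add: closure_greaterThanLessThan)
  then have "continuous_on (closure {0<..<T}) (\<lambda>t. f t - g t)" "t \<in> closure {0<..<T}"
    using assms by (auto intro: continuous_intros)
  then have "f t - g t \<le> 0"
    by (rule continuous_le_on_closure) (use assms(4) in auto)
  then show ?thesis by simp
qed

lemma integral_Gronwall:
  fixes z :: "real \<Rightarrow> real"
  assumes z: "continuous_on {0..T} z" and T: "0 < T" and L: "0 < L"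
    and le: "\<And>t. t \<in> {0..T} \<Longrightarrow> z t \<le> M + L * (LBINT s:{0..t}. z s)"
  shows "(LBINT s:{0..T}. z s) \<le> M * (exp (L * T) - 1) / L"
proof -
  let ?Z = "\<lambda>t. LBINT s:{0..t}. z s"
  \<comment> \<open>Integrating factor: the derivative of \<open>h\<close> is
    \<open>exp (- L * t)\<close> times the difference of the two sides of the hypothesis.\<close>
  define h where "h t = exp (- L * t) * (?Z t + M / L)" for t
  have Z: "continuous_on {0..T} ?Z" by (rule continuous_on_LINT_Icc[OF z])
  have "h T \<le> h 0"
  proof (rule DERIV_nonpos_imp_decreasing_open[of 0 T h])
    show "continuous_on {0..T} h" unfolding h_def by (intro continuous_intros Z)
    fix t assume t: "0 < t" "t < T"
    have "(?Z has_real_derivative z t) (at t within {0..T})"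
      by (rule LINT_Icc_has_derivative[OF z]) (use t in auto)
    then have d: "(?Z has_real_derivative z t) (at t)"
      using t by (simp add: at_within_Icc_at)
    have "(h has_real_derivative exp (- L * t) * (z t - M - L * ?Z t)) (at t)"
      unfolding h_def using L by (auto intro!: derivative_eq_intros d simp: field_simps)
    moreover have "exp (- L * t) * (z t - M - L * ?Z t) \<le> 0"
      using le[of t] t by (intro mult_nonneg_nonpos) auto
    ultimately show "\<exists>y. (h has_real_derivative y) (at t) \<and> y \<le> 0" by blast
  qed (use T in simp)
  moreover have "?Z 0 = 0"
    using LINT_Icc_FTC[of 0 "\<lambda>_. 0" z 0] by simp
  ultimately have "exp (- L * T) * (?Z T + M / L) \<le> M / L" by (simp add: h_def)
  then have "exp (L * T) * (exp (- L * T) * (?Z T + M / L)) \<le> exp (L * T) * (M / L)"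
    by (intro mult_left_mono) auto
  moreover have "exp (L * T) * (exp (- L * T) * x) = x" for x
    using exp_add[of "L * T" "- L * T"] by (simp add: mult.assoc[symmetric])
  ultimately have "?Z T + M / L \<le> exp (L * T) * (M / L)" by (simp only:)
  then show ?thesis by (simp add: right_diff_distrib diff_divide_distrib mult.commute)
qed

section \<open>Energy estimates\<close>

text \<open>\<open>U\<close> stands for the error V, \<open>F\<close> for the difference of the
  reaction terms, \<open>R\<close> for the interior residual. \<open>Ut\<close>, \<open>Gr\<close>
  and \<open>Hs\<close> are continuous extensions of derivatives and are linked to \<open>U\<close>
  in the open cylinder only, as the class C^k provides; \<open>G\<close> bounds the full gradient on
  the lateral boundary.\<close>

locale heat_energy =
  fixes D :: "'a::euclidean_space set" and \<sigma> :: "'a measure" and T Cf G :: real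
    and U Ut F R :: "'a \<times> real \<Rightarrow> real" and Gr Hs :: "'a \<Rightarrow> 'a \<times> real \<Rightarrow> real"
  assumes D: "open D" "bounded D" "Ck_boundary 1 D" and \<sigma>: "surface_measure D \<sigma>"
    and T: "T > 0" and Cf: "Cf \<ge> 0" and G: "G \<ge> 0"
    and U: "continuous_on (closure D \<times> {0..T}) U" and Ut: "continuous_on (closure D \<times> {0..T}) Ut"
    and F: "continuous_on (closure D \<times> {0..T}) F" and R: "continuous_on (closure D \<times> {0..T}) R"
    and Gr: "\<And>b. b \<in> Basis \<Longrightarrow> continuous_on (closure D \<times> {0..T}) (Gr b)"
    and Hs: "\<And>b. b \<in> Basis \<Longrightarrow> continuous_on (closure D \<times> {0..T}) (Hs b)"
    and der_t: "\<And>x t. x \<in> D \<Longrightarrow> t \<in> {0<..<T} \<Longrightarrow> ((\<lambda>s. U (x, s)) has_real_derivative Ut (x, t)) (at t)"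
    and der_x: "\<And>x t b. x \<in> D \<Longrightarrow> t \<in> {0<..<T} \<Longrightarrow> b \<in> Basis \<Longrightarrow>
        ((\<lambda>h. U (x + h *\<^sub>R b, t)) has_real_derivative Gr b (x, t)) (at 0)"
    and der_xx: "\<And>x t b. x \<in> D \<Longrightarrow> t \<in> {0<..<T} \<Longrightarrow> b \<in> Basis \<Longrightarrow>
        ((\<lambda>h. Gr b (x + h *\<^sub>R b, t)) has_real_derivative Hs b (x, t)) (at 0)"
    and eq0: "\<And>x t. x \<in> D \<Longrightarrow> t \<in> {0<..<T} \<Longrightarrow> Ut (x, t) = (\<Sum>b\<in>Basis. Hs b (x, t)) + F (x, t) + R (x, t)"
    and F_le0: "\<And>x t. x \<in> D \<Longrightarrow> t \<in> {0<..<T} \<Longrightarrow> \<bar>F (x, t)\<bar> \<le> Cf * \<bar>U (x, t)\<bar>"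
    and Gr_le: "\<And>x t. x \<in> frontier D \<Longrightarrow> t \<in> {0..T} \<Longrightarrow> sqrt (\<Sum>b\<in>Basis. (Gr b (x, t))\<^sup>2) \<le> G"
begin

abbreviation "K \<equiv> closure D"

definition lap where "lap p = (\<Sum>b\<in>Basis. Hs b p)"
definition boundary_L1 where "boundary_L1 t = (LINT x:frontier D|\<sigma>. \<bar>U (x, t)\<bar>)"
definition energy where "energy = (LBINT p:D \<times> {0..T}. (U p)\<^sup>2)"
definition initial_norm where "initial_norm = sqrt (LBINT x:D. (U (x, 0))\<^sup>2)"
definition source_norm where "source_norm = sqrt (LBINT p:D \<times> {0..T}. (R p)\<^sup>2)"
text \<open>The quantity c^2: once \<open>G\<close> is the sum of the two C^1 norms,
  \<open>G * sqrt (measure \<sigma> (frontier D))\<close> is \<open>const_bdry\<close>.\<close>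

definition boundary_term where "boundary_term = G * sqrt (measure \<sigma> (frontier D)) * sqrt T *
  sqrt (LBINT t:{0..T}. LINT x:frontier D|\<sigma>. (U (x, t))\<^sup>2)"

lemma cont_lap: "continuous_on (K \<times> {0..T}) lap"
  unfolding lap_def by (intro continuous_intros Hs)

lemma compact_K: "compact K" using D(2) by simp
lemma D_subset_K: "x \<in> D \<Longrightarrow> x \<in> K" using closure_subset by blast
lemma frontier_subset_K: "frontier D \<subseteq> K" by (simp add: frontier_def Diff_subset)
lemma sets_\<sigma>: "sets \<sigma> = sets borel" using \<sigma> by (simp add: surface_measure_def)
lemmas fin_\<sigma> = emeasure_frontier_finite[OF \<sigma> D(2,3)]
lemmas slices = continuous_on_slices

lemma int_\<sigma>: "continuous_on K f \<Longrightarrow> set_integrable \<sigma> (frontier D) f" for f :: "'a \<Rightarrow> real"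
  by (rule set_integrable_continuous_compact[OF compact_K _ frontier_subset_K _ sets_\<sigma> fin_\<sigma>]) auto

lemma int_D: "continuous_on K f \<Longrightarrow> set_integrable lborel D f" for f :: "'a \<Rightarrow> real"
  by (rule set_integrable_lborel_continuous[OF D(1,2)])

lemma cont_boundary_L1: "continuous_on {0..T} boundary_L1"
  unfolding boundary_L1_def
  by (rule continuous_on_space_integral[OF compact_K _ frontier_subset_K _ sets_\<sigma> fin_\<sigma>]) (auto intro!: continuous_intros U)

lemma cont_LINT_D:
  "continuous_on (K \<times> {0..T}) \<Phi> \<Longrightarrow> continuous_on {0..T} (\<lambda>t. LBINT x:D. \<Phi> (x, t))"
  for \<Phi> :: "'a \<times> real \<Rightarrow> real"
  by (rule continuous_on_space_integral[OF compact_K _ closure_subset])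
     (use D in \<open>auto intro: emeasure_bounded_finite[unfolded infinity_ennreal_def]\<close>)

lemma boundary_L1_nonneg: "0 \<le> boundary_L1 t"
  unfolding boundary_L1_def set_lebesgue_integral_def by (intro Bochner_Integration.integral_nonneg) auto

lemma cont_t: "continuous_on (K \<times> {0..T}) \<Phi> \<Longrightarrow> x \<in> D \<Longrightarrow> continuous_on {0..T} (\<lambda>t. \<Phi> (x, t))"
  for \<Phi> :: "'a \<times> real \<Rightarrow> real"
  by (rule slices(1)[of K]) (auto intro: D_subset_K)

lemma equation: "x \<in> D \<Longrightarrow> t \<in> {0..T} \<Longrightarrow> Ut (x, t) = lap (x, t) + F (x, t) + R (x, t)"
proof (rule antisym)
  assume x: "x \<in> D" and t: "t \<in> {0..T}"
  have c: "continuous_on {0..T} (\<lambda>t. Ut (x, t))" "continuous_on {0..T} (\<lambda>t. lap (x, t) + F (x, t) + R (x, t))"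
    by (intro continuous_intros cont_t[OF _ x] cont_lap Ut F R)+
  show "Ut (x, t) \<le> lap (x, t) + F (x, t) + R (x, t)"
    by (rule le_on_Icc_if_le_on_Ioo[OF c T _ t]) (simp add: eq0[OF x] lap_def)
  show "lap (x, t) + F (x, t) + R (x, t) \<le> Ut (x, t)"
    by (rule le_on_Icc_if_le_on_Ioo[OF c(2,1) T _ t]) (simp add: eq0[OF x] lap_def)
qed

lemma F_le: "x \<in> D \<Longrightarrow> t \<in> {0..T} \<Longrightarrow> \<bar>F (x, t)\<bar> \<le> Cf * \<bar>U (x, t)\<bar>"
  by (rule le_on_Icc_if_le_on_Ioo[of T "\<lambda>t. \<bar>F (x, t)\<bar>" "\<lambda>t. Cf * \<bar>U (x, t)\<bar>"])
     (auto intro!: continuous_intros cont_t T F_le0 F U)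

text \<open>The times \<open>t\<close> and \<open>s\<close> are independent, since integrating the
  equation in time first pairs V(t) with the Laplacian of V(s). The gradient at time
  \<open>s\<close> is bounded by \<open>G\<close> on the boundary.\<close>

lemma green_open:
  assumes t: "t \<in> {0<..<T}" and s: "s \<in> {0<..<T}"
  shows "(LBINT x:D. U (x, t) * lap (x, s) + (\<Sum>b\<in>Basis. Gr b (x, t) * Gr b (x, s))) \<le> G * boundary_L1 t"
proof -
  have t': "t \<in> {0..T}" and s': "s \<in> {0..T}" using t s by auto
  have "(LBINT x:D. U (x, t) * lap (x, s) + (\<Sum>b\<in>Basis. Gr b (x, t) * Gr b (x, s)))
    \<le> (LINT x:frontier D|\<sigma>. \<bar>U (x, t)\<bar> * sqrt (\<Sum>b\<in>Basis. (Gr b (x, s))\<^sup>2))"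
    unfolding lap_def
    by (rule green_le[OF D \<sigma>])
       (intro slices(2)[OF U t'] slices(2)[OF Gr t'] slices(2)[OF Gr s'] slices(2)[OF Hs s'] der_x[OF _ t] der_xx[OF _ s]; assumption)+
  also have "\<dots> \<le> (LINT x:frontier D|\<sigma>. G * \<bar>U (x, t)\<bar>)"
  proof (rule set_integral_mono)
    show "set_integrable \<sigma> (frontier D) (\<lambda>x. \<bar>U (x, t)\<bar> * sqrt (\<Sum>b\<in>Basis. (Gr b (x, s))\<^sup>2))"
      "set_integrable \<sigma> (frontier D) (\<lambda>x. G * \<bar>U (x, t)\<bar>)"
      by (intro int_\<sigma> continuous_intros slices(2)[OF U t'] slices(2)[OF Gr s']; assumption)+
    show "\<bar>U (x, t)\<bar> * sqrt (\<Sum>b\<in>Basis. (Gr b (x, s))\<^sup>2) \<le> G * \<bar>U (x, t)\<bar>" if "x \<in> frontier D" for x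
      using mult_left_mono[OF Gr_le[OF that s'], of "\<bar>U (x, t)\<bar>"] by (simp add: mult.commute)
  qed
  also have "\<dots> = G * boundary_L1 t" by (simp add: boundary_L1_def)
  finally show ?thesis .
qed

text \<open>Both sides are continuous in each time, so the bound extends to the closed interval
  first in \<open>s\<close>, then in \<open>t\<close>.\<close>

lemma green:
  assumes t: "t \<in> {0..T}" and s: "s \<in> {0..T}"
  shows "(LBINT x:D. U (x, t) * lap (x, s) + (\<Sum>b\<in>Basis. Gr b (x, t) * Gr b (x, s))) \<le> G * boundary_L1 t"
proof -
  have fst: "continuous_on (K \<times> {0..T}) (\<lambda>p. \<Phi> (fst p, t))"
    if "continuous_on (K \<times> {0..T}) \<Phi>" "t \<in> {0..T}" for \<Phi> :: "'a \<times> real \<Rightarrow> real" and t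
    by (rule continuous_on_compose2[OF that(1)]) (use that(2) in \<open>auto intro!: continuous_intros\<close>)
  have 1: "(LBINT x:D. U (x, t) * lap (x, s) + (\<Sum>b\<in>Basis. Gr b (x, t) * Gr b (x, s))) \<le> G * boundary_L1 t"
    if t: "t \<in> {0<..<T}" for t
  proof (rule le_on_Icc_if_le_on_Ioo[OF _ _ T green_open[OF t] s])
    have t': "t \<in> {0..T}" using t by auto
    have "continuous_on (K \<times> {0..T}) (\<lambda>p. U (fst p, t) * lap p + (\<Sum>b\<in>Basis. Gr b (fst p, t) * Gr b p))"
      by (intro continuous_intros fst[OF U t'] cont_lap fst[OF Gr t'] Gr; assumption)
    from cont_LINT_D[OF this]
    show "continuous_on {0..T} (\<lambda>s. LBINT x:D. U (x, t) * lap (x, s) + (\<Sum>b\<in>Basis. Gr b (x, t) * Gr b (x, s)))"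
      by simp
  qed auto
  show ?thesis
  proof (rule le_on_Icc_if_le_on_Ioo[OF _ _ T 1 t])
    have "continuous_on (K \<times> {0..T}) (\<lambda>p. U p * lap (fst p, s) + (\<Sum>b\<in>Basis. Gr b p * Gr b (fst p, s)))"
      by (intro continuous_intros U fst[OF cont_lap s] fst[OF Gr s] Gr; assumption)
    from cont_LINT_D[OF this]
    show "continuous_on {0..T} (\<lambda>t. LBINT x:D. U (x, t) * lap (x, s) + (\<Sum>b\<in>Basis. Gr b (x, t) * Gr b (x, s)))"
      by simp
  qed (auto intro!: continuous_intros cont_boundary_L1)
qed

lemma energy_nonneg: "0 \<le> energy" and initial_norm_nonneg: "0 \<le> initial_norm" and source_norm_nonneg: "0 \<le> source_norm" and boundary_term_nonneg: "0 \<le> boundary_term"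
proof -
  show "0 \<le> energy" unfolding energy_def set_lebesgue_integral_def by (intro Bochner_Integration.integral_nonneg) auto
  have *: "0 \<le> (LBINT x:D. (U (x, 0))\<^sup>2)" "0 \<le> (LBINT p:D \<times> {0..T}. (R p)\<^sup>2)"
    unfolding set_lebesgue_integral_def by (intro Bochner_Integration.integral_nonneg; simp)+
  then show "0 \<le> initial_norm" "0 \<le> source_norm" by (auto simp: initial_norm_def source_norm_def)
  have "0 \<le> (LBINT t:{0..T}. LINT x:frontier D|\<sigma>. (U (x, t))\<^sup>2)"
    unfolding set_lebesgue_integral_def by (intro Bochner_Integration.integral_nonneg) (simp add: Bochner_Integration.integral_nonneg)
  then show "0 \<le> boundary_term" using G T by (simp add: boundary_term_def)
qed

lemma initial_norm_sq: "initial_norm\<^sup>2 = (LBINT x:D. (U (x, 0))\<^sup>2)" and source_norm_sq: "source_norm\<^sup>2 = (LBINT p:D \<times> {0..T}. (R p)\<^sup>2)"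
  unfolding initial_norm_def source_norm_def by (simp_all add: set_lebesgue_integral_def Bochner_Integration.integral_nonneg)

text \<open>Cauchy-Schwarz against the constant 1, once on the boundary and once in time; these
  yield the factors \<open>sqrt (measure \<sigma> (frontier D))\<close> and
  \<open>sqrt T\<close>.\<close>

lemma boundary_le: "G * (LBINT t:{0..T}. boundary_L1 t) \<le> boundary_term"
proof -
  let ?S = "\<lambda>t. LINT x:frontier D|\<sigma>. (U (x, t))\<^sup>2"
  have cS: "continuous_on {0..T} ?S"
    by (rule continuous_on_space_integral[OF compact_K _ frontier_subset_K _ sets_\<sigma> fin_\<sigma>]) (auto intro!: continuous_intros U)
  have S0: "0 \<le> ?S t" for t
    unfolding set_lebesgue_integral_def by (intro Bochner_Integration.integral_nonneg) auto
  have m1: "(LINT x:frontier D|\<sigma>. 1) = measure \<sigma> (frontier D)"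
    using fin_\<sigma> by (simp add: set_lebesgue_integral_def sets_\<sigma>)
  have "boundary_L1 t \<le> sqrt (measure \<sigma> (frontier D)) * sqrt (?S t)" if t: "t \<in> {0..T}" for t
  proof -
    have "(LINT x:frontier D|\<sigma>. 1 * \<bar>U (x, t)\<bar>) \<le> sqrt (LINT x:frontier D|\<sigma>. 1\<^sup>2) * sqrt (LINT x:frontier D|\<sigma>. \<bar>U (x, t)\<bar>\<^sup>2)"
      by (intro set_integral_Cauchy_Schwarz int_\<sigma> continuous_intros slices(2)[OF U t])
    then show ?thesis by (simp add: boundary_L1_def m1)
  qed
  then have "(LBINT t:{0..T}. boundary_L1 t) \<le> (LBINT t:{0..T}. sqrt (measure \<sigma> (frontier D)) * sqrt (?S t))"
    by (intro set_integral_mono set_integrable_Icc[of T] continuous_intros cont_boundary_L1 cS) auto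
  also have "\<dots> = sqrt (measure \<sigma> (frontier D)) * (LBINT t:{0..T}. 1 * sqrt (?S t))"
    by simp
  also have "\<dots> \<le> sqrt (measure \<sigma> (frontier D)) * (sqrt (LBINT t:{0..T}. 1\<^sup>2) * sqrt (LBINT t:{0..T}. (sqrt (?S t))\<^sup>2))"
    by (intro mult_left_mono set_integral_Cauchy_Schwarz set_integrable_Icc[of T] continuous_intros cS) auto
  also have "\<dots> = sqrt (measure \<sigma> (frontier D)) * (sqrt T * sqrt (LBINT t:{0..T}. ?S t))"
    using T S0 by (simp add: set_lebesgue_integral_def)
  finally have "G * (LBINT t:{0..T}. boundary_L1 t) \<le> G * (sqrt (measure \<sigma> (frontier D)) * (sqrt T * sqrt (LBINT t:{0..T}. ?S t)))"
    by (rule mult_left_mono[OF _ G])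
  then show ?thesis by (simp add: boundary_term_def mult.assoc)
qed

text \<open>The rate 1 + 2 Cf collects 2 V F \<le> 2 Cf V^2 and 2 V R \<le> V^2 + R^2. Green's
  inequality at equal times leaves twice the boundary term and a gradient square with the good
  sign.\<close>

lemma energy_Gronwall: "energy \<le> (initial_norm\<^sup>2 + source_norm\<^sup>2 + 2 * boundary_term) * (exp ((1 + 2 * Cf) * T) - 1) / (1 + 2 * Cf)"
proof -
  let ?z = "\<lambda>t. LBINT x:D. (U (x, t))\<^sup>2"
  have cU2: "continuous_on (K \<times> {0..T}) (\<lambda>p. (U p)\<^sup>2)" by (intro continuous_intros U)
  have cR2: "continuous_on (K \<times> {0..T}) (\<lambda>p. (R p)\<^sup>2)" by (intro continuous_intros R)
  have cUU: "continuous_on (K \<times> {0..T}) (\<lambda>p. 2 * U p * Ut p)" by (intro continuous_intros U Ut)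
  note cz = cont_LINT_D[OF cU2] and cr = cont_LINT_D[OF cR2] and cuu = cont_LINT_D[OF cUU]
  have "?z t \<le> (initial_norm\<^sup>2 + source_norm\<^sup>2 + 2 * boundary_term) + (1 + 2 * Cf) * (LBINT s:{0..t}. ?z s)" if t: "t \<in> {0..T}" for t
  proof -
    have "?z t - initial_norm\<^sup>2 = (LBINT x:D. (U (x, t))\<^sup>2 - (U (x, 0))\<^sup>2)"
      unfolding initial_norm_sq
      by (rule set_integral_diff(2)[symmetric]; intro int_D slices(2)[OF cU2]) (use t T in auto)
    also have "\<dots> = (LBINT x:D. LBINT s:{0..t}. 2 * U (x, s) * Ut (x, s))"
    proof (rule set_lebesgue_integral_cong)
      show "D \<in> sets lborel" using D(1) by simp
      show "\<forall>x. x \<in> D \<longrightarrow> (U (x, t))\<^sup>2 - (U (x, 0))\<^sup>2 = (LBINT s:{0..t}. 2 * U (x, s) * Ut (x, s))"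
      proof (intro allI impI)
        fix x assume x: "x \<in> D"
        show "(U (x, t))\<^sup>2 - (U (x, 0))\<^sup>2 = (LBINT s:{0..t}. 2 * U (x, s) * Ut (x, s))"
          by (rule LINT_Icc_FTC[OF cont_t[OF cU2 x] cont_t[OF cUU x] _ t, symmetric])
             (use DERIV_power[OF der_t[OF x], of _ 2] in \<open>simp add: mult_ac\<close>)
      qed
    qed
    also have "\<dots> = (LBINT s:{0..t}. LBINT x:D. 2 * U (x, s) * Ut (x, s))"
      using Fubini_cylinder[OF D(1,2) cUU, of t] t by simp
    also have "\<dots> \<le> (LBINT s:{0..t}. 2 * G * boundary_L1 s + (1 + 2 * Cf) * ?z s + (LBINT x:D. (R (x, s))\<^sup>2))"
    proof (rule set_integral_mono)
      show "set_integrable lborel {0..t} (\<lambda>s. LBINT x:D. 2 * U (x, s) * Ut (x, s))"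
        "set_integrable lborel {0..t} (\<lambda>s. 2 * G * boundary_L1 s + (1 + 2 * Cf) * ?z s + (LBINT x:D. (R (x, s))\<^sup>2))"
        using t by (intro set_integrable_Icc[of T] continuous_intros cuu cont_boundary_L1 cz cr; simp)+
      fix s assume "s \<in> {0..t}"
      then have s: "s \<in> {0..T}" using t by auto
      have cGG: "continuous_on K (\<lambda>x. U (x, s) * lap (x, s) + (\<Sum>b\<in>Basis. Gr b (x, s) * Gr b (x, s)))"
        by (intro continuous_intros slices(2)[OF U s] slices(2)[OF cont_lap s] slices(2)[OF Gr s])
      have "(LBINT x:D. 2 * U (x, s) * Ut (x, s)) \<le>
          (LBINT x:D. 2 * (U (x, s) * lap (x, s) + (\<Sum>b\<in>Basis. Gr b (x, s) * Gr b (x, s)))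
             + ((1 + 2 * Cf) * (U (x, s))\<^sup>2 + (R (x, s))\<^sup>2))"
      proof (rule set_integral_mono)
        show "set_integrable lborel D (\<lambda>x. 2 * U (x, s) * Ut (x, s))"
          by (intro int_D slices(2)[OF cUU s])
        show "set_integrable lborel D (\<lambda>x. 2 * (U (x, s) * lap (x, s) + (\<Sum>b\<in>Basis. Gr b (x, s) * Gr b (x, s)))
             + ((1 + 2 * Cf) * (U (x, s))\<^sup>2 + (R (x, s))\<^sup>2))"
          by (intro int_D continuous_intros cGG slices(2)[OF U s] slices(2)[OF R s])
        fix x assume x: "x \<in> D"
        have "2 * U (x, s) * F (x, s) \<le> 2 * (\<bar>U (x, s)\<bar> * \<bar>F (x, s)\<bar>)"
          using abs_ge_self[of "U (x, s) * F (x, s)"] by (simp add: abs_mult)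
        also have "\<dots> \<le> 2 * (\<bar>U (x, s)\<bar> * (Cf * \<bar>U (x, s)\<bar>))"
          by (intro mult_left_mono F_le[OF x s]) auto
        also have "\<dots> = 2 * Cf * (U (x, s))\<^sup>2" by (simp add: power2_eq_square abs_mult[symmetric])
        finally have "2 * U (x, s) * F (x, s) \<le> 2 * Cf * (U (x, s))\<^sup>2" .
        moreover have "2 * U (x, s) * R (x, s) \<le> (U (x, s))\<^sup>2 + (R (x, s))\<^sup>2"
          using sum_squares_bound[of "U (x, s)" "R (x, s)"] by simp
        moreover have "0 \<le> (\<Sum>b\<in>Basis. Gr b (x, s) * Gr b (x, s))"
          by (intro sum_nonneg) simp
        ultimately show "2 * U (x, s) * Ut (x, s) \<le> 2 * (U (x, s) * lap (x, s) + (\<Sum>b\<in>Basis. Gr b (x, s) * Gr b (x, s)))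
             + ((1 + 2 * Cf) * (U (x, s))\<^sup>2 + (R (x, s))\<^sup>2)"
          by (simp add: equation[OF x s] algebra_simps)
      qed
      also have "\<dots> = 2 * (LBINT x:D. U (x, s) * lap (x, s) + (\<Sum>b\<in>Basis. Gr b (x, s) * Gr b (x, s)))
          + ((1 + 2 * Cf) * ?z s + (LBINT x:D. (R (x, s))\<^sup>2))"
      proof -
        have i: "set_integrable lborel D (\<lambda>x. 2 * (U (x, s) * lap (x, s) + (\<Sum>b\<in>Basis. Gr b (x, s) * Gr b (x, s))))"
          "set_integrable lborel D (\<lambda>x. (1 + 2 * Cf) * (U (x, s))\<^sup>2)" "set_integrable lborel D (\<lambda>x. (R (x, s))\<^sup>2)"
          by (intro int_D continuous_intros cGG slices(2)[OF U s] slices(2)[OF R s])+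
        show ?thesis
          unfolding set_integral_add(2)[OF i(1) set_integral_add(1)[OF i(2,3)]] set_integral_add(2)[OF i(2,3)]
            set_integral_mult_right ..
      qed
      also have "\<dots> \<le> 2 * G * boundary_L1 s + (1 + 2 * Cf) * ?z s + (LBINT x:D. (R (x, s))\<^sup>2)"
        using green[OF s s] by simp
      finally show "(LBINT x:D. 2 * U (x, s) * Ut (x, s)) \<le> 2 * G * boundary_L1 s + (1 + 2 * Cf) * ?z s + (LBINT x:D. (R (x, s))\<^sup>2)" .
    qed
    also have "\<dots> = 2 * (G * (LBINT s:{0..t}. boundary_L1 s)) + (1 + 2 * Cf) * (LBINT s:{0..t}. ?z s)
        + (LBINT s:{0..t}. LBINT x:D. (R (x, s))\<^sup>2)"
    proof -
      have i: "set_integrable lborel {0..t} (\<lambda>s. 2 * G * boundary_L1 s)" "set_integrable lborel {0..t} (\<lambda>s. (1 + 2 * Cf) * ?z s)"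
        "set_integrable lborel {0..t} (\<lambda>s. LBINT x:D. (R (x, s))\<^sup>2)"
        using t by (intro set_integrable_Icc[of T] continuous_intros cont_boundary_L1 cz cr; simp)+
      show ?thesis
        by (simp add: set_integral_add(2)[OF set_integral_add(1)[OF i(1,2)] i(3)] set_integral_add(2)[OF i(1,2)])
    qed
    also have "\<dots> \<le> 2 * boundary_term + (1 + 2 * Cf) * (LBINT s:{0..t}. ?z s) + source_norm\<^sup>2"
    proof -
      \<comment> \<open>The data terms are enlarged from \<open>{0..t}\<close> to
        \<open>{0..T}\<close>, so that the inhomogeneity in Gronwall's inequality is a
        constant.\<close>
      have mono: "(LBINT s:{0..t}. g s) \<le> (LBINT s:{0..T}. g s)"
        if g: "continuous_on {0..T} g" "\<And>s. 0 \<le> g s" for g :: "real \<Rightarrow> real"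
        using set_integrable_Icc[OF g(1), of t] set_integrable_Icc[OF g(1), of T] t g(2)
        unfolding set_lebesgue_integral_def set_integrable_def
        by (intro integral_mono) (auto simp: indicator_def)
      have "G * (LBINT s:{0..t}. boundary_L1 s) \<le> boundary_term"
        using mult_left_mono[OF mono[OF cont_boundary_L1 boundary_L1_nonneg] G] boundary_le by linarith
      moreover have "(LBINT s:{0..t}. LBINT x:D. (R (x, s))\<^sup>2) \<le> source_norm\<^sup>2"
      proof -
        have "source_norm\<^sup>2 = (LBINT s:{0..T}. LBINT x:D. (R (x, s))\<^sup>2)"
          unfolding source_norm_sq by (rule Fubini_cylinder(2)[OF D(1,2) cR2]) simp
        moreover have "0 \<le> (LBINT x:D. (R (x, s))\<^sup>2)" for s
          unfolding set_lebesgue_integral_def by (intro Bochner_Integration.integral_nonneg) auto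
        ultimately show ?thesis using mono[OF cr] by simp
      qed
      ultimately show ?thesis by simp
    qed
    finally show ?thesis by simp
  qed
  then have "(LBINT s:{0..T}. ?z s) \<le> (initial_norm\<^sup>2 + source_norm\<^sup>2 + 2 * boundary_term) * (exp ((1 + 2 * Cf) * T) - 1) / (1 + 2 * Cf)"
    using Cf by (intro integral_Gronwall[OF cz T]) auto
  moreover have "energy = (LBINT s:{0..T}. ?z s)"
    unfolding energy_def by (rule Fubini_cylinder(2)[OF D(1,2) cU2]) simp
  ultimately show ?thesis by simp
qed

section \<open>The estimate obtained by integrating in time first\<close>

definition time_int where "time_int \<Phi> p = (LBINT s:{0..snd p}. \<Phi> (fst p, s))"
  for \<Phi> :: "'a \<times> real \<Rightarrow> real" and p :: "'a \<times> real"

lemma cont_time_int: "continuous_on (K \<times> {0..T}) \<Phi> \<Longrightarrow> continuous_on (K \<times> {0..T}) (time_int \<Phi>)"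
  unfolding time_int_def by (rule continuous_on_time_integral)

lemma int_E: "continuous_on (K \<times> {0..T}) \<Phi> \<Longrightarrow> set_integrable lborel (D \<times> {0..T}) \<Phi>"
  for \<Phi> :: "'a \<times> real \<Rightarrow> real"
  by (rule set_integrable_cylinder[OF D(1,2) _ order_refl])

lemmas Fubini = Fubini_cylinder[OF D(1,2) _ order_refl]

text \<open>The fundamental theorem of calculus expresses V(x,t) - V(x,0) by the time integrals of
  the three terms of the equation; the identity is then multiplied by V(x,t).\<close>

lemma U_expansion:
  assumes p: "p \<in> D \<times> {0..T}"
  shows "(U p)\<^sup>2 = U p * U (fst p, 0) + U p * time_int lap p + U p * time_int F p + U p * time_int R p"
proof -
  obtain x t where pe: "p = (x, t)" by (cases p)
  have x: "x \<in> D" and t: "t \<in> {0..T}" using p pe by auto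
  note c = cont_t[OF _ x]
  have "U (x, t) - U (x, 0) = (LBINT s:{0..t}. Ut (x, s))"
    by (rule LINT_Icc_FTC[OF c[OF U] c[OF Ut] der_t[OF x] t, symmetric])
  also have "\<dots> = (LBINT s:{0..t}. lap (x, s) + F (x, s) + R (x, s))"
    by (rule set_lebesgue_integral_cong) (use t equation[OF x] in auto)
  also have "\<dots> = time_int lap p + time_int F p + time_int R p"
    using t by (subst LINT_sum_add; (intro set_integrable_Icc[of T] c cont_lap F R)?) (auto simp: time_int_def pe)
  finally have "U p = U (fst p, 0) + time_int lap p + time_int F p + time_int R p" by (simp add: pe)
  then have "U p * U p = U p * (U (fst p, 0) + time_int lap p + time_int F p + time_int R p)" by (rule arg_cong)
  then show ?thesis by (simp add: power2_eq_square algebra_simps)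
qed

lemma initial_le: "(LBINT p:D \<times> {0..T}. U p * U (fst p, 0)) \<le> sqrt energy * (sqrt T * initial_norm)"
proof -
  have c0: "continuous_on (K \<times> {0..T}) (\<lambda>p. U (fst p, 0))"
    by (rule continuous_on_compose2[OF U]) (use T in \<open>auto intro!: continuous_intros\<close>)
  have "(LBINT p:D \<times> {0..T}. U p * U (fst p, 0)) \<le>
      sqrt energy * sqrt (LBINT p:D \<times> {0..T}. (U (fst p, 0))\<^sup>2)"
    unfolding energy_def by (intro set_integral_Cauchy_Schwarz int_E continuous_intros U c0)
  also have "(LBINT p:D \<times> {0..T}. (U (fst p, 0))\<^sup>2) = T * initial_norm\<^sup>2"
  proof -
    have "continuous_on (K \<times> {0..T}) (\<lambda>p. (U (fst p, 0))\<^sup>2)" by (intro continuous_intros c0)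
    from Fubini(2)[OF this] T show ?thesis by (simp add: initial_norm_sq set_lebesgue_integral_def)
  qed
  finally show ?thesis using initial_norm_nonneg by (simp add: real_sqrt_mult)
qed

text \<open>For fixed \<open>x\<close>, Cauchy-Schwarz in time bounds the squared integral of R over
  \<open>{0..t}\<close> by T times the integral of R^2 over \<open>{0..T}\<close>; integrating in
  \<open>t\<close> adds another factor T.\<close>

lemma source_le: "(LBINT p:D \<times> {0..T}. U p * time_int R p) \<le> sqrt energy * (T * source_norm)"
proof -
  have cR2: "continuous_on (K \<times> {0..T}) (\<lambda>p. (R p)\<^sup>2)" by (intro continuous_intros R)
  have cP2: "continuous_on (K \<times> {0..T}) (\<lambda>p. (time_int R p)\<^sup>2)" by (intro continuous_intros cont_time_int R)
  have "(LBINT p:D \<times> {0..T}. (time_int R p)\<^sup>2) = (LBINT x:D. LBINT t:{0..T}. (time_int R (x, t))\<^sup>2)"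
    by (rule Fubini(1)[OF cP2])
  also have "\<dots> \<le> (LBINT x:D. T\<^sup>2 * (LBINT s:{0..T}. (R (x, s))\<^sup>2))"
  proof (rule set_integral_mono)
    have "continuous_on K (\<lambda>x. time_int (\<lambda>p. (time_int R p)\<^sup>2) (x, T))" "continuous_on K (\<lambda>x. time_int (\<lambda>p. (R p)\<^sup>2) (x, T))"
      by (intro slices(2)[OF cont_time_int[OF cP2]] slices(2)[OF cont_time_int[OF cR2]]; use T in simp)+
    then have c: "continuous_on K (\<lambda>x. LBINT t:{0..T}. (time_int R (x, t))\<^sup>2)"
        "continuous_on K (\<lambda>x. LBINT s:{0..T}. (R (x, s))\<^sup>2)"
      by (simp_all add: time_int_def)
    show "set_integrable lborel D (\<lambda>x. LBINT t:{0..T}. (time_int R (x, t))\<^sup>2)"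
      "set_integrable lborel D (\<lambda>x. T\<^sup>2 * (LBINT s:{0..T}. (R (x, s))\<^sup>2))"
      by (intro int_D continuous_intros c)+
    fix x assume x: "x \<in> D"
    let ?I = "LBINT s:{0..T}. (R (x, s))\<^sup>2"
    have cr: "continuous_on {0..T} (\<lambda>s. (R (x, s))\<^sup>2)" by (rule cont_t[OF cR2 x])
    have I0: "0 \<le> ?I" unfolding set_lebesgue_integral_def by (intro Bochner_Integration.integral_nonneg) auto
    have "(time_int R (x, t))\<^sup>2 \<le> T * ?I" if t: "t \<in> {0..T}" for t
    proof -
      let ?J = "LBINT s:{0..t}. (R (x, s))\<^sup>2"
      have J: "0 \<le> ?J" unfolding set_lebesgue_integral_def by (intro Bochner_Integration.integral_nonneg) auto
      have "?J \<le> ?I"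
        using set_integrable_Icc[OF cr, of t] set_integrable_Icc[OF cr, of T] t
        unfolding set_lebesgue_integral_def set_integrable_def
        by (intro integral_mono) (auto simp: indicator_def)
      have m: "(LBINT s:{0..t}. 1) = t" using t by (simp add: set_lebesgue_integral_def)
      have le: "(LBINT s:{0..t}. 1 * h (x, s)) \<le> sqrt (LBINT s:{0..t}. 1\<^sup>2) * sqrt (LBINT s:{0..t}. (h (x, s))\<^sup>2)"
        if h: "continuous_on (K \<times> {0..T}) h" for h :: "'a \<times> real \<Rightarrow> real"
        using t by (intro set_integral_Cauchy_Schwarz set_integrable_Icc[of T] continuous_intros cont_t[OF h x]) auto
      \<comment> \<open>Cauchy-Schwarz was stated one-sidedly; applied to \<open>R\<close> and to
        its negative it bounds the absolute value.\<close>
      have "\<bar>time_int R (x, t)\<bar> \<le> sqrt t * sqrt ?J"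
        using le[OF R] le[OF continuous_on_minus[OF R]]
        by (simp add: time_int_def m set_integral_uminus set_integrable_Icc[OF cont_t[OF R x]] t abs_le_iff
              t[unfolded atLeastAtMost_iff])
      then have "(time_int R (x, t))\<^sup>2 \<le> (sqrt t * sqrt ?J)\<^sup>2"
        by (rule power2_le_iff_abs_le[THEN iffD2, rotated]) (use t J in simp)
      also have "\<dots> = t * ?J" using t J by (simp add: power_mult_distrib)
      also have "\<dots> \<le> T * ?I" using t J \<open>?J \<le> ?I\<close> by (intro mult_mono) auto
      finally show ?thesis .
    qed
    then have "(LBINT t:{0..T}. (time_int R (x, t))\<^sup>2) \<le> (LBINT t:{0..T}. T * ?I)"
      by (intro set_integral_mono set_integrable_Icc[of T] cont_t[OF cP2 x] continuous_intros) auto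
    also have "\<dots> = T\<^sup>2 * ?I" using T by (simp add: set_lebesgue_integral_def power2_eq_square)
    finally show "(LBINT t:{0..T}. (time_int R (x, t))\<^sup>2) \<le> T\<^sup>2 * ?I" .
  qed
  also have "\<dots> = T\<^sup>2 * source_norm\<^sup>2" by (simp add: source_norm_sq Fubini(1)[OF cR2])
  finally have le: "sqrt (LBINT p:D \<times> {0..T}. (time_int R p)\<^sup>2) \<le> T * source_norm"
    using T source_norm_nonneg by (intro real_le_lsqrt) (simp_all add: power_mult_distrib)
  have "(LBINT p:D \<times> {0..T}. U p * time_int R p) \<le> sqrt energy * sqrt (LBINT p:D \<times> {0..T}. (time_int R p)\<^sup>2)"
    unfolding energy_def by (intro set_integral_Cauchy_Schwarz int_E continuous_intros U cont_time_int R)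
  also have "\<dots> \<le> sqrt energy * (T * source_norm)" by (intro mult_left_mono le) (simp add: energy_nonneg)
  finally show ?thesis .
qed

text \<open>With g = |V(x, .)| the integrand is at most Cf g(t) times the primitive of g. Its
  integral is Cf/2 times the squared integral of g, and Cauchy-Schwarz contributes the factor
  T.\<close>

lemma reaction_le: "(LBINT p:D \<times> {0..T}. U p * time_int F p) \<le> Cf * T / 2 * energy"
proof -
  have cUF: "continuous_on (K \<times> {0..T}) (\<lambda>p. U p * time_int F p)" by (intro continuous_intros U cont_time_int F)
  have cU2: "continuous_on (K \<times> {0..T}) (\<lambda>p. (U p)\<^sup>2)" by (intro continuous_intros U)
  have "(LBINT p:D \<times> {0..T}. U p * time_int F p) = (LBINT x:D. LBINT t:{0..T}. U (x, t) * time_int F (x, t))"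
    by (rule Fubini(1)[OF cUF])
  also have "\<dots> \<le> (LBINT x:D. Cf * T / 2 * (LBINT t:{0..T}. (U (x, t))\<^sup>2))"
  proof (rule set_integral_mono)
    have "continuous_on K (\<lambda>x. time_int (\<lambda>p. U p * time_int F p) (x, T))" "continuous_on K (\<lambda>x. time_int (\<lambda>p. (U p)\<^sup>2) (x, T))"
      by (intro slices(2)[OF cont_time_int[OF cUF]] slices(2)[OF cont_time_int[OF cU2]]; use T in simp)+
    then have c: "continuous_on K (\<lambda>x. LBINT t:{0..T}. U (x, t) * time_int F (x, t))"
        "continuous_on K (\<lambda>x. LBINT t:{0..T}. (U (x, t))\<^sup>2)"
      by (simp_all add: time_int_def[of "\<lambda>p. U p * time_int F p"] time_int_def[of "\<lambda>p. (U p)\<^sup>2"])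
    show "set_integrable lborel D (\<lambda>x. LBINT t:{0..T}. U (x, t) * time_int F (x, t))"
      "set_integrable lborel D (\<lambda>x. Cf * T / 2 * (LBINT t:{0..T}. (U (x, t))\<^sup>2))"
      by (intro int_D continuous_intros c)+
    fix x assume x: "x \<in> D"
    define g where "g t = \<bar>U (x, t)\<bar>" for t
    have g: "continuous_on {0..T} g" unfolding g_def by (intro continuous_intros cont_t[OF U x])
    have "(LBINT t:{0..T}. U (x, t) * time_int F (x, t)) \<le> (LBINT t:{0..T}. Cf * (g t * (LBINT s:{0..t}. g s)))"
    proof (rule set_integral_mono)
      show "set_integrable lborel {0..T} (\<lambda>t. U (x, t) * time_int F (x, t))"
        "set_integrable lborel {0..T} (\<lambda>t. Cf * (g t * (LBINT s:{0..t}. g s)))"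
        by (intro set_integrable_Icc[of T] cont_t[OF cUF x] continuous_intros g continuous_on_LINT_Icc; simp)+
      fix t assume t: "t \<in> {0..T}"
      have "\<bar>time_int F (x, t)\<bar> \<le> (LBINT s:{0..t}. \<bar>F (x, s)\<bar>)"
        using set_integral_norm_bound[OF set_integrable_Icc[OF cont_t[OF F x], of t]] t by (simp add: time_int_def)
      also have "\<dots> \<le> (LBINT s:{0..t}. Cf * g s)"
        using t F_le[OF x] unfolding g_def
        by (intro set_integral_mono set_integrable_Icc[of T] continuous_intros cont_t[OF F x] cont_t[OF U x]) auto
      also have "\<dots> = Cf * (LBINT s:{0..t}. g s)" by simp
      finally have "\<bar>U (x, t)\<bar> * \<bar>time_int F (x, t)\<bar> \<le> g t * (Cf * (LBINT s:{0..t}. g s))"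
        unfolding g_def by (intro mult_left_mono) auto
      then show "U (x, t) * time_int F (x, t) \<le> Cf * (g t * (LBINT s:{0..t}. g s))"
        using abs_ge_self[of "U (x, t) * time_int F (x, t)"] by (simp add: abs_mult mult_ac)
    qed
    also have "\<dots> = Cf * ((LBINT t:{0..T}. g t)\<^sup>2 / 2)"
      using LINT_triangle[OF g] T by simp
    also have "\<dots> \<le> Cf * (T * (LBINT t:{0..T}. (g t)\<^sup>2) / 2)"
    proof -
      have I0: "0 \<le> (LBINT t:{0..T}. (g t)\<^sup>2)" and g0: "0 \<le> (LBINT t:{0..T}. g t)"
        unfolding set_lebesgue_integral_def by (intro Bochner_Integration.integral_nonneg; simp add: g_def)+
      have "(LBINT t:{0..T}. 1 * g t) \<le> sqrt (LBINT t:{0..T}. 1\<^sup>2) * sqrt (LBINT t:{0..T}. (g t)\<^sup>2)"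
        by (intro set_integral_Cauchy_Schwarz set_integrable_Icc[of T] continuous_intros g) auto
      then have "(LBINT t:{0..T}. g t) \<le> sqrt T * sqrt (LBINT t:{0..T}. (g t)\<^sup>2)"
        using T by (simp add: set_lebesgue_integral_def)
      then have "(LBINT t:{0..T}. g t)\<^sup>2 \<le> (sqrt T * sqrt (LBINT t:{0..T}. (g t)\<^sup>2))\<^sup>2"
        by (rule power_mono) (rule g0)
      then show ?thesis
        using I0 T Cf by (intro mult_left_mono) (simp_all add: power_mult_distrib)
    qed
    also have "\<dots> = Cf * T / 2 * (LBINT t:{0..T}. (U (x, t))\<^sup>2)" by (simp add: g_def)
    finally show "(LBINT t:{0..T}. U (x, t) * time_int F (x, t)) \<le> Cf * T / 2 * (LBINT t:{0..T}. (U (x, t))\<^sup>2)" .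
  qed
  also have "\<dots> = Cf * T / 2 * energy" by (simp add: energy_def Fubini(1)[OF cU2])
  finally show ?thesis .
qed

text \<open>The gradient times its own time integral is added; its integral is half a square and
  hence nonnegative. Green's inequality then applies to every pair of times, and as V is not doubled
  the boundary term enters once.\<close>

lemma diffusion_le: "(LBINT p:D \<times> {0..T}. U p * time_int lap p) \<le> T * boundary_term"
proof -
  let ?GP = "\<lambda>p. \<Sum>b\<in>Basis. Gr b p * time_int (Gr b) p"
  have cGP: "continuous_on (K \<times> {0..T}) ?GP" by (intro continuous_intros Gr cont_time_int)
  have cUL: "continuous_on (K \<times> {0..T}) (\<lambda>p. U p * time_int lap p)" by (intro continuous_intros U cont_time_int cont_lap)
  \<comment> \<open>At fixed \<open>t\<close> the bound from \<open>green\<close> does not depend on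
    \<open>s\<close>, so integrating over \<open>{0..t}\<close> multiplies it by
    \<open>t\<close>.\<close>
  have slice: "(LBINT x:D. U (x, t) * time_int lap (x, t) + ?GP (x, t)) \<le> t * (G * boundary_L1 t)" if t: "t \<in> {0..T}" for t
  proof -
    have tc: "continuous_on (K \<times> {0..T}) (\<lambda>p. \<Phi> (fst p, t))"
      if "continuous_on (K \<times> {0..T}) \<Phi>" for \<Phi> :: "'a \<times> real \<Rightarrow> real"
      by (rule continuous_on_compose2[OF that]) (use t in \<open>auto intro!: continuous_intros\<close>)
    let ?h = "\<lambda>p. U (fst p, t) * lap p + (\<Sum>b\<in>Basis. Gr b (fst p, t) * Gr b p)"
    have ch: "continuous_on (K \<times> {0..T}) ?h"
      by (intro continuous_intros tc U cont_lap Gr; assumption)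
    have "(LBINT x:D. U (x, t) * time_int lap (x, t) + ?GP (x, t)) = (LBINT x:D. LBINT s:{0..t}. ?h (x, s))"
    proof (rule set_lebesgue_integral_cong)
      show "D \<in> sets lborel" using D(1) by simp
      show "\<forall>x. x \<in> D \<longrightarrow> U (x, t) * time_int lap (x, t) + ?GP (x, t) = (LBINT s:{0..t}. ?h (x, s))"
      proof (intro allI impI)
        fix x assume x: "x \<in> D"
        have i: "set_integrable lborel {0..t} (\<lambda>s. U (x, t) * lap (x, s))"
          "\<And>b. b \<in> Basis \<Longrightarrow> set_integrable lborel {0..t} (\<lambda>s. Gr b (x, t) * Gr b (x, s))"
          using t by (intro set_integrable_Icc[of T] continuous_intros cont_t[OF cont_lap x] cont_t[OF Gr x]; simp)+
        have s: "(LBINT s:{0..t}. (\<Sum>b\<in>Basis. Gr b (x, t) * Gr b (x, s))) = ?GP (x, t)"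
          using i(2) unfolding time_int_def set_lebesgue_integral_def set_integrable_def
          by (simp add: sum_distrib_left mult.left_commute)
        have isum: "set_integrable lborel {0..t} (\<lambda>s. \<Sum>b\<in>Basis. Gr b (x, t) * Gr b (x, s))"
          using t by (intro set_integrable_Icc[of T] continuous_intros cont_t[OF Gr x]; simp)
        show "U (x, t) * time_int lap (x, t) + ?GP (x, t) = (LBINT s:{0..t}. ?h (x, s))"
          using set_integral_add(2)[OF i(1) isum] s by (simp add: time_int_def[of lap])
      qed
    qed
    also have "\<dots> = (LBINT s:{0..t}. LBINT x:D. ?h (x, s))"
      using Fubini_cylinder[OF D(1,2) ch, of t] t by simp
    also have "\<dots> \<le> (LBINT s:{0..t}. G * boundary_L1 t)"
      using t green[OF t] by (intro set_integral_mono set_integrable_Icc[of T] cont_LINT_D[OF ch] continuous_intros) auto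
    also have "\<dots> = t * (G * boundary_L1 t)" using t by (simp add: set_lebesgue_integral_def)
    finally show ?thesis .
  qed
  have GP0: "0 \<le> (LBINT p:D \<times> {0..T}. ?GP p)"
  proof -
    have "0 \<le> (LBINT t:{0..T}. ?GP (x, t))" if x: "x \<in> D" for x
    proof -
      have i: "set_integrable lborel {0..T} (\<lambda>t. Gr b (x, t) * time_int (Gr b) (x, t))" if "b \<in> Basis" for b
        by (intro set_integrable_Icc[of T] continuous_intros cont_t[OF _ x] Gr cont_time_int that) simp
      have "(LBINT t:{0..T}. ?GP (x, t)) = (\<Sum>b\<in>Basis. LBINT t:{0..T}. Gr b (x, t) * time_int (Gr b) (x, t))"
        using i unfolding set_lebesgue_integral_def set_integrable_def
        by (subst Bochner_Integration.integral_sum[symmetric]) (auto simp: sum_distrib_left)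
      also have "\<dots> = (\<Sum>b\<in>Basis. (LBINT t:{0..T}. Gr b (x, t))\<^sup>2 / 2)"
        by (rule sum.cong) (use LINT_triangle[OF cont_t[OF Gr x]] T in \<open>simp_all add: time_int_def\<close>)
      also have "\<dots> \<ge> 0" by (intro sum_nonneg) simp
      finally show ?thesis .
    qed
    then show ?thesis
      unfolding Fubini(1)[OF cGP] set_lebesgue_integral_def[of lborel D]
      by (intro Bochner_Integration.integral_nonneg) (simp add: indicator_def)
  qed
  have cUG: "continuous_on (K \<times> {0..T}) (\<lambda>p. U p * time_int lap p + ?GP p)" by (intro continuous_intros cUL cGP)
  have "(LBINT p:D \<times> {0..T}. U p * time_int lap p) \<le> (LBINT p:D \<times> {0..T}. U p * time_int lap p + ?GP p)"
    using GP0 set_integral_add(2)[OF int_E[OF cUL] int_E[OF cGP]] by simp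
  also have "\<dots> = (LBINT t:{0..T}. LBINT x:D. U (x, t) * time_int lap (x, t) + ?GP (x, t))"
    by (rule Fubini(2)[OF cUG])
  also have "\<dots> \<le> (LBINT t:{0..T}. T * (G * boundary_L1 t))"
  proof (intro set_integral_mono set_integrable_Icc[of T] cont_LINT_D[OF cUG] continuous_intros cont_boundary_L1)
    fix t assume t: "t \<in> {0..T}"
    have "t * (G * boundary_L1 t) \<le> T * (G * boundary_L1 t)" using t G boundary_L1_nonneg by (intro mult_right_mono) auto
    then show "(LBINT x:D. U (x, t) * time_int lap (x, t) + ?GP (x, t)) \<le> T * (G * boundary_L1 t)"
      using slice[OF t] by linarith
  qed auto
  also have "\<dots> \<le> T * boundary_term" using boundary_le T by simp
  finally show ?thesis .
qed

text \<open>The reaction contribution is moved to the left-hand side, which leaves a positive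
  coefficient as long as Cf T < 2.\<close>

lemma energy_short_time: "(1 - Cf * T / 2) * energy \<le> sqrt energy * (sqrt T * initial_norm + T * source_norm) + T * boundary_term"
proof -
  have c0: "continuous_on (K \<times> {0..T}) (\<lambda>p. U (fst p, 0))"
    by (rule continuous_on_compose2[OF U]) (use T in \<open>auto intro!: continuous_intros\<close>)
  have i: "set_integrable lborel (D \<times> {0..T}) (\<lambda>p. U p * U (fst p, 0))"
    "set_integrable lborel (D \<times> {0..T}) (\<lambda>p. U p * time_int lap p)"
    "set_integrable lborel (D \<times> {0..T}) (\<lambda>p. U p * time_int F p)"
    "set_integrable lborel (D \<times> {0..T}) (\<lambda>p. U p * time_int R p)"
    by (intro int_E continuous_intros U c0 cont_time_int cont_lap F R)+
  have "energy = (LBINT p:D \<times> {0..T}. (U p * U (fst p, 0) + U p * time_int lap p + U p * time_int F p) + U p * time_int R p)"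
    unfolding energy_def by (rule set_lebesgue_integral_cong) (use U_expansion D(1) in \<open>auto intro: borel_Times\<close>)
  also have "\<dots> = (LBINT p:D \<times> {0..T}. U p * U (fst p, 0)) + (LBINT p:D \<times> {0..T}. U p * time_int lap p)
      + (LBINT p:D \<times> {0..T}. U p * time_int F p) + (LBINT p:D \<times> {0..T}. U p * time_int R p)"
    using set_integral_add(2)[OF set_integral_add(1)[OF set_integral_add(1)[OF i(1,2)] i(3)] i(4)]
      LINT_sum_add[OF i(1-3)] by simp
  also have "\<dots> \<le> sqrt energy * (sqrt T * initial_norm) + T * boundary_term + Cf * T / 2 * energy + sqrt energy * (T * source_norm)"
    by (intro add_mono initial_le diffusion_le reaction_le source_le)
  finally show ?thesis by (simp add: algebra_simps)
qed

text \<open>C_1^2 equals T W with W = 1 + \<tau> exp \<tau> and \<tau> = T + 4 \<kappa>. For short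
  times the polynomial bound W \<ge> 1 + \<tau> + \<tau>^2 is enough; otherwise \<tau> \<ge> 1 and
  the exponentials themselves are compared.\<close>

theorem sqrt_energy_le: "sqrt energy \<le> const_1 T Cf * (initial_norm + source_norm + sqrt boundary_term)"
proof -
  define \<kappa> where "\<kappa> = Cf * T / 2"
  define \<tau> where "\<tau> = (1 + 2 * Cf) * T"
  define W where "W = 1 + \<tau> * exp \<tau>"
  have \<kappa>0: "0 \<le> \<kappa>" using Cf T by (simp add: \<kappa>_def)
  have \<tau>: "\<tau> = T + 4 * \<kappa>" by (simp add: \<tau>_def \<kappa>_def algebra_simps)
  have \<tau>T: "T \<le> \<tau>" "0 < \<tau>" using \<kappa>0 T by (simp_all add: \<tau>)
  have C1: "const_1 T Cf = sqrt (T * W)"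
    by (simp add: const_1_def W_def \<tau>_def power2_eq_square algebra_simps)
  have "\<tau> * (1 + \<tau>) \<le> \<tau> * exp \<tau>"
    using \<tau>T exp_ge_add_one_self[of \<tau>] by (intro mult_left_mono) auto
  then have W1: "1 + \<tau> + \<tau> * \<tau> \<le> W" by (simp add: W_def algebra_simps)
  have W0: "0 \<le> W" using W1 \<tau>T by (simp add: W_def)
  note nn = initial_norm_nonneg source_norm_nonneg boundary_term_nonneg energy_nonneg
  show ?thesis
  proof (cases "Cf * T \<le> 1 / 2")
    case True
    then have \<kappa>1: "\<kappa> \<le> 1 / 4" by (simp add: \<kappa>_def)
    have W2: "1 + 4 * \<kappa> + T + T * T \<le> W"
    proof -
      have "T * T \<le> \<tau> * \<tau>" using \<tau>T T by (intro mult_mono) auto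
      then show ?thesis using W1 by (simp add: \<tau>)
    qed
    define y where "y = sqrt energy"
    have y0: "0 \<le> y" and y2: "y\<^sup>2 = energy" using nn by (simp_all add: y_def)
    define q where "q = (sqrt T * initial_norm + T * source_norm) / (1 - \<kappa>)"
    define r where "r = T * boundary_term / (1 - \<kappa>)"
    have q0: "0 \<le> q" and r0: "0 \<le> r" using nn T \<kappa>1 by (auto simp: q_def r_def)
    have "(1 - \<kappa>) * y\<^sup>2 \<le> y * (sqrt T * initial_norm + T * source_norm) + T * boundary_term"
      unfolding y2 using energy_short_time by (simp add: y_def \<kappa>_def)
    then have "y\<^sup>2 \<le> (y * (sqrt T * initial_norm + T * source_norm) + T * boundary_term) / (1 - \<kappa>)"
      using \<kappa>1 by (simp add: pos_le_divide_eq mult.commute)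
    then have y_le: "y\<^sup>2 \<le> y * q + r"
      unfolding q_def r_def times_divide_eq_right add_divide_distrib[symmetric] .
    \<comment> \<open>If y exceeded q + sqrt r, then y (y - q) would exceed the product of sqrt r
      with itself, contrary to the quadratic inequality.\<close>
    have "y \<le> q + sqrt r"
    proof (rule ccontr)
      assume "\<not> y \<le> q + sqrt r"
      then have *: "q + sqrt r < y" "sqrt r < y - q" by auto
      have "r = sqrt r * sqrt r" using r0 by simp
      also have "\<dots> \<le> sqrt r * (y - q)" using * r0 by (intro mult_left_mono) auto
      also have "\<dots> < y * (y - q)"
      proof (rule mult_strict_right_mono)
        show "sqrt r < y" using * q0 by linarith
        show "0 < y - q" using * r0 real_sqrt_ge_zero[OF r0] by linarith
      qed
      finally show False using y_le by (simp add: power2_eq_square algebra_simps)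
    qed
    also have "q + sqrt r \<le> sqrt (T * W) * initial_norm + sqrt (T * W) * source_norm + sqrt (T * W) * sqrt boundary_term"
    proof -
      have pos: "0 < 1 - \<kappa>" "0 < (1 - \<kappa>)\<^sup>2" using \<kappa>1 by auto
      have k2: "9 / 16 \<le> (1 - \<kappa>)\<^sup>2"
        using power_mono[of "3/4" "1 - \<kappa>" 2] \<kappa>1 by (simp add: power2_eq_square)
      \<comment> \<open>\<open>A\<close>, \<open>B\<close> and \<open>C\<close> compare the
        coefficients of the three norms: 1 / (1 - \<kappa>)^2, T / (1 - \<kappa>)^2 and 1 / (1 -
        \<kappa>) must not exceed W.\<close>
      have A: "1 \<le> (1 - \<kappa>)\<^sup>2 * W"
      proof -
        \<comment> \<open>This polynomial is (1 - \<kappa>)^2 (1 + 4 \<kappa>) - 1; its second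
          factor is nonnegative because \<kappa> \<le> 1/4.\<close>
        have "0 \<le> \<kappa> * (2 - 7 * \<kappa> + 4 * \<kappa> * \<kappa>)" using \<kappa>0 \<kappa>1 by (intro mult_nonneg_nonneg) auto
        then have "1 \<le> (1 - \<kappa>)\<^sup>2 * (1 + 4 * \<kappa>)" by (simp add: power2_eq_square algebra_simps)
        also have "\<dots> \<le> (1 - \<kappa>)\<^sup>2 * W"
        proof (rule mult_left_mono)
          have "0 \<le> T * T" by simp
          then show "1 + 4 * \<kappa> \<le> W" using W2 T by linarith
        qed simp
        finally show ?thesis .
      qed
      have B: "T \<le> (1 - \<kappa>)\<^sup>2 * W"
      proof -
        \<comment> \<open>From 2 T \<le> 1 + T^2 follows 3 T \<le> 1 + T + T^2, and 9/16 times 3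
          exceeds 1.\<close>
        have "0 \<le> (T - 1)\<^sup>2" by simp
        then have "2 * T \<le> 1 + T * T" by (simp add: power2_eq_square algebra_simps)
        then have "T \<le> 9 / 16 * (1 + T + T * T)" using T by simp
        also have "\<dots> \<le> (1 - \<kappa>)\<^sup>2 * W"
          using k2 W2 \<kappa>0 T by (intro mult_mono) auto
        finally show ?thesis .
      qed
      have C: "1 \<le> (1 - \<kappa>) * W"
      proof -
        have "(1 - \<kappa>)\<^sup>2 \<le> 1 - \<kappa>" using \<kappa>0 \<kappa>1 by (simp add: power2_eq_square algebra_simps mult_left_le)
        then have "(1 - \<kappa>)\<^sup>2 * W \<le> (1 - \<kappa>) * W" using W0 by (rule mult_right_mono)
        then show ?thesis using A by linarith
      qed
      have a1: "sqrt T / (1 - \<kappa>) \<le> sqrt (T * W)"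
      proof (rule real_le_rsqrt)
        have "(sqrt T / (1 - \<kappa>))\<^sup>2 = T * (1 / (1 - \<kappa>)\<^sup>2)" using T by (simp add: power_divide)
        also have "\<dots> \<le> T * W" using A pos T by (intro mult_left_mono) (simp_all add: pos_divide_le_eq mult.commute)
        finally show "(sqrt T / (1 - \<kappa>))\<^sup>2 \<le> T * W" .
      qed
      have b1: "T / (1 - \<kappa>) \<le> sqrt (T * W)"
      proof (rule real_le_rsqrt)
        have "(T / (1 - \<kappa>))\<^sup>2 = T * (T / (1 - \<kappa>)\<^sup>2)" by (simp add: power2_eq_square)
        also have "\<dots> \<le> T * W" using B pos T by (intro mult_left_mono) (simp_all add: pos_divide_le_eq mult.commute)
        finally show "(T / (1 - \<kappa>))\<^sup>2 \<le> T * W" .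
      qed
      have "T / (1 - \<kappa>) \<le> T * W" using mult_left_mono[OF C, of T] pos T by (simp add: pos_divide_le_eq mult_ac)
      then have c1: "sqrt r \<le> sqrt (T * W) * sqrt boundary_term"
        using mult_right_mono[of "T / (1 - \<kappa>)" "T * W" boundary_term] nn
        by (simp add: r_def real_sqrt_mult[symmetric])
      have "q = sqrt T / (1 - \<kappa>) * initial_norm + T / (1 - \<kappa>) * source_norm" by (simp add: q_def add_divide_distrib)
      then show ?thesis
        using mult_right_mono[OF a1, of initial_norm] mult_right_mono[OF b1, of source_norm] c1 nn by linarith
    qed
    finally show ?thesis by (simp add: C1 y_def algebra_simps)
  next
    case False
    have "2 * \<kappa> > 1 / 2" using False by (simp add: \<kappa>_def)
    then have \<tau>1: "1 \<le> \<tau>" using T by (simp add: \<tau>)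
    have key: "2 * (exp \<tau> - 1) \<le> \<tau> * W"
    proof -
      \<comment> \<open>The claim reads h(\<tau>) \<ge> 0. For small positive t the function is
        negative, so the comparison starts at 1, where h(1) = 3 - e.\<close>
      define h where "h t = t + (t\<^sup>2 - 2) * exp t + 2" for t :: real
      have "h 1 \<le> h \<tau>"
      proof (rule DERIV_nonneg_imp_nondecreasing[OF \<tau>1])
        fix t :: real assume t: "1 \<le> t"
        have "(h has_real_derivative 1 + (2 * t * exp t + (t\<^sup>2 - 2) * exp t)) (at t)"
          unfolding h_def by (auto intro!: derivative_eq_intros)
        moreover have "1 + (2 * t * exp t + (t\<^sup>2 - 2) * exp t) = 1 + exp t * (t\<^sup>2 + 2 * t - 2)"
          by (simp add: algebra_simps)
        moreover have "0 \<le> t\<^sup>2 + 2 * t - 2"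
          using t zero_le_power2[of t] by linarith
        then have "0 \<le> exp t * (t\<^sup>2 + 2 * t - 2)" by simp
        ultimately show "\<exists>y. (h has_real_derivative y) (at t) \<and> 0 \<le> y" by fastforce
      qed
      moreover have "0 \<le> h 1" using exp_le by (simp add: h_def)
      ultimately show ?thesis by (simp add: h_def W_def power2_eq_square algebra_simps)
    qed
    have "energy \<le> (initial_norm\<^sup>2 + source_norm\<^sup>2 + 2 * boundary_term) * (exp \<tau> - 1) / (1 + 2 * Cf)"
      using energy_Gronwall by (simp add: \<tau>_def)
    also have "\<dots> = (initial_norm\<^sup>2 + source_norm\<^sup>2 + 2 * boundary_term) * (T * ((exp \<tau> - 1) / \<tau>))"
      using T Cf by (simp add: \<tau>_def)
    \<comment> \<open>The factor 2 of the boundary term is granted to all three terms and then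
      absorbed by \<open>key\<close>.\<close>
    also have "\<dots> \<le> (2 * (initial_norm\<^sup>2 + source_norm\<^sup>2 + boundary_term)) * (T * (W / 2))"
    proof (rule mult_mono)
      have "(exp \<tau> - 1) / \<tau> \<le> W / 2" using key \<tau>T by (simp add: pos_divide_le_eq mult.commute)
      then show "T * ((exp \<tau> - 1) / \<tau>) \<le> T * (W / 2)" using T by (intro mult_left_mono) auto
      show "0 \<le> T * ((exp \<tau> - 1) / \<tau>)" using T \<tau>T by simp
    qed (use nn in \<open>auto intro!: add_nonneg_nonneg\<close>)
    also have "\<dots> = T * W * (initial_norm\<^sup>2 + source_norm\<^sup>2 + boundary_term)" by simp
    also have "\<dots> \<le> T * W * (initial_norm + source_norm + sqrt boundary_term)\<^sup>2"
    proof (rule mult_left_mono)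
      have "0 \<le> 2 * initial_norm * source_norm + 2 * initial_norm * sqrt boundary_term + 2 * source_norm * sqrt boundary_term" using nn by (intro add_nonneg_nonneg mult_nonneg_nonneg) auto
      moreover have "(initial_norm + source_norm + sqrt boundary_term)\<^sup>2 = initial_norm\<^sup>2 + source_norm\<^sup>2 + (sqrt boundary_term)\<^sup>2 + (2 * initial_norm * source_norm + 2 * initial_norm * sqrt boundary_term + 2 * source_norm * sqrt boundary_term)"
        by (simp add: power2_eq_square algebra_simps)
      ultimately show "initial_norm\<^sup>2 + source_norm\<^sup>2 + boundary_term \<le> (initial_norm + source_norm + sqrt boundary_term)\<^sup>2" using nn by simp
    qed (use T W0 in simp)
    finally have "sqrt energy \<le> sqrt (T * W * (initial_norm + source_norm + sqrt boundary_term)\<^sup>2)" by simp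
    also have "\<dots> = const_1 T Cf * (initial_norm + source_norm + sqrt boundary_term)" using nn by (simp add: C1 real_sqrt_mult)
    finally show ?thesis .
  qed
qed

end

section \<open>Extensions of derivatives and quadrature\<close>

text \<open>Since every point of the closed cylinder is a limit of interior points, continuous
  extensions, and with them \<open>pd_on\<close>, are determined there.\<close>

lemma cylinder_subset_closure_interior:
  fixes D :: "'a::euclidean_space set"
  assumes "open D" "T > (0::real)"
  shows "closure D \<times> {0..T} \<subseteq> closure (interior (closure D \<times> {0..T}))"
proof -
  have "closure D \<times> {0..T} = closure (D \<times> {0<..<T})"
    using assms(2) by (simp add: closure_Times closure_greaterThanLessThan)
  also have "\<dots> \<subseteq> closure (interior (closure D \<times> {0..T}))"
    by (rule closure_mono[OF cylinder_subset_interior[OF assms(1)]])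
  finally show ?thesis .
qed

text \<open>\<open>pd_on\<close> is a \<open>Lim\<close>, which is informative only along a proper
  filter. The point is a limit point of the interior, so uniqueness of limits gives the value of the
  extension.\<close>

lemma pd_on_eq_extension:
  assumes p: "p \<in> S" "p \<in> closure (interior S)" and G: "continuous_on S G"
    and eq: "\<And>x. x \<in> interior S \<Longrightarrow> G x = pd b v x"
  shows "pd_on S b v p = G p"
proof -
  have "p islimpt interior S"
  proof (cases "p \<in> interior S")
    case True
    then show ?thesis by (metis interior_limit_point interior_interior)
  next
    case False
    then show ?thesis using p(2) by (simp add: closure_def)
  qed
  then have nt: "at p within interior S \<noteq> bot" by (simp add: trivial_limit_within)
  have "(G \<longlongrightarrow> G p) (at p within S)" using G p(1) by (simp add: continuous_on_def)
  then have "(G \<longlongrightarrow> G p) (at p within interior S)"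
    by (rule tendsto_within_subset) (rule interior_subset)
  then have "(pd b v \<longlongrightarrow> G p) (at p within interior S)"
    by (rule Lim_transform_eventually) (auto simp: eventually_at_filter eq)
  from tendsto_Lim[OF nt this] show ?thesis by (simp add: pd_on_def)
qed

lemma Ck_ext_pds:
  assumes "Ck_ext k S K v" "bs \<in> multi_indices k"
  obtains G where "continuous_on K G" "\<And>x. x \<in> S \<Longrightarrow> G x = pds bs v x"
proof -
  have "\<exists>G. continuous_on K G \<and> (\<forall>x\<in>S. G x = pds bs v x)"
    using assms by (simp add: Ck_ext_def)
  then show ?thesis using that by blast
qed

text \<open>Collects what \<open>heat_energy\<close> needs to know about one function, as both
  \<open>u\<close> and \<open>ustar\<close> are treated; the last clause ties the extended gradient
  to the norm in the error bound.\<close>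

definition C2_extensions ::
    "'a::euclidean_space set \<Rightarrow> real \<Rightarrow> ('a \<times> real \<Rightarrow> real) \<Rightarrow> ('a \<times> real \<Rightarrow> real) \<Rightarrow>
      ('a \<Rightarrow> 'a \<times> real \<Rightarrow> real) \<Rightarrow> ('a \<Rightarrow> 'a \<times> real \<Rightarrow> real) \<Rightarrow> bool" where
  "C2_extensions D T v Gt Gb Hb \<longleftrightarrow>
    continuous_on (closure D \<times> {0..T}) Gt \<and>
    (\<forall>b\<in>Basis. continuous_on (closure D \<times> {0..T}) (Gb b)) \<and>
    (\<forall>b\<in>Basis. continuous_on (closure D \<times> {0..T}) (Hb b)) \<and>
    (\<forall>x\<in>D. \<forall>t\<in>{0<..<T}. ((\<lambda>s. v (x, s)) has_real_derivative Gt (x, t)) (at t)) \<and>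
    (\<forall>x\<in>D. \<forall>t\<in>{0<..<T}. \<forall>b\<in>Basis. ((\<lambda>h. v (x + h *\<^sub>R b, t)) has_real_derivative Gb b (x, t)) (at 0)) \<and>
    (\<forall>x\<in>D. \<forall>t\<in>{0<..<T}. \<forall>b\<in>Basis. ((\<lambda>h. Gb b (x + h *\<^sub>R b, t)) has_real_derivative Hb b (x, t)) (at 0)) \<and>
    (\<forall>x\<in>D. \<forall>t\<in>{0<..<T}. dt v (x, t) = Gt (x, t)) \<and>
    (\<forall>x\<in>D. \<forall>t\<in>{0<..<T}. laplacian v (x, t) = (\<Sum>b\<in>Basis. Hb b (x, t))) \<and>
    (\<forall>p\<in>frontier D \<times> {0..T}. sqrt (\<Sum>b\<in>Basis. (Gb b p)\<^sup>2) \<le> C1_lateral_norm D T v)"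

lemma C2_extensionsD:
  assumes "C2_extensions D T v Gt Gb Hb"
  shows "continuous_on (closure D \<times> {0..T}) Gt"
    and "\<And>b. b \<in> Basis \<Longrightarrow> continuous_on (closure D \<times> {0..T}) (Gb b)"
    and "\<And>b. b \<in> Basis \<Longrightarrow> continuous_on (closure D \<times> {0..T}) (Hb b)"
    and "\<And>x t. x \<in> D \<Longrightarrow> t \<in> {0<..<T} \<Longrightarrow> ((\<lambda>s. v (x, s)) has_real_derivative Gt (x, t)) (at t)"
    and "\<And>x t b. x \<in> D \<Longrightarrow> t \<in> {0<..<T} \<Longrightarrow> b \<in> Basis \<Longrightarrow> ((\<lambda>h. v (x + h *\<^sub>R b, t)) has_real_derivative Gb b (x, t)) (at 0)"
    and "\<And>x t b. x \<in> D \<Longrightarrow> t \<in> {0<..<T} \<Longrightarrow> b \<in> Basis \<Longrightarrow> ((\<lambda>h. Gb b (x + h *\<^sub>R b, t)) has_real_derivative Hb b (x, t)) (at 0)"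
    and "\<And>x t. x \<in> D \<Longrightarrow> t \<in> {0<..<T} \<Longrightarrow> dt v (x, t) = Gt (x, t)"
    and "\<And>x t. x \<in> D \<Longrightarrow> t \<in> {0<..<T} \<Longrightarrow> laplacian v (x, t) = (\<Sum>b\<in>Basis. Hb b (x, t))"
    and "\<And>p. p \<in> frontier D \<times> {0..T} \<Longrightarrow> sqrt (\<Sum>b\<in>Basis. (Gb b p)\<^sup>2) \<le> C1_lateral_norm D T v"
  using assms unfolding C2_extensions_def by blast+

lemma C2_cylinder_extensions:
  fixes D :: "'a::euclidean_space set" and v :: "'a \<times> real \<Rightarrow> real"
  assumes D: "open D" "bounded D" "D \<noteq> {}" and T: "T > 0" and k: "k \<ge> 2" and v: "Ck_on k (closure D \<times> {0..T}) v"
  shows "\<exists>Gt Gb Hb. C2_extensions D T v Gt Gb Hb"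
proof -
  let ?Q = "closure D \<times> {0..T}"
  have E: "Ck_ext 2 (interior ?Q) ?Q v" and cv: "continuous_on ?Q v"
    using v k by (auto simp: Ck_on_iff intro: Ck_ext_le)
  have cyl: "(x, t) \<in> interior ?Q" if "x \<in> D" "t \<in> {0<..<T}" for x t
    using cylinder_subset_interior[OF D(1), of T] that by blast
  have B: "(b, 0) \<in> Basis" "(0, 1) \<in> (Basis :: ('a \<times> real) set)" if "b \<in> Basis" for b :: 'a
    using that by (auto simp: Basis_prod_def)
  have B1: "(0, 1) \<in> (Basis :: ('a \<times> real) set)"
    by (auto simp: Basis_prod_def)
  have mi: "[(0, 1)] \<in> (multi_indices 2 :: ('a \<times> real) list set)"
    "\<And>b::'a. b \<in> Basis \<Longrightarrow> [(b, 0::real)] \<in> multi_indices 2"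
    "\<And>b::'a. b \<in> Basis \<Longrightarrow> [(b, 0::real), (b, 0)] \<in> multi_indices 2"
    using B B1 by (auto simp: multi_indices_def)
  obtain Gt where Gt: "continuous_on ?Q Gt" "\<And>p. p \<in> interior ?Q \<Longrightarrow> Gt p = pd (0, 1) v p"
    using Ck_ext_pds[OF E mi(1)] by auto
  have "\<forall>b\<in>(Basis::'a set). \<exists>G. continuous_on ?Q G \<and> (\<forall>p\<in>interior ?Q. G p = pd (b, 0) v p)"
    using Ck_ext_pds[OF E mi(2)] by (metis pds.simps)
  then obtain Gb where Gb: "\<And>b. b \<in> Basis \<Longrightarrow> continuous_on ?Q (Gb b)"
    "\<And>b p. b \<in> Basis \<Longrightarrow> p \<in> interior ?Q \<Longrightarrow> Gb b p = pd (b, 0) v p"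
    unfolding bchoice_iff by blast
  have "\<forall>b\<in>(Basis::'a set). \<exists>G. continuous_on ?Q G \<and> (\<forall>p\<in>interior ?Q. G p = pds [(b, 0), (b, 0)] v p)"
    using Ck_ext_pds[OF E mi(3)] by metis
  then obtain Hb where Hb: "\<And>b. b \<in> Basis \<Longrightarrow> continuous_on ?Q (Hb b)"
    "\<And>b p. b \<in> Basis \<Longrightarrow> p \<in> interior ?Q \<Longrightarrow> Hb b p = pds [(b, 0), (b, 0)] v p"
    unfolding bchoice_iff by blast
  have dif: "(\<lambda>h. v (p + h *\<^sub>R c)) differentiable (at 0)" if "p \<in> interior ?Q" "c \<in> Basis" for p c
    using E that by (simp add: numeral_2_eq_2 Ck_ext_Suc)
  have dif2: "(\<lambda>h. pd c v (p + h *\<^sub>R c)) differentiable (at 0)" if "p \<in> interior ?Q" "c \<in> Basis" for p c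
    using E that by (simp add: numeral_2_eq_2 Ck_ext_Suc)
  have cQ: "compact ?Q" using D(2) by (intro compact_Times) auto
  define M where "M p = Max {\<bar>v p\<bar>, \<bar>pd_on ?Q (0, 1) v p\<bar>, sqrt (\<Sum>b\<in>Basis. (pd_on ?Q (b, 0) v p)\<^sup>2)}" for p
  have pdon: "pd_on ?Q (0, 1) v p = Gt p" "b \<in> Basis \<Longrightarrow> pd_on ?Q (b, 0) v p = Gb b p" if "p \<in> ?Q" for p b
  proof -
    have "p \<in> closure (interior ?Q)" using cylinder_subset_closure_interior[OF D(1) T] that by blast
    from pd_on_eq_extension[OF that this Gt] pd_on_eq_extension[OF that this Gb]
    show "pd_on ?Q (0, 1) v p = Gt p" "b \<in> Basis \<Longrightarrow> pd_on ?Q (b, 0) v p = Gb b p" by blast+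
  qed
  have Meq: "M p = max \<bar>v p\<bar> (max \<bar>Gt p\<bar> (sqrt (\<Sum>b\<in>Basis. (Gb b p)\<^sup>2)))" if "p \<in> ?Q" for p
    by (simp add: M_def pdon[OF that])
  have "continuous_on ?Q (\<lambda>p. max \<bar>v p\<bar> (max \<bar>Gt p\<bar> (sqrt (\<Sum>b\<in>Basis. (Gb b p)\<^sup>2))))"
    by (intro continuous_intros cv Gt(1) Gb(1))
  \<comment> \<open>The supremum in \<open>C1_lateral_norm\<close> dominates its terms only if the
    set is bounded above; compactness supplies the bound \<open>C\<close>.\<close>
  from compact_bound[OF cQ this] obtain C where C: "\<And>p. p \<in> ?Q \<Longrightarrow> norm (max \<bar>v p\<bar> (max \<bar>Gt p\<bar> (sqrt (\<Sum>b\<in>Basis. (Gb b p)\<^sup>2)))) \<le> C"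
    by blast
  have FQ: "p \<in> ?Q" if "p \<in> frontier D \<times> {0..T}" for p
    using that by (auto simp: frontier_def)
  have norm_le: "sqrt (\<Sum>b\<in>Basis. (Gb b p)\<^sup>2) \<le> C1_lateral_norm D T v" if p: "p \<in> frontier D \<times> {0..T}" for p
  proof -
    have "sqrt (\<Sum>b\<in>Basis. (Gb b p)\<^sup>2) \<le> M p" using Meq[OF FQ[OF p]] by simp
    also have "M p \<le> (SUP p\<in>frontier D \<times> {0..T}. M p)"
    proof (rule cSUP_upper[OF p])
      show "bdd_above (M ` (frontier D \<times> {0..T}))"
      proof (rule bdd_aboveI2)
        fix q assume "q \<in> frontier D \<times> {0..T}"
        then have "q \<in> ?Q" by (rule FQ)
        then show "M q \<le> C" using C[of q] Meq[of q] by simp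
      qed
    qed
    also have "\<dots> = C1_lateral_norm D T v" by (simp add: C1_lateral_norm_def Let_def M_def)
    finally show ?thesis .
  qed
  have "C2_extensions D T v Gt Gb Hb"
    unfolding C2_extensions_def
  proof (intro conjI ballI Gt(1) Gb(1) Hb(1) norm_le)
    fix x t assume x: "x \<in> D" and t: "t \<in> {0<..<T}"
    note p = cyl[OF x t]
    show "dt v (x, t) = Gt (x, t)" using Gt(2)[OF p] by (simp add: dt_def)
    show "laplacian v (x, t) = (\<Sum>b\<in>Basis. Hb b (x, t))" using Hb(2)[OF _ p] by (simp add: laplacian_def)
    have "((\<lambda>h. v (x, t + h)) has_real_derivative Gt (x, t)) (at 0)"
      using pd_has_derivative[OF dif[OF p B1]] Gt(2)[OF p] by simp
    then show "((\<lambda>s. v (x, s)) has_real_derivative Gt (x, t)) (at t)"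
      using DERIV_shift[of "\<lambda>s. v (x, s)" "Gt (x, t)" 0 t] by (simp add: add.commute)
    fix b :: 'a assume b: "b \<in> Basis"
    show "((\<lambda>h. v (x + h *\<^sub>R b, t)) has_real_derivative Gb b (x, t)) (at 0)"
      using pd_has_derivative[OF dif[OF p B(1)[OF b]]] Gb(2)[OF b p] by simp
    have "((\<lambda>h. pd (b, 0) v ((x, t) + h *\<^sub>R (b, 0))) has_real_derivative Hb b (x, t)) (at 0)"
      using pd_has_derivative[OF dif2[OF p B(1)[OF b]]] Hb(2)[OF b p] by simp
    moreover have "\<forall>\<^sub>F h in nhds 0. pd (b, 0) v ((x, t) + h *\<^sub>R (b, 0)) = Gb b (x + h *\<^sub>R b, t)"
      using eventually_line_in_open[OF open_interior p, of "(b, 0)"]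
      by (rule eventually_mono) (use Gb(2)[OF b] in auto)
    ultimately show "((\<lambda>h. Gb b (x + h *\<^sub>R b, t)) has_real_derivative Hb b (x, t)) (at 0)"
      using DERIV_cong_ev[of 0 0 "\<lambda>h. pd (b, 0) v ((x, t) + h *\<^sub>R (b, 0))" "\<lambda>h. Gb b (x + h *\<^sub>R b, t)" "Hb b (x, t)"]
      by simp
  qed
  then show ?thesis by blast
qed

section \<open>From quadrature bounds to residual norms, and the error bound\<close>

lemma sqrt_powr: "0 < x \<Longrightarrow> sqrt (x powr a) = x powr (a / 2)"
  by (simp add: powr_half_sqrt[symmetric] powr_powr)

text \<open>The quadrature constants are values of arbitrary real functions; their nonnegativity is
  forced by the bound, whose left-hand side is an absolute value. The estimate itself is the
  subadditivity of the square root.\<close>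

lemma sqrt_le_quad:
  assumes I: "\<bar>I - quad N w z (\<lambda>p. (R p)\<^sup>2)\<bar> \<le> C * real N powr (- \<alpha>)" and N: "N > 0"
    and w: "\<And>n. n < N \<Longrightarrow> 0 < w n"
  shows "sqrt I \<le> training_error N w z R + sqrt C * real N powr (- \<alpha> / 2)" and "0 \<le> C"
proof -
  have C: "0 \<le> C * real N powr (- \<alpha>)" using I abs_ge_zero order_trans by blast
  then show "0 \<le> C" using N by (simp add: zero_le_mult_iff)
  have "I \<le> quad N w z (\<lambda>p. \<bar>R p\<bar>\<^sup>2) + C * real N powr (- \<alpha>)" using I by simp
  then have "sqrt I \<le> sqrt (quad N w z (\<lambda>p. \<bar>R p\<bar>\<^sup>2) + C * real N powr (- \<alpha>))" by simp
  also have "\<dots> \<le> training_error N w z R + sqrt (C * real N powr (- \<alpha>))"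
  proof -
    have "0 \<le> quad N w z (\<lambda>p. \<bar>R p\<bar>\<^sup>2)"
      unfolding quad_def using w by (intro sum_nonneg mult_nonneg_nonneg) (auto intro: less_imp_le)
    then show ?thesis unfolding training_error_def by (rule sqrt_add_le_add_sqrt[OF _ C])
  qed
  finally show "sqrt I \<le> training_error N w z R + sqrt C * real N powr (- \<alpha> / 2)"
    using N by (simp add: real_sqrt_mult sqrt_powr)
qed

text \<open>The exact solution has zero residual, so the error solves the equation with source
  \<open>res_int f ustar\<close>. The energy estimate bounds it by three residual norms, and each
  quadrature bound trades one norm for a training error.\<close>

theorem theorem3p1:
  fixes D :: "'a::euclidean_space set"
    and \<sigma> :: "'a measure" and \<A> :: "'a chart set"
    and k :: nat and T Cf :: real
    and f :: "real \<Rightarrow> real" and ubar :: "'a \<Rightarrow> real" and u :: "'a \<times> real \<Rightarrow> real"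
    and act :: "real \<Rightarrow> real" and ns :: "nat list"
    and \<Theta> :: "(nat \<Rightarrow> real) set" and \<theta>s :: "nat \<Rightarrow> real"
    and N_tb N_sb N_int :: nat
    and w_tb w_sb w_int :: "nat \<Rightarrow> real"
    and x_tb :: "nat \<Rightarrow> 'a" and z_sb z_int :: "nat \<Rightarrow> 'a \<times> real"
    and \<alpha>_tb \<alpha>_sb \<alpha>_int :: real
    and Cq_tb Cq_sb Cq_int :: "real \<Rightarrow> real"
    and lam lam_reg :: real and J J_reg :: "(nat \<Rightarrow> real) \<Rightarrow> real"
    and ustar :: "'a \<times> real \<Rightarrow> real"
  \<comment> \<open>domain and data\<close>
  assumes k: "k \<ge> 2" and T: "T > 0"
    and D: "open D" "connected D" "bounded D" "Ck_boundary k D"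
    and \<sigma>: "surface_measure D \<sigma>"
    and \<A>: "boundary_atlas k D \<A>"
    and f: "\<And>v w. \<bar>f v - f w\<bar> \<le> Cf * \<bar>v - w\<bar>"
    and ubar: "Ck_on k D ubar"
    and u: "unique_classical_solution k D T f ubar u"
  \<comment> \<open>neural networks\<close>
    and act: "\<And>m. Ck_on m UNIV act"
    and ns: "length ns \<ge> 2" "\<And>n. n \<in> set ns \<Longrightarrow> n > 0" "hd ns = DIM('a \<times> real)" "last ns = 1"
    and \<Theta>: "\<Theta> \<subseteq> param_space (num_params ns)"
    and net_Ck: "\<And>\<theta>. \<theta> \<in> \<Theta> \<Longrightarrow> Ck_on k (closure D \<times> {0..T}) (network act ns \<theta>)"
    and res_Ck: "\<And>\<theta>. \<theta> \<in> \<Theta> \<Longrightarrow>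
        Ck_on (k - 2) (closure D \<times> {0..T}) (res_int f (network act ns \<theta>))"
  \<comment> \<open>training points and weights\<close>
    and tb: "N_tb > 0" "\<And>n. n < N_tb \<Longrightarrow> x_tb n \<in> D \<and> w_tb n > 0"
    and sb: "N_sb > 0" "\<And>n. n < N_sb \<Longrightarrow> z_sb n \<in> frontier D \<times> {0..T} \<and> w_sb n > 0"
    and int: "N_int > 0" "\<And>n. n < N_int \<Longrightarrow> z_int n \<in> D \<times> {0<..<T} \<and> w_int n > 0"
  \<comment> \<open>quadrature error bounds\<close>
    and \<alpha>: "\<alpha>_tb > 0" "\<alpha>_sb > 0" "\<alpha>_int > 0"
    and quad_tb: "\<And>g. Ck_bdd k D g \<Longrightarrow>
        \<bar>(LINT x:D|lborel. g x) - quad N_tb w_tb x_tb g\<bar>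
          \<le> Cq_tb (Ck_norm k D g) * real N_tb powr (- \<alpha>_tb)"
    and quad_sb: "\<And>g. Ck_lateral k \<A> T g \<Longrightarrow>
        \<bar>(LINT t:{0..T}|lborel. LINT x:frontier D|\<sigma>. g (x, t)) - quad N_sb w_sb z_sb g\<bar>
          \<le> Cq_sb (Ck_lateral_norm k \<A> T g) * real N_sb powr (- \<alpha>_sb)"
    and quad_int: "\<And>g. Ck_bdd (k - 2) (D \<times> {0..T}) g \<Longrightarrow>
        \<bar>(LINT t:{0..T}|lborel. LINT x:D|lborel. g (x, t)) - quad N_int w_int z_int g\<bar>
          \<le> Cq_int (Ck_norm (k - 2) (D \<times> {0..T}) g) * real N_int powr (- \<alpha>_int)"
  \<comment> \<open>the PINN algorithm\<close>
    and lam: "lam > 0" "lam_reg \<ge> 0"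
    and J: "\<And>\<theta>. J \<theta> =
        quad N_tb w_tb x_tb (\<lambda>x. \<bar>res_tb ubar (network act ns \<theta>) x\<bar>\<^sup>2)
        + quad N_sb w_sb z_sb (\<lambda>p. \<bar>res_sb (network act ns \<theta>) p\<bar>\<^sup>2)
        + lam * quad N_int w_int z_int (\<lambda>p. \<bar>res_int f (network act ns \<theta>) p\<bar>\<^sup>2)"
    and \<theta>s: "approx_local_minimizer (\<lambda>\<theta>. J \<theta> + lam_reg * J_reg \<theta>) \<Theta> \<theta>s"
    and ustar: "ustar = network act ns \<theta>s"
  shows
    "generalization_error D T u ustar \<le>
       const_1 T Cf *
        (training_error N_tb w_tb x_tb (res_tb ubar ustar)
         + training_error N_int w_int z_int (res_int f ustar)
         + const_2 D \<sigma> T u ustar * sqrt (training_error N_sb w_sb z_sb (res_sb ustar))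
         + sqrt (Cq_tb (Ck_norm k D (\<lambda>x. (res_tb ubar ustar x)\<^sup>2))) * real N_tb powr (- \<alpha>_tb / 2)
         + sqrt (Cq_int (Ck_norm (k - 2) (D \<times> {0..T}) (\<lambda>p. (res_int f ustar p)\<^sup>2)))
             * real N_int powr (- \<alpha>_int / 2)
         + const_2 D \<sigma> T u ustar
             * root 4 (Cq_sb (Ck_lateral_norm k \<A> T (\<lambda>p. (res_sb ustar p)\<^sup>2)))
             * real N_sb powr (- \<alpha>_sb / 4))"
proof -
  let ?K = "closure D" and ?Q = "closure D \<times> {0..T}"
  have D1: "Ck_boundary 1 D" using Ck_boundary_le[OF D(4)] k by simp
  have \<theta>: "\<theta>s \<in> \<Theta>" using \<theta>s by (simp add: approx_local_minimizer_def)
  have v: "Ck_on k ?Q ustar" using net_Ck[OF \<theta>] ustar by simp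
  have res: "Ck_on (k - 2) ?Q (res_int f ustar)" using res_Ck[OF \<theta>] ustar by simp
  have uC: "Ck_on k ?Q u" and u_eq: "\<And>x t. x \<in> D \<Longrightarrow> t \<in> {0<..<T} \<Longrightarrow> dt u (x, t) = laplacian u (x, t) + f (u (x, t))"
    and u0: "\<And>x. x \<in> D \<Longrightarrow> u (x, 0) = ubar x"
    and u_bd: "\<And>x t. x \<in> frontier D \<Longrightarrow> t \<in> {0<..<T} \<Longrightarrow> u (x, t) = 0"
    using u unfolding unique_classical_solution_def classical_solution_def by auto
  have cu: "continuous_on ?Q u" and cv: "continuous_on ?Q ustar" and cR: "continuous_on ?Q (res_int f ustar)"
    using uC v res by (simp_all add: Ck_on_iff)
  have Cf0: "0 \<le> Cf" using f[of 1 0] abs_ge_zero[of "f 1 - f 0"] by simp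
  have cf: "continuous_on UNIV f"
  proof (rule lipschitz_on_continuous_on)
    show "Cf-lipschitz_on UNIV f" using f Cf0 by (auto simp: lipschitz_on_def dist_real_def)
  qed
  \<comment> \<open>There is at least one initial training point, and it lies in
    \<open>D\<close>.\<close>
  have "D \<noteq> {}" using tb by blast
  \<comment> \<open>A bounded nonempty set has a boundary point. Both norms in \<open>G\<close>
    dominate gradient lengths there, which makes \<open>G\<close> nonnegative.\<close>
  obtain x1 where x1: "x1 \<in> frontier D"
    using frontier_not_empty[of D] \<open>D \<noteq> {}\<close> D(3) not_bounded_UNIV by blast
  obtain ut ub uh where "C2_extensions D T u ut ub uh"
    using C2_cylinder_extensions[OF D(1,3) \<open>D \<noteq> {}\<close> T k uC] by blast
  note ue = C2_extensionsD[OF this]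
  obtain vt vb vh where "C2_extensions D T ustar vt vb vh"
    using C2_cylinder_extensions[OF D(1,3) \<open>D \<noteq> {}\<close> T k v] by blast
  note ve = C2_extensionsD[OF this]
  define G where "G = C1_lateral_norm D T u + C1_lateral_norm D T ustar"
  have p1: "(x1, 0) \<in> frontier D \<times> {0..T}" using x1 T by simp
  have nonneg: "0 \<le> sqrt (\<Sum>b\<in>Basis. (g b)\<^sup>2)" for g :: "'a \<Rightarrow> real" by (simp add: sum_nonneg)
  have G0: "0 \<le> G"
    unfolding G_def using order_trans[OF nonneg ue(9)[OF p1]] order_trans[OF nonneg ve(9)[OF p1]] by simp
  interpret E: heat_energy D \<sigma> T Cf G "\<lambda>p. ustar p - u p" "\<lambda>p. vt p - ut p"
    "\<lambda>p. f (ustar p) - f (u p)" "res_int f ustar" "\<lambda>b p. vb b p - ub b p" "\<lambda>b p. vh b p - uh b p"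
  proof (rule heat_energy.intro[OF D(1,3) D1 \<sigma> T Cf0 G0])
    show "continuous_on ?Q (\<lambda>p. ustar p - u p)" "continuous_on ?Q (\<lambda>p. vt p - ut p)"
      by (intro continuous_intros cu cv ue ve)+
    show "continuous_on ?Q (\<lambda>p. f (ustar p) - f (u p))"
      by (intro continuous_intros continuous_on_compose2[OF cf] cu cv) auto
    show "continuous_on ?Q (res_int f ustar)" by (rule cR)
    show "continuous_on ?Q (\<lambda>p. vb b p - ub b p)" "continuous_on ?Q (\<lambda>p. vh b p - uh b p)" if "b \<in> Basis" for b
      by (intro continuous_intros ue ve that)+
    show "((\<lambda>s. ustar (x, s) - u (x, s)) has_real_derivative vt (x, t) - ut (x, t)) (at t)"
      if "x \<in> D" "t \<in> {0<..<T}" for x t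
      by (intro DERIV_diff ue ve that)
    show "((\<lambda>h. ustar (x + h *\<^sub>R b, t) - u (x + h *\<^sub>R b, t)) has_real_derivative vb b (x, t) - ub b (x, t)) (at 0)"
      "((\<lambda>h. vb b (x + h *\<^sub>R b, t) - ub b (x + h *\<^sub>R b, t)) has_real_derivative vh b (x, t) - uh b (x, t)) (at 0)"
      if "x \<in> D" "t \<in> {0<..<T}" "b \<in> Basis" for x t b
      by (intro DERIV_diff ue ve that)+
    show "vt (x, t) - ut (x, t) = (\<Sum>b\<in>Basis. vh b (x, t) - uh b (x, t)) + (f (ustar (x, t)) - f (u (x, t))) + res_int f ustar (x, t)"
      if "x \<in> D" "t \<in> {0<..<T}" for x t
      using u_eq[OF that]
      by (simp add: res_int_def ue(7)[OF that] ue(8)[OF that] ve(7)[OF that] ve(8)[OF that] sum_subtractf)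
    show "\<bar>f (ustar (x, t)) - f (u (x, t))\<bar> \<le> Cf * \<bar>ustar (x, t) - u (x, t)\<bar>" for x t
      by (rule f)
    show "sqrt (\<Sum>b\<in>Basis. (vb b (x, t) - ub b (x, t))\<^sup>2) \<le> G" if "x \<in> frontier D" "t \<in> {0..T}" for x t
    proof -
      have p: "(x, t) \<in> frontier D \<times> {0..T}" using that by simp
      have "sqrt (\<Sum>b\<in>Basis. (vb b (x, t) + - ub b (x, t))\<^sup>2) \<le>
          sqrt (\<Sum>b\<in>Basis. (vb b (x, t))\<^sup>2) + sqrt (\<Sum>b\<in>Basis. (- ub b (x, t))\<^sup>2)"
        using L2_set_triangle_ineq[of "\<lambda>b. vb b (x, t)" "\<lambda>b. - ub b (x, t)" Basis] by (simp add: L2_set_def)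
      then show ?thesis using ue(9)[OF p] ve(9)[OF p] by (simp add: G_def)
    qed
  qed
  define qt qi qs where "qt = Cq_tb (Ck_norm k D (\<lambda>x. (res_tb ubar ustar x)\<^sup>2))"
    and "qi = Cq_int (Ck_norm (k - 2) (D \<times> {0..T}) (\<lambda>p. (res_int f ustar p)\<^sup>2))"
    and "qs = Cq_sb (Ck_lateral_norm k \<A> T (\<lambda>p. (res_sb ustar p)\<^sup>2))"
  have gen: "generalization_error D T u ustar = sqrt E.energy"
  proof -
    have "continuous_on ?Q (\<lambda>p. (ustar p - u p)\<^sup>2)" by (intro continuous_intros cu cv)
    from Fubini_cylinder(2)[OF D(1,3) this order_refl] show ?thesis
      by (simp add: generalization_error_def E.energy_def power2_commute)
  qed
  have a_le: "E.initial_norm \<le> training_error N_tb w_tb x_tb (res_tb ubar ustar) + sqrt qt * real N_tb powr (- \<alpha>_tb / 2)"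
  proof -
    have cN: "Ck_ext k D ?K (\<lambda>x. ustar (x, 0))"
      by (rule Ck_ext_slice[OF D(1) T v])
    \<comment> \<open>\<open>ubar\<close> is assumed to be C^k on the open set \<open>D\<close>
      only. It agrees there with the trace of \<open>u\<close> and so inherits extensions of its
      derivatives to the closure, hence bounds for them.\<close>
    have cU: "Ck_ext k D ?K ubar"
      by (rule Ck_ext_cong[OF D(1) _ Ck_ext_slice[OF D(1) T uC]]) (rule u0)
    have "Ck_ext k D ?K (\<lambda>x. ustar (x, 0) + (- 1) * ubar x)"
      by (intro Ck_ext_add Ck_ext_mult Ck_ext_const D(1) cN cU)
    then have cr: "Ck_ext k D ?K (res_tb ubar ustar)" by (simp add: res_tb_def[abs_def])
    have cr2: "Ck_ext k D ?K (\<lambda>x. (res_tb ubar ustar x)\<^sup>2)"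
      unfolding power2_eq_square by (rule Ck_ext_mult[OF D(1) cr cr])
    have "continuous_on D (\<lambda>x. (res_tb ubar ustar x)\<^sup>2)"
    proof -
      obtain g where g: "continuous_on ?K g" "\<And>x. x \<in> D \<Longrightarrow> g x = (res_tb ubar ustar x)\<^sup>2"
        using Ck_ext_imp_extension[OF cr2] by blast
      show ?thesis
        by (rule continuous_on_eq[OF continuous_on_subset[OF g(1) closure_subset] g(2)])
    qed
    then have "Ck_bdd k D (\<lambda>x. (res_tb ubar ustar x)\<^sup>2)"
      using cr2 D(1,3) by (intro Ck_bddI[of _ _ _ ?K]) (auto simp: interior_open closure_subset)
    from quad_tb[OF this] have "sqrt (LBINT x:D. (res_tb ubar ustar x)\<^sup>2) \<le>
        training_error N_tb w_tb x_tb (res_tb ubar ustar) + sqrt qt * real N_tb powr (- \<alpha>_tb / 2)"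
      unfolding qt_def using tb by (intro sqrt_le_quad(1)) auto
    moreover have "E.initial_norm = sqrt (LBINT x:D. (res_tb ubar ustar x)\<^sup>2)"
      unfolding E.initial_norm_def using D(1)
      by (intro arg_cong[where f = sqrt] set_lebesgue_integral_cong) (auto simp: res_tb_def u0)
    ultimately show ?thesis by simp
  qed
  have b_le: "E.source_norm \<le> training_error N_int w_int z_int (res_int f ustar) + sqrt qi * real N_int powr (- \<alpha>_int / 2)"
  proof -
    have sub: "D \<times> {0..T} \<subseteq> ?Q" by (rule Sigma_mono) (auto intro: subsetD[OF closure_subset])
    have "Ck_ext (k - 2) (interior (D \<times> {0..T})) ?Q (res_int f ustar)"
      using res interior_mono[OF sub] by (auto simp: Ck_on_iff intro: Ck_ext_subset)
    then have "Ck_ext (k - 2) (interior (D \<times> {0..T})) ?Q (\<lambda>p. (res_int f ustar p)\<^sup>2)"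
      unfolding power2_eq_square by (intro Ck_ext_mult open_interior)
    moreover have cR2: "continuous_on ?Q (\<lambda>p. (res_int f ustar p)\<^sup>2)" by (intro continuous_intros cR)
    moreover have "compact ?Q" using D(3) by (intro compact_Times) auto
    ultimately have "Ck_bdd (k - 2) (D \<times> {0..T}) (\<lambda>p. (res_int f ustar p)\<^sup>2)"
      using continuous_on_subset[OF cR2 sub] sub by (intro Ck_bddI)
    from quad_int[OF this] have "sqrt (LBINT t:{0..T}. LBINT x:D. (res_int f ustar (x, t))\<^sup>2) \<le>
        training_error N_int w_int z_int (res_int f ustar) + sqrt qi * real N_int powr (- \<alpha>_int / 2)"
      unfolding qi_def using int by (intro sqrt_le_quad(1)) auto
    then show ?thesis
      by (simp add: E.source_norm_def Fubini_cylinder(2)[OF D(1,3) cR2 order_refl])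
  qed
  have c_le: "sqrt E.boundary_term \<le> const_2 D \<sigma> T u ustar * sqrt (training_error N_sb w_sb z_sb (res_sb ustar))
      + const_2 D \<sigma> T u ustar * root 4 qs * real N_sb powr (- \<alpha>_sb / 4)"
  proof -
    define S where "S = (LBINT t:{0..T}. LINT x:frontier D|\<sigma>. (res_sb ustar (x, t))\<^sup>2)"
    \<comment> \<open>The boundary condition is imposed on the open time interval; continuity of
      \<open>u\<close> gives it at 0 and T, so that V equals the lateral residual on all of
      \<open>frontier D \<times> {0..T}\<close>.\<close>
    have u_bd': "u (x, t) = 0" if x: "x \<in> frontier D" and t: "t \<in> {0..T}" for x t
    proof -
      have "x \<in> ?K" using x by (simp add: frontier_def)
      then have c: "continuous_on {0..T} (\<lambda>t. u (x, t))" by (rule continuous_on_slices(1)[OF cu])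
      have "u (x, t) \<le> 0" "0 \<le> u (x, t)"
        by (rule le_on_Icc_if_le_on_Ioo[OF c continuous_on_const T _ t], simp add: u_bd[OF x])
           (rule le_on_Icc_if_le_on_Ioo[OF continuous_on_const c T _ t], simp add: u_bd[OF x])
      then show ?thesis by simp
    qed
    have S: "(LBINT t:{0..T}. LINT x:frontier D|\<sigma>. (ustar (x, t) - u (x, t))\<^sup>2) = S"
      unfolding S_def
    proof (rule set_lebesgue_integral_cong)
      show "\<forall>t. t \<in> {0..T} \<longrightarrow> (LINT x:frontier D|\<sigma>. (ustar (x, t) - u (x, t))\<^sup>2) = (LINT x:frontier D|\<sigma>. (res_sb ustar (x, t))\<^sup>2)"
        by (intro allI impI set_lebesgue_integral_cong) (auto simp: E.sets_\<sigma> u_bd' res_sb_def)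
    qed simp
    have "Ck_lateral k \<A> T (\<lambda>p. (res_sb ustar p)\<^sup>2)"
      unfolding res_sb_def ustar by (rule Ck_lateral_network_square[OF act \<A>])
    note q = quad_sb[OF this, folded S_def qs_def]
    have S_le: "sqrt S \<le> training_error N_sb w_sb z_sb (res_sb ustar) + sqrt qs * real N_sb powr (- \<alpha>_sb / 2)"
      using q sb by (intro sqrt_le_quad(1)) auto
    have qs0: "0 \<le> qs" using sb by (intro sqrt_le_quad(2)[OF q]) auto
    have E0: "0 \<le> training_error N_sb w_sb z_sb (res_sb ustar)"
      unfolding training_error_def quad_def using sb
      by (intro real_sqrt_ge_zero sum_nonneg mult_nonneg_nonneg) (auto intro: less_imp_le)
    \<comment> \<open>The boundary term contains the root of the lateral integral and is itself
      under a root. The second root produces the exponent 1/2 on the training error and the fourth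
      root of the quadrature constant.\<close>
    have "sqrt (sqrt S) \<le> sqrt (training_error N_sb w_sb z_sb (res_sb ustar) + sqrt qs * real N_sb powr (- \<alpha>_sb / 2))"
      using S_le by simp
    also have "\<dots> \<le> sqrt (training_error N_sb w_sb z_sb (res_sb ustar)) + sqrt (sqrt qs * real N_sb powr (- \<alpha>_sb / 2))"
      using E0 qs0 by (intro sqrt_add_le_add_sqrt) auto
    also have "sqrt (sqrt qs * real N_sb powr (- \<alpha>_sb / 2)) = root 4 qs * real N_sb powr (- \<alpha>_sb / 4)"
    proof -
      have "root 4 qs = sqrt (sqrt qs)"
        using real_root_mult_exp[of 2 2 qs] by (simp add: sqrt_def)
      then show ?thesis using sb(1) by (simp add: real_sqrt_mult sqrt_powr)
    qed
    finally have le: "sqrt (sqrt S) \<le> sqrt (training_error N_sb w_sb z_sb (res_sb ustar)) + root 4 qs * real N_sb powr (- \<alpha>_sb / 4)" .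
    have "E.boundary_term = const_bdry D \<sigma> T u ustar * sqrt T * sqrt S"
      unfolding E.boundary_term_def S const_bdry_def G_def[symmetric] by simp
    then have "sqrt E.boundary_term = const_2 D \<sigma> T u ustar * sqrt (sqrt S)"
      by (simp add: const_2_def real_sqrt_mult)
    also have "\<dots> \<le> const_2 D \<sigma> T u ustar * (sqrt (training_error N_sb w_sb z_sb (res_sb ustar)) + root 4 qs * real N_sb powr (- \<alpha>_sb / 4))"
    proof (rule mult_left_mono[OF le])
      show "0 \<le> const_2 D \<sigma> T u ustar"
        using G0 T by (simp add: const_2_def const_bdry_def G_def)
    qed
    finally show ?thesis by (simp add: algebra_simps)
  qed
  have C1: "0 \<le> const_1 T Cf" using T Cf0 by (simp add: const_1_def)
  have "generalization_error D T u ustar \<le> const_1 T Cf * (E.initial_norm + E.source_norm + sqrt E.boundary_term)"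
    unfolding gen by (rule E.sqrt_energy_le)
  also have "\<dots> \<le> const_1 T Cf *
      ((training_error N_tb w_tb x_tb (res_tb ubar ustar) + sqrt qt * real N_tb powr (- \<alpha>_tb / 2))
       + (training_error N_int w_int z_int (res_int f ustar) + sqrt qi * real N_int powr (- \<alpha>_int / 2))
       + (const_2 D \<sigma> T u ustar * sqrt (training_error N_sb w_sb z_sb (res_sb ustar))
          + const_2 D \<sigma> T u ustar * root 4 qs * real N_sb powr (- \<alpha>_sb / 4)))"
    by (intro mult_left_mono add_mono a_le b_le c_le C1)
  finally show ?thesis
    by (simp add: qt_def qi_def qs_def algebra_simps)
qed

end
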